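(* Let $K(n)=\dfrac{\psi(\phi(n))}{\phi(\phi(n))}$. Then: (1) As $x\to\infty$, \[ \frac1x\sum_{n\le x}K(n)=\frac{6}{\pi^2}e^{2\gamma}(\log_3 x)^2+O\big((\log_3 x)^{3/2}\big). \] (2) On a set of positive integers $n$ of asymptotic density $1$, \[ K(n)=(1+o(1))\,\frac{6}{\pi^2}e^{2\gamma}(\log_3 n)^2 . \]
   Context: $\phi$ is Euler's totient function, $\phi(n)=n\prod_{p\mid n}(1-1/p)$, and $\psi$ is Dedekind's arithmetic function, $\psi(n)=n\prod_{p\mid n}(1+1/p)$; $p$ denotes primes. $\gamma$ is the Euler–Mascheroni constant. $\log_k x$ denotes the $k$-fold iterated logarithm, e.g. $\log_3 x=\log\log\log x$. *)

theory Defs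
  imports "HOL-Analysis.Analysis" "HOL-Number_Theory.Totient" "HOL-Library.Landau_Symbols"
begin

definition dedekind_psi :: "nat \<Rightarrow> real" where
  "dedekind_psi n = real n * (\<Prod>p\<in>prime_factors n. (1 + 1 / real p))"

definition K :: "nat \<Rightarrow> real" where
  "K n = dedekind_psi (totient n) / real (totient (totient n))"

definition log3 :: "real \<Rightarrow> real" where
  "log3 x = ln (ln (ln x))"

end

theory Submission
  imports Defs "HOL-Number_Theory.Number_Theory" "HOL-Real_Asymp.Real_Asymp"
begin

text \<open>
  For \<open>n > 0\<close> we have \<open>K n = (\<Prod>p | p dvd totient n. (p + 1) / (p - 1))\<close>. Write \<open>t = log3 x\<close>.
  For almost all \<open>n \<le> x\<close>, \<open>totient n\<close> is divisible by every prime \<open>p < y = exp (t - sqrt t)\<close>, and the primes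
  above \<open>exp (t + sqrt t)\<close> dividing \<open>totient n\<close> hardly matter, so that \<open>K n\<close> is close to
  \<open>(\<Prod>p<y. (p + 1) / (p - 1))\<close>, which Mertens' third theorem and \<open>\<zeta>(2)\<close> evaluate; the primes in between
  cost a relative error \<open>1 / sqrt t\<close>.

  Small primes: \<open>p\<close> divides \<open>totient n\<close> as soon as \<open>n\<close> has a prime factor \<open>q \<equiv> 1 (mod p)\<close>, and by Chebyshev's
  inequality the \<open>n\<close> without one have density \<open>O(1 / S)\<close>, where \<open>S\<close> is the sum of \<open>1 / q\<close> over these \<open>q \<le> x\<close>.
  The lower bound \<open>S \<ge> (ln (ln x) - O(p ln p)) / (2 p)\<close> follows Dirichlet's argument; the very weak
  bound \<open>\<bar>L(1,\<chi>)\<bar> \<ge> (2 p) powr (- 4 p)\<close> is all that is needed, since \<open>x\<close> is doubly exponential in \<open>p\<close>.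

  Large primes: the rational number \<open>(\<Prod>j=1..m. 1 + d * j) / fact m\<close> has only primes dividing \<open>d\<close> in its
  denominator and is divisible by all primes \<open>q \<equiv> 1 (mod d)\<close> in \<open>(m, d m + 1]\<close>. This gives
  \<open>O(ln d / d * ln (ln x))\<close> for the sum of their reciprocals, uniformly in \<open>d\<close>, without any sieve.
\<close>

section \<open>Dirichlet's test and Euler products\<close>

text \<open>A statement on almost all \<open>n\<close> would not control the mean, since few
  \<open>n\<close> with a large \<open>K n\<close> could dominate it. So both halves are drawn from
  one bound for the mean of the absolute deviation; Markov's inequality gives the second. From
  above, \<open>K\<close> is at most a constant times a multiplicative function of \<open>n\<close>,
  and expanding the mean of the latter produces primes \<open>q \<equiv> 1\<close> modulo every
  product of large primes: this forces an upper bound uniform in the modulus. Its factor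
  \<open>ln d\<close>, which a sieve would save, is affordable because
  \<open>ln (ln x) = exp t\<close> is multiplied by the sum of \<open>ln r / r^2\<close> over
  \<open>r > exp (t + sqrt t)\<close>, which leaves about \<open>t * exp (- sqrt t)\<close>. The
  small primes lose about \<open>exp (- sqrt t)\<close> as well. Both errors would still be small
  for a somewhat narrower gap; up to a constant, \<open>sqrt t\<close> is the widest one compatible
  with the error term \<open>t powr (3 / 2)\<close>. In the lower bound for
  \<open>L(1,\<chi>)\<close>, comparison with the point \<open>1 + 1 / N\<close> works only for
  characters that occur in conjugate pairs, so real characters need an argument of their
  own.\<close>

lemma norm_sum_scaleR_decreasing_le:
  fixes b :: "nat \<Rightarrow> 'a::real_normed_vector" and f :: "nat \<Rightarrow> real"
  assumes "m \<le> n"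
    and part: "\<And>k. m \<le> k \<Longrightarrow> k \<le> n \<Longrightarrow> norm (\<Sum>i=m..<k. b i) \<le> C"
    and dec: "\<And>k. m \<le> k \<Longrightarrow> f (Suc k) \<le> f k"
    and nonneg: "\<And>k. m \<le> k \<Longrightarrow> f k \<ge> 0"
  shows "norm (\<Sum>i=m..<n. f i *\<^sub>R b i) \<le> C * f m"
proof -
  define B where "B k = (\<Sum>i=m..<k. b i)" for k
  \<comment> \<open>Abel summation: the weights \<open>f i - f (Suc i)\<close> are nonnegative and
    telescope, so that only \<open>f m\<close> survives in the bound.\<close>
  have abel: "(\<Sum>i=m..<n. f i *\<^sub>R b i) = (\<Sum>i=m..<n. (f i - f (Suc i)) *\<^sub>R B (Suc i)) + f n *\<^sub>R B n"
    using assms(1)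
  proof (induction n rule: dec_induct)
    case base
    show ?case by (simp add: B_def)
  next
    case (step n)
    have "B (Suc n) = B n + b n" using step by (simp add: B_def)
    with step show ?case by (simp add: algebra_simps)
  qed
  have "norm (\<Sum>i=m..<n. (f i - f (Suc i)) *\<^sub>R B (Suc i)) \<le> (\<Sum>i=m..<n. (f i - f (Suc i)) * C)"
    by (intro order.trans[OF norm_sum] sum_mono)
       (auto simp: B_def dec simp del: sum.op_ivl_Suc intro!: mult_left_mono part)
  also have "\<dots> = C * (f m - f n)"
    using assms(1) by (simp add: sum_distrib_right[symmetric] sum_Suc_diff'[of m n "\<lambda>i. - f i", simplified])
  finally have "norm (\<Sum>i=m..<n. (f i - f (Suc i)) *\<^sub>R B (Suc i)) \<le> C * (f m - f n)" .
  moreover have "norm (f n *\<^sub>R B n) \<le> C * f n"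
    using nonneg[of n] part[of n] assms(1) by (simp add: B_def mult.commute[of C] mult_left_mono)
  ultimately have "norm (\<Sum>i=m..<n. f i *\<^sub>R b i) \<le> C * (f m - f n) + C * f n"
    unfolding abel by (intro order.trans[OF norm_triangle_ineq] add_mono)
  thus ?thesis by (simp add: algebra_simps)
qed

lemma norm_suminf_minus_partial_le:
  fixes g :: "nat \<Rightarrow> 'a::banach"
  assumes "summable g" "\<And>n. m \<le> n \<Longrightarrow> norm (\<Sum>i=m..<n. g i) \<le> B"
  shows "norm (suminf g - (\<Sum>n<m. g n)) \<le> B"
proof (rule tendsto_upperbound)
  show "(\<lambda>n. norm ((\<Sum>i<n. g i) - (\<Sum>n<m. g n))) \<longlonglongrightarrow> norm (suminf g - (\<Sum>n<m. g n))"
    by (intro tendsto_intros summable_LIMSEQ assms)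
  show "eventually (\<lambda>n. norm ((\<Sum>i<n. g i) - (\<Sum>n<m. g n)) \<le> B) sequentially"
    using eventually_ge_at_top[of m]
  proof eventually_elim
    case (elim n)
    have "(\<Sum>i<n. g i) - (\<Sum>n<m. g n) = (\<Sum>i=m..<n. g i)"
      using elim sum_diff_nat_ivl[of 0 m n g] by (simp add: lessThan_atLeast0)
    thus ?case using assms(2)[OF elim] by simp
  qed
qed auto

text \<open>The offset \<open>m0\<close> lets the weights take default values at small indices, such
  as \<open>1 / ln 1 = 0\<close> or \<open>0 powr (- s) = 0\<close>, which break monotonicity
  there.\<close>

lemma dirichlet_test:
  fixes b :: "nat \<Rightarrow> 'a::banach" and f :: "nat \<Rightarrow> real"
  assumes part: "\<And>m k. m0 \<le> m \<Longrightarrow> norm (\<Sum>i=m..<k. b i) \<le> C"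
    and dec: "\<And>k. m0 \<le> k \<Longrightarrow> f (Suc k) \<le> f k"
    and lim: "f \<longlonglongrightarrow> 0"
  shows "summable (\<lambda>n. f n *\<^sub>R b n)"
    and "m0 \<le> m \<Longrightarrow> norm ((\<Sum>n. f n *\<^sub>R b n) - (\<Sum>n<m. f n *\<^sub>R b n)) \<le> C * f m"
proof -
  have nonneg: "f k \<ge> 0" if "m0 \<le> k" for k
  proof (rule decseq_ge[of "\<lambda>i. f (i + k)" 0 0, simplified])
    show "decseq (\<lambda>i. f (i + k))" using that by (auto simp: decseq_Suc_iff dec)
    show "(\<lambda>i. f (i + k)) \<longlonglongrightarrow> 0" using lim by (simp add: LIMSEQ_ignore_initial_segment)
  qed
  have fin: "norm (\<Sum>i=m..<n. f i *\<^sub>R b i) \<le> C * f m" if "m0 \<le> m" for m n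
  proof (cases "m \<le> n")
    case True
    show ?thesis
      by (rule norm_sum_scaleR_decreasing_le[OF True]) (use that part dec nonneg in auto)
  next
    case False
    have "0 \<le> C" using part[of m0 m0] by simp
    thus ?thesis using False nonneg[OF that] by simp
  qed
  have "(\<lambda>m. C * f m) \<longlonglongrightarrow> 0" using tendsto_mult_left[OF lim, of C] by simp
  show summ: "summable (\<lambda>n. f n *\<^sub>R b n)"
    unfolding summable_Cauchy
  proof (intro allI impI)
    fix e :: real assume "e > 0"
    with \<open>(\<lambda>m. C * f m) \<longlonglongrightarrow> 0\<close> have "eventually (\<lambda>m. C * f m < e) sequentially"
      by (rule order_tendstoD)
    then obtain N where "\<And>m. m \<ge> N \<Longrightarrow> C * f m < e" by (auto simp: eventually_sequentially)
    hence "norm (\<Sum>i=m..<n. f i *\<^sub>R b i) < e" if "m \<ge> max N m0" for m n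
      using fin[of m n] that by force
    thus "\<exists>N. \<forall>m\<ge>N. \<forall>n. norm (\<Sum>i=m..<n. f i *\<^sub>R b i) < e" by blast
  qed
  show "norm ((\<Sum>n. f n *\<^sub>R b n) - (\<Sum>n<m. f n *\<^sub>R b n)) \<le> C * f m" if "m0 \<le> m"
    by (rule norm_suminf_minus_partial_le[OF summ fin[OF that]])
qed

lemma tendsto_suminf_regular:
  fixes c :: "nat \<Rightarrow> real" and f :: "nat \<Rightarrow> nat \<Rightarrow> real"
  assumes c: "summable c"
    and dec: "\<And>N k. f N (Suc k) \<le> f N k" and nonneg: "\<And>N k. f N k \<ge> 0"
    and le1: "\<And>N k. f N k \<le> 1" and summ: "\<And>N. summable (\<lambda>k. f N k * c k)"
    and lim: "\<And>k. (\<lambda>N. f N k) \<longlonglongrightarrow> 1"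
  shows "(\<lambda>N. \<Sum>k. f N k * c k) \<longlonglongrightarrow> (\<Sum>k. c k)"
proof (rule LIMSEQ_I)
  fix e :: real assume e: "e > 0"
  obtain M where M: "\<And>m n. m \<ge> M \<Longrightarrow> norm (\<Sum>i=m..<n. c i) < e / 4"
    using c[unfolded summable_Cauchy, rule_format, of "e / 4"] e by auto
  have tail: "norm (\<Sum>i=M..<n. f N i * c i) \<le> e / 4" if "M \<le> n" for n N
  proof -
    have "norm (\<Sum>i=M..<n. f N i *\<^sub>R c i) \<le> e / 4 * f N M"
      by (rule norm_sum_scaleR_decreasing_le[OF that]) (use M dec nonneg in \<open>auto intro: less_imp_le\<close>)
    also have "\<dots> \<le> e / 4 * 1" using e le1 by (intro mult_left_mono) auto
    finally show ?thesis by simp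
  qed
  have tail2: "norm ((\<Sum>k. f N k * c k) - (\<Sum>k<M. f N k * c k)) \<le> e / 4" for N
    by (rule norm_suminf_minus_partial_le[OF summ tail])
  have tail3: "norm ((\<Sum>k. c k) - (\<Sum>k<M. c k)) \<le> e / 4"
    using M by (intro norm_suminf_minus_partial_le[OF c]) (auto intro: less_imp_le)
  have "(\<lambda>N. \<Sum>k<M. f N k * c k) \<longlonglongrightarrow> (\<Sum>k<M. 1 * c k)"
    by (intro tendsto_intros lim)
  from LIMSEQ_D[OF this, of "e/4"] e obtain N0
    where N0: "\<And>N. N \<ge> N0 \<Longrightarrow> norm ((\<Sum>k<M. f N k * c k) - (\<Sum>k<M. c k)) < e / 4" by auto
  show "\<exists>no. \<forall>n\<ge>no. norm ((\<Sum>k. f n k * c k) - suminf c) < e"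
  proof (intro exI allI impI)
    fix N assume "N \<ge> N0"
    from N0[OF this] tail2[of N] tail3 show "norm ((\<Sum>k. f N k * c k) - suminf c) < e"
      using e unfolding real_norm_def by linarith
  qed
qed

lemma suminf_times_one_minus_prime:
  fixes f :: "nat \<Rightarrow> 'a::{real_normed_field,banach}"
  assumes mult: "\<And>m n. f (m * n) = f m * f n" and summ: "summable f" and q: "q > 0"
  shows "suminf f * (1 - f q) = (\<Sum>n. if q dvd n then 0 else f n)"
proof -
  have mono: "strict_mono (\<lambda>n. q * n)" using q by (auto simp: strict_mono_def)
  have sm: "(\<lambda>n. f (q * n)) sums (f q * suminf f)"
    unfolding mult by (intro sums_mult summable_sums summ)
  have eq: "(\<lambda>n. f (q * n)) = (\<lambda>n. (\<lambda>n. if q dvd n then f n else 0) (q * n))" by simp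
  have s2: "(\<lambda>n. if q dvd n then f n else 0) sums (f q * suminf f)"
    using sm unfolding eq by (subst (asm) sums_mono_reindex[OF mono]) auto
  have "(\<lambda>n. f n - (if q dvd n then f n else 0)) sums (suminf f - f q * suminf f)"
    by (intro sums_diff summable_sums summ s2)
  also have "(\<lambda>n. f n - (if q dvd n then f n else 0)) = (\<lambda>n. if q dvd n then 0 else f n)" by auto
  finally have s3: "(\<lambda>n. if q dvd n then 0 else f n) sums (suminf f - f q * suminf f)" .
  show "suminf f * (1 - f q) = (\<Sum>n. if q dvd n then 0 else f n)"
    using sums_unique[OF s3] by (simp add: algebra_simps)
qed

text \<open>Primes are sieved out one at a time. The sieved function \<open>g\<close> is again
  completely multiplicative, because a prime dividing a product divides a factor, and
  \<open>g r = f r\<close> because no other prime divides \<open>r\<close>; hence the one-prime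
  identity applies to \<open>g\<close>.\<close>

lemma suminf_times_prod_one_minus_prime:
  fixes f :: "nat \<Rightarrow> 'a::{real_normed_field,banach}"
  assumes mult: "\<And>m n. f (m * n) = f m * f n" and summ: "summable (\<lambda>n. norm (f n))"
    and A: "finite A" "\<And>q. q \<in> A \<Longrightarrow> prime q"
  shows "suminf f * (\<Prod>q\<in>A. 1 - f q) = (\<Sum>n. if \<exists>q\<in>A. q dvd n then 0 else f n)"
  using A
proof (induction A rule: finite_induct)
  case empty
  show ?case by simp
next
  case (insert r A)
  define g where "g n = (if \<exists>q\<in>A. q dvd n then 0 else f n)" for n
  have pr: "\<And>q. q \<in> A \<Longrightarrow> prime q" using insert by auto
  have gm: "g (m * n) = g m * g n" for m n
    using prime_dvd_mult_nat[OF pr] by (auto simp: g_def mult)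
  have "summable (\<lambda>n. norm (g n))"
    by (rule summable_comparison_test'[OF summ]) (auto simp: g_def)
  hence gs: "summable g" by (rule summable_norm_cancel)
  have "g r = f r" using insert by (auto simp: g_def dest!: primes_dvd_imp_eq[rotated 2])
  have "suminf f * (\<Prod>q\<in>insert r A. 1 - f q) = suminf g * (1 - g r)"
    using insert.IH[OF pr] insert.hyps \<open>g r = f r\<close> by (simp add: g_def[abs_def] algebra_simps)
  also have "\<dots> = (\<Sum>n. if r dvd n then 0 else g n)"
    using insert.prems prime_gt_0_nat by (intro suminf_times_one_minus_prime gm gs) auto
  also have "\<dots> = (\<Sum>n. if \<exists>q\<in>insert r A. q dvd n then 0 else f n)"
    by (intro suminf_cong) (auto simp: g_def)
  finally show ?case .
qed

text \<open>After sieving by all primes up to \<open>Q\<close>, only \<open>n = 1\<close> and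
  numbers above \<open>Q\<close> survive. The explicit error is wanted for the sum of inverse
  squares; \<open>max 1 Q\<close> keeps the index 1 among the split-off terms also when
  \<open>Q = 0\<close>.\<close>

lemma euler_product_error:
  fixes f :: "nat \<Rightarrow> 'a::{real_normed_field,banach}"
  assumes mult: "\<And>m n. f (m * n) = f m * f n" and "f 0 = 0" "f 1 = 1"
    and summ: "summable (\<lambda>n. norm (f n))"
  shows "norm (suminf f * (\<Prod>q | prime q \<and> q \<le> Q. 1 - f q) - 1) \<le> (\<Sum>n. norm (f (n + Suc (max 1 Q))))"
proof -
  define g where "g n = (if \<exists>q\<in>{q. prime q \<and> q \<le> Q}. q dvd n then 0 else f n)" for n
  have fin: "finite {q::nat. prime q \<and> q \<le> Q}" by (rule finite_subset[of _ "{..Q}"]) auto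
  have 1: "suminf f * (\<Prod>q | prime q \<and> q \<le> Q. 1 - f q) = suminf g"
    unfolding g_def by (intro suminf_times_prod_one_minus_prime mult summ fin) auto
  have gsn: "summable (\<lambda>n. norm (g n))"
    by (rule summable_comparison_test'[OF summ]) (auto simp: g_def)
  hence gs: "summable g" by (rule summable_norm_cancel)
  have g0: "g n = (if n = 1 then 1 else 0)" if "n < Suc (max 1 Q)" for n
  proof -
    consider "n = 0" | "n = 1" | "n > 1" by linarith
    thus ?thesis
    proof cases
      case 3
      then obtain q where "prime q" "q dvd n" using prime_factor_nat[of n] by auto
      moreover have "q \<le> n" using 3 \<open>q dvd n\<close> by (intro dvd_imp_le) auto
      ultimately show ?thesis using that 3 by (auto simp: g_def)
    next
      case 2
      have "\<not> (\<exists>q\<in>{q::nat. prime q \<and> q \<le> Q}. q dvd 1)" by (auto simp: not_prime_1)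
      thus ?thesis using 2 assms by (simp add: g_def)
    qed (auto simp: g_def assms)
  qed
  have "suminf g = (\<Sum>n. g (n + Suc (max 1 Q))) + (\<Sum>n<Suc (max 1 Q). g n)"
    by (rule suminf_split_initial_segment[OF gs])
  also have "(\<Sum>n<Suc (max 1 Q). g n) = (\<Sum>n<Suc (max 1 Q). if n = 1 then 1 else 0)"
    using g0 by (intro sum.cong) auto
  also have "\<dots> = 1" by simp
  finally have "suminf g - 1 = (\<Sum>n. g (n + Suc (max 1 Q)))" by simp
  also have "norm \<dots> \<le> (\<Sum>n. norm (g (n + Suc (max 1 Q))))"
    by (intro summable_norm summable_ignore_initial_segment gsn)
  also have "\<dots> \<le> (\<Sum>n. norm (f (n + Suc (max 1 Q))))"
    by (intro suminf_le summable_ignore_initial_segment gsn summ) (auto simp: g_def)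
  finally show ?thesis by (simp add: 1)
qed

lemma euler_product_tendsto:
  fixes f :: "nat \<Rightarrow> 'a::{real_normed_field,banach}"
  assumes mult: "\<And>m n. f (m * n) = f m * f n" and "f 0 = 0" "f 1 = 1"
    and summ: "summable (\<lambda>n. norm (f n))"
  shows "(\<lambda>Q. suminf f * (\<Prod>q | prime q \<and> q \<le> Q. 1 - f q)) \<longlonglongrightarrow> 1"
proof -
  have "(\<lambda>m. \<Sum>n. norm (f (n + m))) \<longlonglongrightarrow> 0" by (rule suminf_exist_split2[OF summ])
  moreover have "filterlim (\<lambda>Q. Suc (max 1 Q)) at_top sequentially"
    by (rule filterlim_at_top_mono[OF filterlim_ident]) (auto intro!: always_eventually)
  ultimately have "(\<lambda>Q. \<Sum>n. norm (f (n + Suc (max 1 Q)))) \<longlonglongrightarrow> 0"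
    by (rule filterlim_compose)
  hence "(\<lambda>Q. suminf f * (\<Prod>q | prime q \<and> q \<le> Q. 1 - f q) - 1) \<longlonglongrightarrow> 0"
    by (rule Lim_null_comparison[rotated])
       (intro always_eventually allI euler_product_error assms)
  thus ?thesis by (simp add: LIM_zero_iff)
qed

section \<open>Estimates of Chebyshev and Mertens\<close>

text \<open>The substitution \<open>n = d * m\<close>. The summand depends on both factors because
  the same rearrangement serves \<open>ln (fact N)\<close>, the twisted logarithmic sums and the
  Lambert series.\<close>

lemma sum_divisors_swap:
  fixes F :: "nat \<Rightarrow> nat \<Rightarrow> 'a::comm_monoid_add"
  shows "(\<Sum>n=1..N. \<Sum>d | d dvd n. F d (n div d)) = (\<Sum>d=1..N. \<Sum>m=1..N div d. F d m)"
proof -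
  have "(\<Sum>n=1..N. \<Sum>d | d dvd n. F d (n div d)) = (\<Sum>(n,d)\<in>(SIGMA n:{1..N}. {d. d dvd n}). F d (n div d))"
    by (subst sum.Sigma) auto
  also have "\<dots> = (\<Sum>(d,m)\<in>(SIGMA d:{1..N}. {1..N div d}). F d m)"
  proof (rule sum.reindex_bij_witness[of _ "\<lambda>(d,m). (d * m, d)" "\<lambda>(n,d). (d, n div d)"])
    fix x assume "x \<in> (SIGMA n:{1..N}. {d. d dvd n})"
    then obtain n d where x: "x = (n, d)" "n > 0" "n \<le> N" "d dvd n" by auto
    have "d > 0" "d \<le> n" using x by (auto intro: dvd_pos_nat dvd_imp_le)
    moreover have "n div d > 0" using x by (auto simp: div_greater_zero_iff dvd_imp_le dvd_pos_nat)
    moreover have "n div d \<le> N div d" using x by (intro div_le_mono)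
    ultimately show "(case x of (n, d) \<Rightarrow> (d, n div d)) \<in> (SIGMA d:{1..N}. {1..N div d})"
      using x by auto
  qed (auto simp: less_eq_div_iff_mult_less_eq mult.commute)
  also have "\<dots> = (\<Sum>d=1..N. \<Sum>m=1..N div d. F d m)"
    by (subst sum.Sigma) auto
  finally show ?thesis .
qed

lemma ln_fact_eq_sum_mangoldt: "ln (fact N :: real) = (\<Sum>d=1..N. mangoldt d * real (N div d))"
proof -
  have "ln (fact N :: real) = (\<Sum>n=1..N. ln (real n))"
    by (induction N) (auto simp: ln_mult add.commute)
  also have "\<dots> = (\<Sum>n=1..N. \<Sum>d | d dvd n. mangoldt d)"
    by (intro sum.cong refl, subst mangoldt_sum) auto
  also have "\<dots> = (\<Sum>d=1..N. \<Sum>m=1..N div d. mangoldt d)"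
    by (rule sum_divisors_swap[of "\<lambda>d _. mangoldt d"])
  finally show ?thesis by (simp add: mult.commute)
qed

lemma ln_fact_le: "ln (fact N :: real) \<le> real N * ln (real N)"
proof -
  have "ln (fact N :: real) \<le> ln (real N ^ N)"
    by (cases "N = 0") (use fact_le_power[of N, where 'a = real] in \<open>auto intro!: ln_mono\<close>)
  thus ?thesis by (cases "N = 0") (auto simp: ln_realpow)
qed

text \<open>\<open>N ^ N / fact N\<close> is a single term of the exponential series at
  \<open>N\<close>, hence at most \<open>exp N\<close>.\<close>

lemma ln_fact_ge: 
  assumes "N > 0"
  shows "ln (fact N :: real) \<ge> real N * ln (real N) - real N"
proof -
  have s: "(\<lambda>n. inverse (fact n) * real N ^ n) sums exp (real N)"
    using exp_converges[of "real N"] by simp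
  have "(\<Sum>n\<in>{N}. inverse (fact n) * real N ^ n) \<le> exp (real N)"
    by (rule sum_le_suminf[OF sums_summable[OF s], of "{N}", folded sums_unique[OF s]]) auto
  hence "real N ^ N \<le> exp (real N) * fact N" by (simp add: field_simps)
  hence "ln (real N ^ N) \<le> ln (exp (real N) * fact N)" using assms by (intro ln_mono) auto
  thus ?thesis using assms by (simp add: ln_realpow ln_mult)
qed

text \<open>Halving: every \<open>n\<close> in \<open>(N/2, N]\<close> has coefficient 1 in
  \<open>ln (fact N) - 2 * ln (fact (N div 2))\<close>, so this difference bounds the increment of
  the sum. It is at most \<open>2 * ln 2 * N\<close>; together with the induction hypothesis at half
  the size this gives the constant \<open>4 * ln 2\<close>, which is below 3.\<close>

lemma chebyshev_psi_le: "(\<Sum>n=1..N. mangoldt n) \<le> (3 * real N :: real)"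
proof -
  have "(\<Sum>n=1..N. mangoldt n) \<le> (4 * ln 2 * real N :: real)"
  proof (induction N rule: less_induct)
    case (less N)
    show ?case
    proof (cases "N = 0")
      case False
      define h where "h = N div 2"
      have h: "h < N" "2 * real h \<le> real N" using False by (auto simp: h_def)
      have "(\<Sum>n=1..N. mangoldt n) - (\<Sum>n=1..h. mangoldt n) = (\<Sum>n=h+1..N. mangoldt n :: real)"
      proof -
        have "{1..N} = {1..h} \<union> {h+1..N}" using h by auto
        hence "(\<Sum>n=1..N. mangoldt n) = (\<Sum>n=1..h. mangoldt n) + (\<Sum>n=h+1..N. mangoldt n :: real)"
          by (simp only:) (rule sum.union_disjoint, auto)
        thus ?thesis by simp
      qed
      also have "\<dots> = (\<Sum>n=h+1..N. mangoldt n * (real (N div n) - 2 * real (h div n)))"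
      proof (intro sum.cong refl)
        fix n assume "n \<in> {h+1..N}"
        hence "n \<le> N" "N < 2 * n" "h < n" by (auto simp: h_def)
        hence "N div n = 1" "h div n = 0" by (auto intro!: div_nat_eqI)
        thus "mangoldt n = mangoldt n * (real (N div n) - 2 * real (h div n))" by simp
      qed
      also have "\<dots> \<le> (\<Sum>n=1..N. mangoldt n * (real (N div n) - 2 * real (h div n)))"
      proof (intro sum_mono2 mult_nonneg_nonneg mangoldt_nonneg)
        fix n
        \<comment> \<open>The other coefficients are nonnegative, as twice a floor is at most the
          floor of the double.\<close>
        have "2 * (h div n) \<le> N div n"
          unfolding h_def by (simp add: div_mult2_eq[symmetric] mult.commute[of 2 n])
             (metis div_mult2_eq div_times_less_eq_dividend mult.commute)
        thus "0 \<le> real (N div n) - 2 * real (h div n)" by linarith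
      qed auto
      also have "\<dots> = ln (fact N) - 2 * (\<Sum>n=1..N. mangoldt n * real (h div n))"
        unfolding ln_fact_eq_sum_mangoldt by (simp add: algebra_simps sum_subtractf sum_distrib_left)
      also have "(\<Sum>n=1..N. mangoldt n * real (h div n)) = ln (fact h)"
        unfolding ln_fact_eq_sum_mangoldt using h by (intro sum.mono_neutral_right) auto
      also have "ln (fact N) - 2 * ln (fact h) \<le> 2 * real N * ln 2"
      proof -
        have "(fact N :: real) \<le> 4 ^ N * (fact h)\<^sup>2"
        proof -
          have "fact N = (N choose h) * fact h * fact (N - h)"
            using binomial_fact_lemma[of h N] h by (simp add: mult_ac)
          \<comment> \<open>For odd \<open>N\<close> the complementary factor is
            \<open>fact (h + 1)\<close>; bounding the additional \<open>h + 1\<close> by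
            \<open>2 ^ N\<close> is what makes the result \<open>4 ^ N\<close> instead of
            \<open>2 ^ N\<close>.\<close>
          also have "fact (N - h) \<le> (h + 1) * fact h"
            by (cases "even N") (auto simp: h_def elim!: evenE oddE)
          also have "(N choose h) * fact h * ((h + 1) * fact h) = ((N choose h) * (h + 1)) * (fact h)\<^sup>2"
            by (simp add: power2_eq_square algebra_simps)
          also have "(N choose h) * (h + 1) \<le> 2 ^ N * 2 ^ N"
          proof (intro mult_mono)
            show "N choose h \<le> 2 ^ N" by (rule binomial_le_pow2)
            have "h + 1 \<le> N" if "N \<ge> 2" using that by (auto simp: h_def)
            moreover have "N < 2 ^ N" by (rule less_exp)
            ultimately show "h + 1 \<le> 2 ^ N" using h False by linarith
          qed auto
          also have "2 ^ N * 2 ^ N = (4 ^ N :: nat)" by (simp flip: power_mult_distrib)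
          finally have "fact N \<le> 4 ^ N * (fact h :: nat)\<^sup>2" by simp
          hence "real (fact N) \<le> real (4 ^ N * (fact h)\<^sup>2)" by (simp only: of_nat_le_iff)
          thus ?thesis by simp
        qed
        hence "ln (fact N :: real) \<le> ln (4 ^ N * (fact h)\<^sup>2)" by (intro ln_mono) auto
        also have "\<dots> = real N * ln 4 + 2 * ln (fact h)" by (simp add: ln_mult ln_realpow)
        also have "ln (4::real) = 2 * ln 2" using ln_realpow[of 2 2] by simp
        finally show ?thesis by (simp add: algebra_simps)
      qed
      finally have "(\<Sum>n=1..N. mangoldt n) \<le> (\<Sum>n=1..h. mangoldt n) + 2 * real N * ln 2" by simp
      also have "(\<Sum>n=1..h. mangoldt n) \<le> 4 * ln 2 * real h" by (rule less.IH) (use h in auto)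
      also have "4 * ln 2 * real h \<le> 2 * ln 2 * real N" using h(2) by (simp add: algebra_simps)
      finally show ?thesis by (simp add: algebra_simps)
    qed auto
  qed
  also have "4 * ln 2 * real N \<le> 3 * real N"
    using ln2_le_25_over_36 by (intro mult_right_mono) auto
  finally show ?thesis .
qed

text \<open>\<open>ln (fact N)\<close> is the sum of \<open>mangoldt n\<close> times the floor of
  \<open>N / n\<close>. Removing the floor raises this by at most the Chebyshev sum,
  \<open>3 * N\<close>; in the other direction the floor only helps, and the loss is the
  \<open>N\<close> of the factorial estimate.\<close>

lemma mertens_first_mangoldt:
  assumes "N > 0"
  shows "\<bar>(\<Sum>n=1..N. mangoldt n / real n) - ln (real N)\<bar> \<le> 3"
proof -
  have up: "real N * (\<Sum>n=1..N. mangoldt n / real n) \<le> real N * ln N + 3 * real N"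
  proof -
    have "real N * (\<Sum>n=1..N. mangoldt n / real n) \<le> (\<Sum>n=1..N. mangoldt n * (real (N div n) + 1))"
      unfolding sum_distrib_left
    proof (intro sum_mono)
      fix n assume n: "n \<in> {1..N}"
      have "N \<le> n * (N div n) + n" using n mod_less_divisor[of n N] div_mult_mod_eq[of N n]
        by (metis add_mono_thms_linordered_semiring(2) atLeastAtMost_iff less_imp_le_nat less_le_trans mult.commute zero_less_one)
      hence "real N \<le> real n * (real (N div n) + 1)"
        by (simp add: algebra_simps flip: of_nat_mult of_nat_add)
      hence "real N / real n \<le> real (N div n) + 1" using n by (simp add: field_simps)
      hence "mangoldt n * (real N / real n) \<le> mangoldt n * (real (N div n) + 1)"
        by (intro mult_left_mono mangoldt_nonneg)
      thus "real N * (mangoldt n / real n) \<le> mangoldt n * (real (N div n) + 1)" by (simp add: mult_ac)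
    qed
    also have "\<dots> = ln (fact N) + (\<Sum>n=1..N. mangoldt n)"
      by (simp add: ln_fact_eq_sum_mangoldt algebra_simps sum.distrib)
    also have "\<dots> \<le> real N * ln N + 3 * real N" by (intro add_mono ln_fact_le chebyshev_psi_le)
    finally show ?thesis .
  qed
  have lo: "real N * (\<Sum>n=1..N. mangoldt n / real n) \<ge> real N * ln N - real N"
  proof -
    have "real N * ln N - real N \<le> (\<Sum>n=1..N. mangoldt n * real (N div n))"
      using ln_fact_ge[OF assms] by (simp add: ln_fact_eq_sum_mangoldt)
    also have "\<dots> \<le> (\<Sum>n=1..N. mangoldt n * (real N / real n))"
      by (intro sum_mono mult_left_mono mangoldt_nonneg of_nat_div_le_of_nat)
    finally show ?thesis by (simp add: sum_distrib_left mult_ac)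
  qed
  from up assms have "(\<Sum>n=1..N. mangoldt n / real n) \<le> ln N + 3"
    by (simp flip: distrib_left add: mult.commute[of 3])
  moreover from lo assms have "(\<Sum>n=1..N. mangoldt n / real n) \<ge> ln N - 1"
    by (metis mult.right_neutral mult_le_cancel_left_pos of_nat_0_less_iff right_diff_distrib)
  ultimately show ?thesis by linarith
qed

text \<open>An antiderivative of \<open>ln x / x^2\<close> is \<open>- (ln x + 1) / x\<close>. The
  constant 2 in place of 1 leaves room for the difference between sum and integral.\<close>

lemma ln_div_telescope:
  assumes "n \<ge> 2"
  shows "ln (real n) / (real n * (real n - 1)) \<le> (ln (real n - 1) + 2) / (real n - 1) - (ln (real n) + 2) / real n"
proof -
  have "ln (real n / (real n - 1)) \<le> real n / (real n - 1) - 1"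
    using assms by (intro ln_le_minus_one) auto
  also have "ln (real n / (real n - 1)) = ln (real n) - ln (real n - 1)" using assms by (simp add: ln_div)
  also have "real n / (real n - 1) - 1 = 1 / (real n - 1)" using assms by (simp add: field_simps)
  finally have "real n * (ln (real n) - ln (real n - 1)) \<le> real n * (1 / (real n - 1))"
    by (intro mult_left_mono) auto
  also have "\<dots> \<le> 2" using assms by (simp add: field_simps)
  finally have "ln (real n) \<le> real n * (ln (real n - 1) + 2) - (real n - 1) * (ln (real n) + 2)"
    by (simp add: algebra_simps)
  hence "ln (real n) / (real n * (real n - 1)) \<le>
     (real n * (ln (real n - 1) + 2) - (real n - 1) * (ln (real n) + 2)) / (real n * (real n - 1))"
    using assms by (intro divide_right_mono) auto
  also have "\<dots> = (ln (real n - 1) + 2) / (real n - 1) - (ln (real n) + 2) / real n"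
    using assms by (simp add: divide_simps)
  finally show ?thesis .
qed

lemma sum_ln_div_square_le:
  assumes "m \<ge> 1"
  shows "(\<Sum>n=m+1..N. ln (real n) / (real n * (real n - 1))) \<le> (ln (real m) + 2) / real m"
proof (cases "m \<le> N")
  case True
  have "(\<Sum>n=m+1..N. ln (real n) / (real n * (real n - 1))) \<le> (ln (real m) + 2) / real m - (ln (real N) + 2) / real N"
    using True
  proof (induction N rule: dec_induct)
    case (step N)
    have "ln (real (Suc N)) / (real (Suc N) * (real (Suc N) - 1))
       \<le> (ln (real N) + 2) / real N - (ln (real (Suc N)) + 2) / real (Suc N)"
      using ln_div_telescope[of "Suc N"] step assms by simp
    with step show ?case by (simp del: of_nat_Suc)
  qed auto
  moreover have "(ln (real N) + 2) / real N \<ge> 0" using True assms by auto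
  ultimately show ?thesis by linarith
next
  case False
  thus ?thesis using assms by auto
qed

text \<open>For each prime the powers with exponent at least 2 contribute no more than the geometric
  series \<open>ln p / (p * (p - 1))\<close>; enlarging the sum over primes to all integers from 2
  on makes it telescope, to the value 2.\<close>

lemma sum_nonprime_mangoldt_le:
  "(\<Sum>n | n \<in> {1..N} \<and> \<not> prime n. mangoldt n / real n) \<le> 2"
proof -
  define A where "A = {n \<in> {1..N}. \<not> prime n \<and> primepow n}"
  define P where "P = {p. prime p \<and> p \<le> N}"
  have finP: "finite P" unfolding P_def by (rule finite_subset[of _ "{..N}"]) auto
  have sub: "A \<subseteq> (\<lambda>(p,k). p ^ k) ` (P \<times> {2..N})"
  proof
    fix n assume "n \<in> A"
    then obtain p k where pk: "prime p" "k > 0" "n = p ^ k" "\<not> prime n" "n \<le> N"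
      by (auto simp: A_def primepow_def)
    have "k \<noteq> 1" using pk by auto
    \<comment> \<open>This puts the exponent into \<open>{2..N}\<close>, so that a finite rectangle
      of pairs covers all prime powers in question.\<close>
    moreover have "k < p ^ k" by (rule power_gt_expt) (use prime_gt_1_nat[OF pk(1)] in auto)
    moreover have "p \<le> p ^ k" using pk prime_gt_0_nat[of p] by (intro self_le_power) auto
    ultimately show "n \<in> (\<lambda>(p,k). p ^ k) ` (P \<times> {2..N})"
      using pk by (auto simp: P_def intro!: image_eqI[of _ _ "(p,k)"])
  qed
  have "(\<Sum>n | n \<in> {1..N} \<and> \<not> prime n. mangoldt n / real n) = (\<Sum>n\<in>A. mangoldt n / real n)"
    by (intro sum.mono_neutral_right) (auto simp: A_def mangoldt_def)
  also have "\<dots> \<le> (\<Sum>n\<in>(\<lambda>(p,k). p ^ k) ` (P \<times> {2..N}). mangoldt n / real n)"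
    using finP by (intro sum_mono2 sub) (auto simp: mangoldt_nonneg)
  also have "\<dots> \<le> (\<Sum>x\<in>P \<times> {2..N}. ((\<lambda>n. mangoldt n / real n) \<circ> (\<lambda>(p,k). p ^ k)) x)"
    using finP by (intro sum_image_le) (auto simp: mangoldt_nonneg)
  also have "\<dots> = (\<Sum>p\<in>P. \<Sum>k=2..N. ln (real p) / real p ^ k)"
    unfolding sum.cartesian_product by (intro sum.cong) (auto simp: P_def mangoldt_primepow)
  also have "\<dots> \<le> (\<Sum>p\<in>P. ln (real p) / (real p * (real p - 1)))"
  proof (intro sum_mono)
    fix p assume "p \<in> P"
    hence p: "p \<ge> 2" by (auto simp: P_def prime_ge_2_nat)
    have "(\<Sum>k=2..N. (1 / real p) ^ k) \<le> 1 / (real p * (real p - 1))"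
    proof (cases "N < 2")
      case False
      have "(\<Sum>k=2..N. (1 / real p) ^ k) = ((1 / real p)^2 - (1 / real p) ^ Suc N) / (1 - 1 / real p)"
        using False p by (subst sum_gp) auto
      also have "\<dots> \<le> (1 / real p)^2 / (1 - 1 / real p)"
        using p by (intro divide_right_mono) auto
      also have "\<dots> = 1 / (real p * (real p - 1))" using p by (simp add: field_simps power2_eq_square)
      finally show ?thesis .
    qed (use p in auto)
    hence "ln (real p) * (\<Sum>k=2..N. (1 / real p) ^ k) \<le> ln (real p) * (1 / (real p * (real p - 1)))"
      using p by (intro mult_left_mono) auto
    thus "(\<Sum>k=2..N. ln (real p) / real p ^ k) \<le> ln (real p) / (real p * (real p - 1))"
      by (simp add: sum_distrib_left power_divide)
  qed
  also have "\<dots> \<le> (\<Sum>n=1+1..N. ln (real n) / (real n * (real n - 1)))"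
    by (intro sum_mono2) (auto simp: P_def numeral_2_eq_2[symmetric] prime_ge_2_nat)
  also have "\<dots> \<le> (ln (real 1) + 2) / real 1" by (rule sum_ln_div_square_le) auto
  finally show ?thesis by simp
qed

lemma mertens_first_primes:
  assumes "N > 0"
  shows "\<bar>(\<Sum>n=1..N. if prime n then ln (real n) / real n else 0) - ln (real N)\<bar> \<le> 5"
proof -
  have "(\<Sum>n=1..N. mangoldt n / real n) =
     (\<Sum>n | n \<in> {1..N} \<and> prime n. mangoldt n / real n) + (\<Sum>n | n \<in> {1..N} \<and> \<not> prime n. mangoldt n / real n)"
    by (subst sum.union_disjoint [symmetric]) (auto intro!: sum.cong)
  also have "(\<Sum>n | n \<in> {1..N} \<and> prime n. mangoldt n / real n) = (\<Sum>n=1..N. if prime n then ln (real n) / real n else 0)"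
    by (subst sum.inter_filter) (auto intro!: sum.cong)
  moreover have "(\<Sum>n | n \<in> {1..N} \<and> \<not> prime n. mangoldt n / real n) \<ge> 0"
    by (intro sum_nonneg) (auto simp: mangoldt_nonneg)
  ultimately show ?thesis using sum_nonprime_mangoldt_le[of N] mertens_first_mangoldt[OF assms] by linarith
qed

section \<open>Primes congruent to 1 modulo d: an upper bound from divisibility by
  factorials\<close>

text \<open>Legendre's count in recursive form: only the multiples of \<open>r\<close> contribute,
  which gives \<open>q + multiplicity r (fact q)\<close> with \<open>q = m div r\<close>, and
  \<open>2 * q \<le> m\<close>.\<close>

lemma multiplicity_fact_le:
  fixes r :: nat
  assumes r: "prime r"
  shows "multiplicity r (fact m) \<le> m"
proof (induction m rule: less_induct)
  case (less m)
  show ?case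
  proof (cases "m = 0")
    case False
    define q where "q = m div r"
    have r2: "r \<ge> 2" using r by (rule prime_ge_2_nat)
    have q: "q < m" "2 * q \<le> m" unfolding q_def using r2 False
      by (auto intro: order.trans[OF mult_le_mono1[OF r2]])
    have mf: "multiplicity r (fact n) = (\<Sum>j=1..n. multiplicity r j)" for n
      using r by (induction n) (auto simp: prime_elem_multiplicity_mult_distrib simp del: mult_Suc)
    have "multiplicity r (fact m) = (\<Sum>j=1..m. multiplicity r j)" by (rule mf)
    also have "\<dots> = (\<Sum>j\<in>(\<lambda>i. r * i) ` {1..q}. multiplicity r j)"
    proof (rule sum.mono_neutral_right)
      show "(*) r ` {1..q} \<subseteq> {1..m}" using r2 
        by (auto simp: q_def less_eq_div_iff_mult_less_eq mult.commute)
      show "\<forall>i\<in>{1..m} - (*) r ` {1..q}. multiplicity r i = 0"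
      proof
        fix i assume i: "i \<in> {1..m} - (*) r ` {1..q}"
        have "\<not> r dvd i"
        proof
          assume "r dvd i"
          then obtain j where "i = r * j" by auto
          with i r2 show False by (auto simp: q_def less_eq_div_iff_mult_less_eq mult.commute image_iff)
        qed
        thus "multiplicity r i = 0" by (rule not_dvd_imp_multiplicity_0)
      qed
    qed auto
    also have "\<dots> = (\<Sum>i=1..q. multiplicity r (r * i))"
      using r2 by (subst sum.reindex) (auto simp: inj_on_def)
    also have "\<dots> = (\<Sum>i=1..q. 1 + multiplicity r i)"
      using r r2 by (intro sum.cong) (auto simp: prime_elem_multiplicity_mult_distrib prime_imp_prime_elem)
    also have "\<dots> = q + multiplicity r (fact q)" by (simp only: mf sum.distrib) simp
    also have "multiplicity r (fact q) \<le> q" by (rule less.IH[OF q(1)])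
    finally show ?thesis using q(2) by linarith
  qed auto
qed

text \<open>This is checked at one prime \<open>r\<close> at a time. If \<open>r\<close> divides
  \<open>d\<close>, the factor \<open>d ^ m\<close> alone contains enough powers of
  \<open>r\<close>. Otherwise \<open>d\<close> has an inverse \<open>e\<close> modulo
  \<open>r ^ k\<close>, and the product is congruent to \<open>d ^ m\<close> times the product of
  the \<open>m\<close> consecutive numbers \<open>e + 1, ..., e + m\<close>, which
  \<open>fact m\<close> divides.\<close>

lemma fact_dvd_prod_arith_progression:
  fixes d m :: nat
  assumes d: "d > 0"
  shows "fact m dvd d ^ m * (\<Prod>j=1..m. 1 + d * j)"
proof (rule multiplicity_le_imp_dvd)
  fix r :: nat assume r: "prime r"
  define P where "P = (\<Prod>j=1..m. 1 + d * j)"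
  have nz: "d ^ m * P \<noteq> 0" using d by (auto simp: P_def)
  show "multiplicity r (fact m :: nat) \<le> multiplicity r (d ^ m * (\<Prod>j=1..m. 1 + d * j))"
  proof (cases "r dvd d")
    case True
    have "r ^ m dvd d ^ m * P" using True by (intro dvd_mult2 dvd_power_same)
    hence "m \<le> multiplicity r (d ^ m * P)" 
      using nz r by (intro multiplicity_geI) (auto simp: not_prime_unit)
    with multiplicity_fact_le[OF r, of m] show ?thesis by (simp add: P_def)
  next
    case False
    define k where "k = multiplicity r (fact m :: nat)"
    have cop: "coprime d (r ^ k)" using False r 
      by (auto simp: coprime_commute[of d] intro!: prime_imp_coprime)
    obtain e where e: "[d * e = 1] (mod r ^ k)" using cong_solve_coprime_nat[OF cop] by auto
    have "fact e * (\<Prod>j=1..m. e + j) = (fact (e + m) :: nat)"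
      by (induction m) (auto simp: algebra_simps)
    moreover have "fact e * fact m dvd (fact (e + m) :: nat)" by (rule fact_fact_dvd_fact)
    ultimately have "fact e * fact m dvd fact e * (\<Prod>j=1..m. e + j)" by simp
    hence "fact m dvd (\<Prod>j=1..m. e + j)" by (subst (asm) dvd_times_left_cancel_iff) auto
    moreover have "r ^ k dvd fact m" unfolding k_def by (rule multiplicity_dvd)
    ultimately have "r ^ k dvd d ^ m * (\<Prod>j=1..m. e + j)" by (meson dvd_mult dvd_trans)
    also have "d ^ m * (\<Prod>j=1..m. e + j) = (\<Prod>j=1..m. d * e + d * j)"
      by (induction m) (auto simp: algebra_simps)
    finally have "[(\<Prod>j=1..m. d * e + d * j) = 0] (mod r ^ k)" by (simp add: cong_0_iff)
    moreover have "[(\<Prod>j=1..m. d * e + d * j) = P] (mod r ^ k)"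
      unfolding P_def by (intro cong_prod cong_add e) auto
    ultimately have "r ^ k dvd P" by (metis cong_0_iff cong_sym cong_trans)
    hence "r ^ k dvd d ^ m * P" by (rule dvd_mult)
    hence "k \<le> multiplicity r (d ^ m * P)"
      using nz r by (intro multiplicity_geI) (auto simp: not_prime_unit)
    thus ?thesis by (simp add: k_def P_def)
  qed
qed auto

text \<open>The primes in \<open>A\<close> occur among the distinct factors
  \<open>1 + d * j\<close>, and being larger than \<open>m\<close> they are coprime to
  \<open>fact m\<close>. So \<open>\<Prod>A * fact m\<close> divides \<open>d ^ m * P\<close>, while
  \<open>P \<le> d ^ m * fact (m + 1)\<close>; the factorials cancel up to
  \<open>m + 1\<close>.\<close>

lemma sum_ln_primes_mod_le:
  fixes d m :: nat
  assumes d: "d > 0" 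
    and A: "A \<subseteq> {q. prime q \<and> [q = 1] (mod d) \<and> m < q \<and> q \<le> d * m + 1}"
  shows "(\<Sum>q\<in>A. ln (real q)) \<le> 2 * real m * ln (real d) + ln (real m + 1)"
proof -
  have fin: "finite A" by (rule finite_subset[OF A], rule finite_subset[of _ "{..d*m+1}"]) auto
  have pr: "\<And>q. q \<in> A \<Longrightarrow> prime q" using A by auto
  define P where "P = (\<Prod>j=1..m. 1 + d * j)"
  have "A \<subseteq> (\<lambda>j. 1 + d * j) ` {1..m}"
  proof
    fix q assume "q \<in> A"
    hence q: "prime q" "[q = 1] (mod d)" "q \<le> d * m + 1" using A by auto
    have "q > 1" using q prime_gt_1_nat by auto
    from q(2) \<open>q > 1\<close> obtain j where j: "q = 1 + d * j" 
      by (metis cong_to_1_nat dvdE less_imp_le_nat le_add_diff_inverse cong_to_1'_nat mult.commute add.commute not_one_less_zero)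
    have "j \<ge> 1" using j \<open>q > 1\<close> by (cases j) auto
    moreover have "j \<le> m" using j q(3) d by simp
    ultimately show "q \<in> (\<lambda>j. 1 + d * j) ` {1..m}" using j by auto
  qed
  hence "\<Prod>A dvd \<Prod>((\<lambda>j. 1 + d * j) ` {1..m})" by (intro prod_dvd_prod_subset) auto
  also have "\<Prod>((\<lambda>j. 1 + d * j) ` {1..m}) = P"
    unfolding P_def using d by (subst prod.reindex) (auto simp: inj_on_def)
  finally have "\<Prod>A dvd d ^ m * P" by (rule dvd_mult)
  moreover have "fact m dvd d ^ m * P" unfolding P_def by (rule fact_dvd_prod_arith_progression[OF d])
  moreover have "coprime (\<Prod>A) (fact m)"
  proof (rule prod_coprime_left)
    fix q assume "q \<in> A"
    hence q: "prime q" "m < q" using A by auto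
    hence "\<not> q dvd fact m" by (simp add: prime_dvd_fact_iff)
    thus "coprime q (fact m)" using q by (intro prime_imp_coprime) auto
  qed
  ultimately have "\<Prod>A * fact m dvd d ^ m * P" by (intro divides_mult)
  hence "\<Prod>A * fact m \<le> d ^ m * P" using d by (intro dvd_imp_le) (auto simp: P_def)
  also have "P \<le> (\<Prod>j=1..m. d * (j + 1))" unfolding P_def using d by (intro prod_mono) auto
  also have "\<dots> = d ^ m * fact (m + 1)"
    by (induction m) (auto simp: algebra_simps)
  finally have "\<Prod>A * fact m \<le> (d ^ (2 * m) * (m + 1)) * fact m"
    by (simp add: algebra_simps power_mult_distrib flip: power_add mult_2)
  hence "\<Prod>A \<le> d ^ (2 * m) * (m + 1)" by (subst (asm) mult_le_cancel2) auto
  hence "real (\<Prod>A) \<le> real (d ^ (2 * m) * (m + 1))" by (simp only: of_nat_le_iff)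
  hence "ln (real (\<Prod>A)) \<le> ln (real (d ^ (2 * m) * (m + 1)))"
    using pr prime_gt_0_nat by (intro ln_mono) (auto intro!: prod_pos)
  also have "ln (real (\<Prod>A)) = (\<Sum>q\<in>A. ln (real q))"
    using fin pr prime_gt_0_nat by (subst of_nat_prod, subst ln_prod) auto
  also have "ln (real (d ^ (2 * m) * (m + 1))) = 2 * real m * ln (real d) + ln (real m + 1)"
    using d ln_mult[of "real d ^ (2 * m)" "real m + 1"] by (simp add: ln_realpow algebra_simps)
  finally show ?thesis .
qed

text \<open>The preceding bound is applied to the blocks \<open>(d * 2 ^ k, d * 2 ^ Suc k]\<close>
  with \<open>m = 2 ^ Suc k\<close>; \<open>d \<ge> 2\<close> makes all primes of the block exceed
  \<open>m\<close>. Since \<open>ln q \<ge> Suc k * ln 2\<close> there, a block contributes a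
  constant times \<open>ln d / d / Suc k\<close>. Hence the harmonic number, which later plays the
  part of \<open>ln (ln x)\<close>.\<close>

lemma sum_inverse_primes_mod_le:
  fixes d J :: nat
  assumes d: "d \<ge> 2"
  shows "(\<Sum>q | prime q \<and> [q = 1] (mod d) \<and> q \<le> d * 2 ^ J. 1 / real q) \<le> 9 * (ln (real d) / real d) * harm J"
proof -
  define A where "A J = {q. prime q \<and> [q = 1] (mod d) \<and> q \<le> d * 2 ^ J}" for J
  have fin: "finite (A J)" for J unfolding A_def by (rule finite_subset[of _ "{..d * 2 ^ J}"]) auto
  have "(\<Sum>q\<in>A J. 1 / real q) \<le> (6 / ln 2) * (ln (real d) / real d) * harm J"
  proof (induction J)
    case 0
    \<comment> \<open>A prime congruent to 1 modulo \<open>d\<close> exceeds \<open>d\<close>, so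
      nothing lies below the dyadic blocks.\<close>
    have "A 0 = {}"
    proof (rule ccontr)
      assume "A 0 \<noteq> {}"
      then obtain q where q: "prime q" "[q = 1] (mod d)" "q \<le> d" by (auto simp: A_def)
      have "q > 1" using q(1) by (rule prime_gt_1_nat)
      hence "d dvd q - 1" using q(2) cong_to_1_nat by blast
      hence "d \<le> q - 1" using \<open>q > 1\<close> by (intro dvd_imp_le) auto
      with q \<open>q > 1\<close> show False by simp
    qed
    thus ?case by (simp add: harm_def)
  next
    case (Suc k)
    define B where "B = A (Suc k) - A k"
    define m :: nat where "m = 2 ^ Suc k"
    have "2 * 2 ^ k \<le> d * 2 ^ k" using d by (intro mult_right_mono) auto
    hence "2 * 2 ^ k < x" if "d * 2 ^ k < x" for x using that by linarith
    hence B: "B \<subseteq> {q. prime q \<and> [q = 1] (mod d) \<and> m < q \<and> q \<le> d * m + 1}"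
      by (auto simp: B_def A_def m_def not_le)
    have lnd: "ln 2 \<le> ln (real d)" using d by (intro ln_mono) auto
    have "m + 1 \<le> 2 ^ m" unfolding Suc_eq_plus1[symmetric] by (intro Suc_leI less_exp)
    hence "real (m + 1) \<le> real (2 ^ m)" by (simp only: of_nat_le_iff)
    hence "ln (real m + 1) \<le> ln (2 ^ m)" by (intro ln_mono) auto
    also have "\<dots> = real m * ln 2" by (simp add: ln_realpow)
    also have "\<dots> \<le> real m * ln (real d)" using lnd by (intro mult_left_mono) auto
    finally have "(\<Sum>q\<in>B. ln (real q)) \<le> 3 * real m * ln (real d)"
      using sum_ln_primes_mod_le[OF _ B] d by simp
    moreover have "(\<Sum>q\<in>B. 1 / real q) \<le> (\<Sum>q\<in>B. ln (real q) / (real d * 2 ^ k * (real (Suc k) * ln 2)))"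
    proof (rule sum_mono)
      fix q assume "q \<in> B"
      hence q: "q > d * 2 ^ k" by (auto simp: B_def A_def)
      have "(2::nat) ^ Suc k \<le> d * 2 ^ k" using d by simp
      also have "\<dots> \<le> q" using q by simp
      finally have "real (2 ^ Suc k) \<le> real q" by (simp only: of_nat_le_iff)
      hence "ln (2 ^ Suc k) \<le> ln (real q)" by (intro ln_mono) auto
      hence l: "real (Suc k) * ln 2 \<le> ln (real q)" by (simp only: ln_realpow)
      have "real (d * 2 ^ k) \<le> real q" using q by (simp only: of_nat_le_iff)
      hence "real d * 2 ^ k * (real (Suc k) * ln 2) \<le> real q * ln (real q)"
        using l by (intro mult_mono) auto
      moreover have "real q > 0" "real d * 2 ^ k * (real (Suc k) * ln 2) > 0" using q d by auto
      ultimately show "1 / real q \<le> ln (real q) / (real d * 2 ^ k * (real (Suc k) * ln 2))"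
        by (simp add: field_simps del: of_nat_Suc)
    qed
    ultimately have "(\<Sum>q\<in>B. 1 / real q) \<le> 3 * real m * ln (real d) / (real d * 2 ^ k * (real (Suc k) * ln 2))"
      using d by (subst (asm) sum_divide_distrib[symmetric])
        (meson divide_right_mono order_trans mult_nonneg_nonneg of_nat_0_le_iff zero_le_power ln_ge_zero one_le_numeral zero_le_numeral)
    also have "\<dots> = (6 / ln 2) * (ln (real d) / real d) * inverse (real (Suc k))"
      by (simp add: m_def field_simps del: of_nat_Suc)
    finally have 1: "(\<Sum>q\<in>B. 1 / real q) \<le> (6 / ln 2) * (ln (real d) / real d) * inverse (real (Suc k))" .
    have "A (Suc k) = A k \<union> B" by (auto simp: B_def A_def)
    hence "(\<Sum>q\<in>A (Suc k). 1 / real q) = (\<Sum>q\<in>A k. 1 / real q) + (\<Sum>q\<in>B. 1 / real q)"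
      using fin by (simp only:) (rule sum.union_disjoint, auto simp: B_def)
    with 1 Suc.IH show ?case unfolding harm_Suc distrib_left by linarith
  qed
  also have "\<dots> \<le> 9 * (ln (real d) / real d) * harm J"
  proof (intro mult_right_mono harm_nonneg)
    show "6 / ln 2 \<le> (9::real)" using ln2_ge_two_thirds by (simp add: field_simps)
  qed (use d in auto)
  finally show ?thesis by (simp add: A_def)
qed

section \<open>Mertens' second theorem\<close>

text \<open>Both sums from 1 to \<open>N\<close> are \<open>ln N\<close> up to bounded errors, 5 for
  the primes and 1 for the harmonic numbers; taking the difference of two initial segments doubles
  the 6.\<close>

lemma bounded_partial_sums_prime_minus_harmonic:
  defines "b \<equiv> \<lambda>n::nat. (if prime n then ln (real n) / real n else 0) - 1 / real n"
  assumes "1 \<le> m"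
  shows "\<bar>\<Sum>i=m..<k. b i\<bar> \<le> 12"
proof -
  have 1: "\<bar>\<Sum>i=1..N. b i\<bar> \<le> 6" for N
  proof (cases "N = 0")
    case False
    have "(\<Sum>i=1..N. b i) = (\<Sum>n=1..N. if prime n then ln (real n) / real n else 0) - harm N"
      by (simp add: b_def sum_subtractf harm_def inverse_eq_divide)
    moreover have "harm N \<ge> ln (real N)" 
      using ln_le_harm[of N] False ln_mono[of "real N" "real N + 1"] by linarith
    moreover have "harm N - ln (real N) \<le> 1"
      using euler_mascheroni_sequence_decreasing[of 1 N] False by (auto simp: harm_def)
    ultimately show ?thesis using mertens_first_primes[of N] False by linarith
  qed auto
  show ?thesis
  proof (cases "m < k")
    case True
    have "{1..k-1} = {1..m-1} \<union> {m..<k}" using True assms(2) by auto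
    hence "(\<Sum>i=1..k-1. b i) = (\<Sum>i=1..m-1. b i) + (\<Sum>i=m..<k. b i)"
      using assms(2) by (simp only:) (rule sum.union_disjoint, auto)
    with 1[of "k-1"] 1[of "m-1"] show ?thesis by linarith
  qed auto
qed

lemma ln_ln_diff_bounds:
  assumes "n \<ge> 2"
  shows "1 / (real (Suc n) * ln (real (Suc n))) \<le> ln (ln (real (Suc n))) - ln (ln (real n))"
    and "ln (ln (real (Suc n))) - ln (ln (real n)) \<le> 1 / (real n * ln (real n))"
proof -
  have "\<exists>z>real n. z < real (Suc n) \<and> ln (ln (real (Suc n))) - ln (ln (real n)) = (real (Suc n) - real n) * (1 / (z * ln z))"
    using assms by (intro MVT2) (auto intro!: derivative_eq_intros simp: field_simps)
  then obtain z where z: "z > real n" "z < real (Suc n)"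
    "ln (ln (real (Suc n))) - ln (ln (real n)) = 1 / (z * ln z)" by auto
  have "real n * ln (real n) \<le> z * ln z" "z * ln z \<le> real (Suc n) * ln (real (Suc n))"
    using z assms by (auto intro!: mult_mono ln_mono simp del: of_nat_Suc)
  moreover have "real n * ln (real n) > 0" using assms by auto
  ultimately show "1 / (real (Suc n) * ln (real (Suc n))) \<le> ln (ln (real (Suc n))) - ln (ln (real n))"
    "ln (ln (real (Suc n))) - ln (ln (real n)) \<le> 1 / (real n * ln (real n))"
    unfolding z(3) by (meson frac_le order_refl zero_le_one less_le_trans)+
qed

text \<open>In the notation of the proof, \<open>a\<close> increases and \<open>a + u\<close>
  decreases, so the limit \<open>B\<close> lies between \<open>a N\<close> and
  \<open>a N + u N\<close>.\<close>

lemma sum_inverse_n_ln_n_asymp: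
  "\<exists>B. \<forall>N\<ge>2. \<bar>(\<Sum>n=2..<N. 1 / (real n * ln (real n))) - ln (ln (real N)) - B\<bar> \<le> 1 / (real N * ln (real N))"
proof -
  define u where "u n = 1 / (real n * ln (real n))" for n
  define a where "a N = (\<Sum>n=2..<N. u n) - ln (ln (real N))" for N
  have step: "0 \<le> a (Suc N) - a N" "a (Suc N) - a N \<le> u N - u (Suc N)" if "N \<ge> 2" for N
    using ln_ln_diff_bounds[OF that] that by (simp_all add: a_def u_def del: of_nat_Suc)
  have le: "a N \<le> a M \<and> a M \<le> a N + (u N - u M)" if "N \<ge> 2" "N \<le> M" for N M
    using that(2)
  proof (induction M rule: dec_induct)
    case (step M)
    with \<open>N \<ge> 2\<close> that(1) show ?case using \<open>\<And>N. 2 \<le> N \<Longrightarrow> 0 \<le> a (Suc N) - a N\<close>[of M] 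
       \<open>\<And>N. 2 \<le> N \<Longrightarrow> a (Suc N) - a N \<le> u N - u (Suc N)\<close>[of M] by simp
  qed auto
  have upos: "u n \<ge> 0" if "n \<ge> 2" for n using that by (simp add: u_def)
  have "incseq (\<lambda>n. a (n + 2))" using step by (auto simp: incseq_Suc_iff)
  moreover have "Bseq (\<lambda>n. a (n + 2))"
  proof (rule BseqI'[of _ "\<bar>a 2\<bar> + u 2"])
    fix n show "norm (a (n + 2)) \<le> \<bar>a 2\<bar> + u 2"
      using le[of 2 "n+2"] upos[of 2] upos[of "n+2"] by auto
  qed
  ultimately obtain B where "(\<lambda>n. a (n + 2)) \<longlonglongrightarrow> B"
    using Bseq_monoseq_convergent[of "\<lambda>n. a (n+2)"] by (auto simp: convergent_def incseq_imp_monoseq)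
  hence B: "a \<longlonglongrightarrow> B" using LIMSEQ_offset by blast
  show ?thesis
  proof (intro exI[of _ B] allI impI)
    fix N :: nat assume N: "N \<ge> 2"
    have "a N \<le> B" by (rule tendsto_lowerbound[OF B]) 
      (use le N in \<open>auto simp: eventually_sequentially intro!: exI[of _ N]\<close>)
    moreover have "eventually (\<lambda>M. a M \<le> a N + u N) sequentially"
      using eventually_ge_at_top[of N]
    proof eventually_elim
      case (elim M) thus ?case using le[OF N elim] upos[of M] N by simp
    qed
    hence "B \<le> a N + u N" by (rule tendsto_upperbound[OF B]) auto
    ultimately show "\<bar>(\<Sum>n=2..<N. 1 / (real n * ln (real n))) - ln (ln (real N)) - B\<bar> \<le> 1 / (real N * ln (real N))"
      by (simp add: a_def u_def)
  qed
qed

text \<open>\<open>1 / p\<close> is \<open>ln p / p\<close> with the weight \<open>1 / ln p\<close>.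
  Subtracting \<open>1 / n\<close> from \<open>ln p / p\<close> makes the partial sums bounded, so
  that Dirichlet's test applies with tail \<open>12 / ln N\<close>; the subtracted sum of
  \<open>1 / (n * ln n)\<close> brings in \<open>ln (ln N)\<close> and one more unit of
  error.\<close>

lemma mertens_second:
  "\<exists>B. \<forall>N\<ge>2. \<bar>(\<Sum>p | prime p \<and> p < N. 1 / real p) - ln (ln (real N)) - B\<bar> \<le> 13 / ln (real N)"
proof -
  define b where "b n = (if prime n then ln (real n) / real n else 0) - 1 / real n" for n :: nat
  define f where "f n = 1 / ln (real n)" for n :: nat
  obtain B2 where B2: "\<And>N. N \<ge> 2 \<Longrightarrow> \<bar>(\<Sum>n=2..<N. 1 / (real n * ln (real n))) - ln (ln (real N)) - B2\<bar> \<le> 1 / (real N * ln (real N))"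
    using sum_inverse_n_ln_n_asymp by blast
  have f0: "f \<longlonglongrightarrow> 0" unfolding f_def by real_asymp
  have fdec: "f (Suc k) \<le> f k" if "k \<ge> 2" for k
    using that by (auto simp: f_def intro!: divide_left_mono ln_mono mult_pos_pos)
  have bb: "norm (\<Sum>i=m..<k. b i) \<le> 12" if "2 \<le> m" for m k
    using bounded_partial_sums_prime_minus_harmonic[of m k] that by (simp add: b_def)
  define B1 where "B1 = (\<Sum>n. f n *\<^sub>R b n)"
  show ?thesis
  proof (intro exI[of _ "B1 + B2"] allI impI)
    fix N :: nat assume N: "N \<ge> 2"
    have 1: "norm (B1 - (\<Sum>n<N. f n *\<^sub>R b n)) \<le> 12 * f N"
      unfolding B1_def by (rule dirichlet_test(2)[where ?m0.0 = 2]) (use bb fdec f0 N in auto)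
    \<comment> \<open>The indices 0 and 1 drop out because \<open>ln\<close> is 0 at both and
      division by 0 gives 0.\<close>
    have "(\<Sum>n<N. f n *\<^sub>R b n) = (\<Sum>n=2..<N. f n * b n)"
    proof (rule sum.mono_neutral_cong_right)
      show "\<forall>i\<in>{..<N} - {2..<N}. f i *\<^sub>R b i = 0"
      proof
        fix i assume "i \<in> {..<N} - {2..<N}"
        hence "i = 0 \<or> i = 1" using N by auto
        thus "f i *\<^sub>R b i = 0" by (auto simp: f_def)
      qed
    qed auto
    also have "\<dots> = (\<Sum>n=2..<N. if prime n then 1 / real n else 0) - (\<Sum>n=2..<N. 1 / (real n * ln (real n)))"
      unfolding sum_subtractf[symmetric] by (intro sum.cong) (auto simp: f_def b_def field_simps)
    also have "(\<Sum>n=2..<N. if prime n then 1 / real n else 0) = (\<Sum>p | prime p \<and> p < N. 1 / real p)"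
    proof -
      have "{n \<in> {2..<N}. prime n} = {p. prime p \<and> p < N}" by (auto simp: prime_ge_2_nat)
      thus ?thesis by (subst sum.inter_filter[symmetric]) simp_all
    qed
    finally have 2: "(\<Sum>p | prime p \<and> p < N. 1 / real p) = (\<Sum>n<N. f n *\<^sub>R b n) + (\<Sum>n=2..<N. 1 / (real n * ln (real n)))" by simp
    have "1 / (real N * ln (real N)) \<le> f N" 
      unfolding f_def using N by (intro divide_left_mono) auto
    with 1 2 B2[OF N] show "\<bar>(\<Sum>p | prime p \<and> p < N. 1 / real p) - ln (ln (real N)) - (B1 + B2)\<bar> \<le> 13 / ln (real N)"
      by (simp add: f_def)
  qed
qed

section \<open>The zeta function to the right of 1 and its Euler product\<close>

lemma powr_neg_diff_bounds:
  fixes \<sigma> :: real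
  assumes "n \<ge> 1" "\<sigma> > 0"
  shows "\<sigma> * real (Suc n) powr (- 1 - \<sigma>) \<le> real n powr (-\<sigma>) - real (Suc n) powr (-\<sigma>)"
    and "real n powr (-\<sigma>) - real (Suc n) powr (-\<sigma>) \<le> \<sigma> * real n powr (- 1 - \<sigma>)"
proof -
  have eq: "- \<sigma> - 1 = - 1 - \<sigma>" by simp
  have "\<exists>z>real n. z < real (Suc n) \<and> (real (Suc n) powr (-\<sigma>)) - (real n powr (-\<sigma>)) = (real (Suc n) - real n) * (- \<sigma> * z powr (- 1 - \<sigma>))"
    using assms by (intro MVT2) (auto intro!: derivative_eq_intros simp: algebra_simps eq)
  then obtain z where z: "z > real n" "z < real (Suc n)"
    "real (Suc n) powr (-\<sigma>) - real n powr (-\<sigma>) = (real (Suc n) - real n) * (- \<sigma> * z powr (- 1 - \<sigma>))" by blast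
  from z(3) have z3: "real n powr (-\<sigma>) - real (Suc n) powr (-\<sigma>) = \<sigma> * z powr (- 1 - \<sigma>)" by simp
  show "\<sigma> * real (Suc n) powr (- 1 - \<sigma>) \<le> real n powr (-\<sigma>) - real (Suc n) powr (-\<sigma>)"
    unfolding z3 using z assms by (intro mult_left_mono powr_mono2') auto
  show "real n powr (-\<sigma>) - real (Suc n) powr (-\<sigma>) \<le> \<sigma> * real n powr (- 1 - \<sigma>)"
    unfolding z3 using z assms by (intro mult_left_mono powr_mono2') auto
qed

lemma summable_powr_neg:
  fixes \<sigma> :: real
  assumes "\<sigma> > 0"
  shows "summable (\<lambda>n. real n powr (- 1 - \<sigma>))"
  using assms by (subst summable_real_powr_iff) auto

text \<open>Telescoping: \<open>\<sigma> * n powr (- 1 - \<sigma>)\<close> lies between two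
  consecutive decrements of \<open>n powr (- \<sigma>)\<close>. The summand at 0 vanishes since
  \<open>0 powr y = 0\<close>.\<close>

lemma zeta_bounds:
  fixes \<sigma> :: real
  assumes "\<sigma> > 0"
  shows "1 / \<sigma> \<le> (\<Sum>n. real n powr (- 1 - \<sigma>))"
    and "(\<Sum>n. real n powr (- 1 - \<sigma>)) \<le> 1 + 1 / \<sigma>"
proof -
  define Z where "Z = (\<Sum>n. real n powr (- 1 - \<sigma>))"
  have lim: "(\<lambda>n. real (n + 1) powr (-\<sigma>)) \<longlonglongrightarrow> 0" using assms by real_asymp
  have tel: "(\<lambda>n. real (n + 1) powr (-\<sigma>) - real (Suc n + 1) powr (-\<sigma>)) sums (real (0 + 1) powr (-\<sigma>) - 0)"
    by (rule telescope_sums'[OF lim])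
  have s: "summable (\<lambda>n. real n powr (- 1 - \<sigma>))" by (rule summable_powr_neg[OF assms])
  have s1: "(\<lambda>n. real (n + 1) powr (- 1 - \<sigma>)) sums Z"
    using summable_sums[OF s] by (subst (asm) sums_iff_shift'[of _ 1, symmetric]) (auto simp: Z_def)
  have s2: "(\<lambda>n. real (n + 2) powr (- 1 - \<sigma>)) sums (Z - 1)"
    using summable_sums[OF s] unfolding Z_def[symmetric]
    by (subst (asm) sums_iff_shift'[of _ 2, symmetric]) (auto simp: numeral_2_eq_2)
  have "real (0 + 1) powr (-\<sigma>) - 0 \<le> \<sigma> * Z"
    by (rule sums_le[OF _ tel sums_mult[OF s1]]) (use powr_neg_diff_bounds(2)[OF _ assms, of "Suc n" for n] in \<open>auto simp: add_ac\<close>)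
  thus "1 / \<sigma> \<le> (\<Sum>n. real n powr (- 1 - \<sigma>))" using assms by (simp add: Z_def field_simps)
  have "\<sigma> * (Z - 1) \<le> real (0 + 1) powr (-\<sigma>) - 0"
    by (rule sums_le[OF _ sums_mult[OF s2] tel]) (use powr_neg_diff_bounds(1)[OF _ assms, of "Suc n" for n] in \<open>auto simp: add_ac\<close>)
  thus "(\<Sum>n. real n powr (- 1 - \<sigma>)) \<le> 1 + 1 / \<sigma>" using assms by (simp add: Z_def field_simps)
qed

lemma suminf_inverse_square_tail_le:
  assumes "N \<ge> 2"
  shows "summable (\<lambda>n. 1 / real (n + N) ^ 2)" "(\<Sum>n. 1 / real (n + N) ^ 2) \<le> 2 / real N"
proof -
  have lim: "(\<lambda>n. 1 / (real (n + N) - 1)) \<longlonglongrightarrow> 0" by real_asymp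
  have tel: "(\<lambda>n. 1 / (real (n + N) - 1) - 1 / (real (Suc n + N) - 1)) sums (1 / (real (0 + N) - 1) - 0)"
    by (rule telescope_sums'[OF lim])
  have le: "1 / real (n + N) ^ 2 \<le> 1 / (real (n + N) - 1) - 1 / (real (Suc n + N) - 1)" for n
  proof -
    have "1 / real (n + N) ^ 2 \<le> 1 / (real (n + N) * (real (n + N) - 1))"
      unfolding power2_eq_square using assms by (intro divide_left_mono mult_left_mono mult_pos_pos) auto
    also have "\<dots> = 1 / (real (n + N) - 1) - 1 / (real (Suc n + N) - 1)"
      using assms by (simp add: divide_simps)
    finally show ?thesis .
  qed
  show s: "summable (\<lambda>n. 1 / real (n + N) ^ 2)"
    by (rule summable_comparison_test'[OF sums_summable[OF tel], of 0]) (use le in auto)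
  have "(\<Sum>n. 1 / real (n + N) ^ 2) \<le> 1 / (real (0 + N) - 1) - 0"
    by (rule sums_le[OF le summable_sums[OF s] tel])
  also have "\<dots> \<le> 2 / real N" using assms by (simp add: field_simps)
  finally show "(\<Sum>n. 1 / real (n + N) ^ 2) \<le> 2 / real N" .
qed

lemma ln_one_minus_bounds:
  fixes x :: real
  assumes "0 \<le> x" "x \<le> 1 / 2"
  shows "0 \<le> - ln (1 - x) - x" "- ln (1 - x) - x \<le> 2 * x\<^sup>2"
  using ln_one_minus_pos_upper_bound[of x] ln_one_minus_pos_lower_bound[of x] assms by auto

lemma powr_neg_le_half:
  fixes \<sigma> :: real
  assumes "p \<ge> 2" "\<sigma> \<ge> 0"
  shows "real p powr (- 1 - \<sigma>) \<le> 1 / 2" "real p powr (- 1 - \<sigma>) \<le> 1 / real p"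
proof -
  have "real p powr (- 1 - \<sigma>) \<le> real p powr (- 1)" using assms by (intro powr_mono) auto
  thus "real p powr (- 1 - \<sigma>) \<le> 1 / real p" by (simp add: powr_minus_divide)
  also have "\<dots> \<le> 1 / 2" using assms by (intro divide_left_mono) auto
  finally show "real p powr (- 1 - \<sigma>) \<le> 1 / 2" .
qed

text \<open>The logarithm of the Euler product, with the first-order term of each factor separated:
  that term carries the whole singularity at \<open>\<sigma> = 0\<close>, while the remainder is
  dominated by \<open>2 / n^2\<close> uniformly in \<open>\<sigma>\<close>.\<close>

lemma ln_zeta_eq:
  fixes \<sigma> :: real
  assumes \<sigma>: "\<sigma> > 0"
  shows "ln (\<Sum>n. real n powr (- 1 - \<sigma>)) = 
     (\<Sum>n. if prime n then real n powr (- 1 - \<sigma>) else 0) +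
     (\<Sum>n. if prime n then - ln (1 - real n powr (- 1 - \<sigma>)) - real n powr (- 1 - \<sigma>) else 0)"
proof -
  define f where "f n = real n powr (- 1 - \<sigma>)" for n :: nat
  have s: "summable f" unfolding f_def by (rule summable_powr_neg[OF \<sigma>])
  have half: "0 \<le> f p" "f p \<le> 1 / 2" "f p \<le> 1 / real p" if "prime p" for p
    using powr_neg_le_half[of p \<sigma>] prime_ge_2_nat[OF that] \<sigma> by (auto simp: f_def)
  have Zpos: "suminf f > 0" 
    using zeta_bounds(1)[OF \<sigma>] \<sigma> unfolding f_def[symmetric] 
    by (meson divide_pos_pos less_le_trans zero_less_one)
  have s1: "summable (\<lambda>n. if prime n then f n else 0)"
    by (rule summable_comparison_test'[OF s, of 0]) (auto simp: f_def)
  have s2: "summable (\<lambda>n. if prime n then - ln (1 - f n) - f n else 0)"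
  proof (rule summable_comparison_test'[of "\<lambda>n. 2 * (1 / real n ^ 2)" 0])
    show "summable (\<lambda>n. 2 * (1 / real n ^ 2))" 
      using inverse_power_summable[of 2, where 'a = real] by (intro summable_mult) (simp add: inverse_eq_divide)
    fix n :: nat
    show "norm (if prime n then - ln (1 - f n) - f n else 0) \<le> 2 * (1 / real n ^ 2)"
    proof (cases "prime n")
      case True
      have "(f n)\<^sup>2 \<le> (1 / real n)\<^sup>2" using half[OF True] by (intro power_mono) auto
      thus ?thesis using ln_one_minus_bounds[of "f n"] half[OF True] True
        by (simp add: power_divide)
    qed auto
  qed
  have "(\<lambda>Q. suminf f * (\<Prod>q | prime q \<and> q \<le> Q. 1 - f q)) \<longlonglongrightarrow> 1"
    by (rule euler_product_tendsto) (use s in \<open>simp_all add: f_def[abs_def] powr_mult\<close>)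
  hence "(\<lambda>Q. ln (suminf f * (\<Prod>q | prime q \<and> q \<le> Q. 1 - f q))) \<longlonglongrightarrow> ln 1"
    by (rule tendsto_ln) auto
  also have "(\<lambda>Q. ln (suminf f * (\<Prod>q | prime q \<and> q \<le> Q. 1 - f q))) =
     (\<lambda>Q. ln (suminf f) - (\<Sum>n\<le>Q. (if prime n then f n else 0) + (if prime n then - ln (1 - f n) - f n else 0)))"
  proof
    fix Q
    have fin: "finite {q::nat. prime q \<and> q \<le> Q}" by (rule finite_subset[of _ "{..Q}"]) auto
    have pos: "1 - f q > 0" if "q \<in> {q. prime q \<and> q \<le> Q}" for q using half[of q] that by auto
    have "ln (suminf f * (\<Prod>q | prime q \<and> q \<le> Q. 1 - f q)) = ln (suminf f) + (\<Sum>q | prime q \<and> q \<le> Q. ln (1 - f q))"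
    proof -
      have "(\<Prod>q | prime q \<and> q \<le> Q. 1 - f q) > 0" using pos by (intro prod_pos) auto
      moreover have "ln (\<Prod>q | prime q \<and> q \<le> Q. 1 - f q) = (\<Sum>q | prime q \<and> q \<le> Q. ln (1 - f q))"
        by (intro ln_prod) (use fin pos less_irrefl in \<open>metis+\<close>)
      ultimately show ?thesis using Zpos 
        using ln_mult_pos[of "suminf f" "\<Prod>q | prime q \<and> q \<le> Q. 1 - f q"] by linarith
    qed
    also have "(\<Sum>q | prime q \<and> q \<le> Q. ln (1 - f q)) = (\<Sum>n\<le>Q. if prime n then ln (1 - f n) else 0)"
      by (subst sum.inter_filter[symmetric]) (auto intro!: sum.cong)
    also have "\<dots> = - (\<Sum>n\<le>Q. (if prime n then f n else 0) + (if prime n then - ln (1 - f n) - f n else 0))"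
      unfolding sum_negf[symmetric] by (intro sum.cong) auto
    finally show "ln (suminf f * (\<Prod>q | prime q \<and> q \<le> Q. 1 - f q)) =
       ln (suminf f) - (\<Sum>n\<le>Q. (if prime n then f n else 0) + (if prime n then - ln (1 - f n) - f n else 0))"
      by simp
  qed
  finally have l1: "(\<lambda>Q. ln (suminf f) - (\<Sum>n\<le>Q. (if prime n then f n else 0) + (if prime n then - ln (1 - f n) - f n else 0))) \<longlonglongrightarrow> 0" by simp
  have "(\<lambda>Q. ln (suminf f) - (\<Sum>n\<le>Q. (if prime n then f n else 0) + (if prime n then - ln (1 - f n) - f n else 0)))
     \<longlonglongrightarrow> ln (suminf f) - ((\<Sum>n. if prime n then f n else 0) + (\<Sum>n. if prime n then - ln (1 - f n) - f n else 0))"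
    unfolding suminf_add[OF s1 s2] by (intro tendsto_intros summable_LIMSEQ' summable_add s1 s2)
  from LIMSEQ_unique[OF l1 this] show ?thesis unfolding f_def by linarith
qed

section \<open>The constant in Mertens' theorem\<close>

text \<open>
  Grouping the primes by \<open>\<lfloor>ln p\<rfloor>\<close> turns the Dirichlet series over primes into a power series
  whose coefficients can be compared with those of \<open>-ln (1 - z)\<close>, which is what brings in the
  Euler--Mascheroni constant.
\<close>

lemma prime_series_grouped:
  fixes \<sigma> :: real
  assumes \<sigma>: "\<sigma> > 0"
  defines "W \<equiv> \<lambda>k::nat. \<Sum>p | prime p \<and> nat \<lfloor>ln (real p)\<rfloor> = k. 1 / real p"
  shows "summable (\<lambda>k. W k * exp (-\<sigma>) ^ k)"
    and "exp (-\<sigma>) * (\<Sum>k. W k * exp (-\<sigma>) ^ k) \<le> (\<Sum>n. if prime n then real n powr (- 1 - \<sigma>) else 0)"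
    and "(\<Sum>n. if prime n then real n powr (- 1 - \<sigma>) else 0) \<le> (\<Sum>k. W k * exp (-\<sigma>) ^ k)"
    and "\<And>K. (\<Sum>k<K. W k) = (\<Sum>p | prime p \<and> p < nat \<lceil>exp (real K)\<rceil>. 1 / real p)"
proof -
  define z where "z = exp (-\<sigma>)"
  define g where "g n = (if prime n then real n powr (- 1 - \<sigma>) else 0)" for n :: nat
  define P where "P K = {p::nat. prime p \<and> p < nat \<lceil>exp (real K)\<rceil>}" for K :: nat
  have z: "0 < z" "z < 1" using \<sigma> by (auto simp: z_def)
  have finP: "finite (P K)" for K unfolding P_def by (rule finite_subset[of _ "{..<nat \<lceil>exp (real K)\<rceil>}"]) auto
  \<comment> \<open>Both sides say \<open>p < exp K\<close>, so that grouping by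
    \<open>k < K\<close> matches the strict cutoff in Mertens' sum exactly.\<close>
  have iff: "nat \<lfloor>ln (real p)\<rfloor> < K \<longleftrightarrow> p < nat \<lceil>exp (real K)\<rceil>" if "prime p" for p K
  proof -
    have p: "real p \<ge> 1" using prime_ge_1_nat[OF that] by simp
    hence "nat \<lfloor>ln (real p)\<rfloor> < K \<longleftrightarrow> ln (real p) < real K"
      by (simp add: nat_less_iff floor_less_iff)
    also have "\<dots> \<longleftrightarrow> real p < exp (real K)" using p exp_less_cancel_iff[of "ln (real p)" "real K"] by simp
    also have "\<dots> \<longleftrightarrow> p < nat \<lceil>exp (real K)\<rceil>" by (simp add: zless_nat_eq_int_zless less_ceiling_iff)
    finally show ?thesis .
  qed
  have group: "(\<Sum>p\<in>P K. h p) = (\<Sum>k<K. \<Sum>p | prime p \<and> nat \<lfloor>ln (real p)\<rfloor> = k. h p)" for K and h :: "nat \<Rightarrow> real"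
  proof -
    have "(\<Sum>k<K. \<Sum>p\<in>{p \<in> P K. nat \<lfloor>ln (real p)\<rfloor> = k}. h p) = (\<Sum>p\<in>P K. h p)"
      by (rule sum.group) (use iff finP in \<open>auto simp: P_def\<close>)
    moreover have "{p \<in> P K. nat \<lfloor>ln (real p)\<rfloor> = k} = {p. prime p \<and> nat \<lfloor>ln (real p)\<rfloor> = k}" if "k < K" for k
      using that iff[of _ K] by (auto simp: P_def)
    ultimately show ?thesis by simp
  qed
  show "\<And>K. (\<Sum>k<K. W k) = (\<Sum>p | prime p \<and> p < nat \<lceil>exp (real K)\<rceil>. 1 / real p)"
    using group by (simp add: W_def P_def)
  have W0: "W k \<ge> 0" for k by (auto simp: W_def intro!: sum_nonneg)
  \<comment> \<open>With \<open>k = nat \<lfloor>ln p\<rfloor>\<close>, the power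
    \<open>p powr (- \<sigma>)\<close> lies between \<open>z ^ Suc k\<close> and
    \<open>z ^ k\<close>; the factor \<open>z\<close> lost here tends to 1 with
    \<open>\<sigma>\<close> tending to 0.\<close>
  have pw: "z * (1 / real p * z ^ nat \<lfloor>ln (real p)\<rfloor>) \<le> g p \<and> g p \<le> 1 / real p * z ^ nat \<lfloor>ln (real p)\<rfloor>" if "prime p" for p
  proof -
    define k where "k = nat \<lfloor>ln (real p)\<rfloor>"
    have p: "real p \<ge> 1" using prime_ge_1_nat[OF that] by simp
    have k: "real k \<le> ln (real p)" "ln (real p) \<le> real k + 1" using p by (auto simp: k_def)
    have "g p = real p powr (-1) * real p powr (-\<sigma>)" using that by (simp only: powr_add[symmetric]) (simp add: g_def)
    also have "real p powr (-1) = 1 / real p" by (simp add: powr_minus_divide)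
    also have "real p powr (-\<sigma>) = exp (-\<sigma> * ln (real p))" using p by (simp add: powr_def)
    finally have g: "g p = 1 / real p * exp (-\<sigma> * ln (real p))" .
    have "exp (-\<sigma> * ln (real p)) \<le> exp (- \<sigma> * real k)" using k \<sigma> by simp
    also have "\<dots> = z ^ k" by (simp add: z_def exp_of_nat_mult[symmetric] mult.commute)
    finally have 1: "exp (-\<sigma> * ln (real p)) \<le> z ^ k" .
    have "z * z ^ k = exp (- \<sigma> * (real k + 1))" 
      by (simp add: z_def exp_of_nat_mult[symmetric] exp_add[symmetric] algebra_simps)
    also have "\<dots> \<le> exp (-\<sigma> * ln (real p))" using k \<sigma> by simp
    finally have 2: "z * z ^ k \<le> exp (-\<sigma> * ln (real p))" .
    show ?thesis unfolding g k_def[symmetric] 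
      using mult_left_mono[OF 1, of "1 / real p"] mult_left_mono[OF 2, of "1 / real p"] by (simp add: mult_ac)
  qed
  have Wz: "(\<Sum>k<K. W k * z ^ k) = (\<Sum>p\<in>P K. 1 / real p * z ^ nat \<lfloor>ln (real p)\<rfloor>)" for K
    unfolding group W_def sum_distrib_right by (intro sum.cong refl) auto
  have g0: "g n \<ge> 0" for n by (simp add: g_def)
  have gs: "summable g"
    by (rule summable_comparison_test'[OF summable_powr_neg[OF \<sigma>], of 0]) (auto simp: g_def)
  have gP: "(\<Sum>p\<in>P K. g p) = (\<Sum>n<nat \<lceil>exp (real K)\<rceil>. g n)" for K
    by (intro sum.mono_neutral_left) (auto simp: P_def g_def)
  have up: "z * (\<Sum>k<K. W k * z ^ k) \<le> suminf g" for K
  proof -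
    have "z * (\<Sum>k<K. W k * z ^ k) \<le> (\<Sum>p\<in>P K. g p)"
      unfolding Wz sum_distrib_left by (intro sum_mono) (use pw in \<open>auto simp: P_def\<close>)
    also have "\<dots> \<le> suminf g" by (intro sum_le_suminf gs finP) (auto simp: g0)
    finally show ?thesis .
  qed
  have s: "summable (\<lambda>k. W k * z ^ k)"
  proof (rule summableI_nonneg_bounded[of _ "suminf g / z"])
    show "(\<Sum>k<K. W k * z ^ k) \<le> suminf g / z" for K using up[of K] z by (simp add: field_simps)
  qed (use W0 z in auto)
  thus "summable (\<lambda>k. W k * exp (-\<sigma>) ^ k)" by (simp add: z_def)
  have "(\<lambda>K. z * (\<Sum>k<K. W k * z ^ k)) \<longlonglongrightarrow> z * (\<Sum>k. W k * z ^ k)"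
    by (intro tendsto_intros summable_LIMSEQ s)
  hence "z * (\<Sum>k. W k * z ^ k) \<le> suminf g" by (rule tendsto_upperbound) (auto simp: up)
  thus "exp (-\<sigma>) * (\<Sum>k. W k * exp (-\<sigma>) ^ k) \<le> (\<Sum>n. if prime n then real n powr (- 1 - \<sigma>) else 0)"
    by (simp add: z_def g_def[abs_def])
  have "filterlim (\<lambda>K::nat. nat \<lceil>exp (real K)\<rceil>) at_top sequentially"
  proof (rule filterlim_at_top_mono[OF filterlim_ident], rule always_eventually, rule allI)
    fix K :: nat
    have "real K \<le> exp (real K)" using exp_ge_add_one_self[of "real K"] by linarith
    thus "K \<le> nat \<lceil>exp (real K)\<rceil>" by linarith
  qed
  hence lim: "(\<lambda>K. \<Sum>n<nat \<lceil>exp (real K)\<rceil>. g n) \<longlonglongrightarrow> suminf g"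
    by (rule filterlim_compose[OF summable_LIMSEQ[OF gs]])
  have "(\<Sum>n<nat \<lceil>exp (real K)\<rceil>. g n) \<le> (\<Sum>k. W k * z ^ k)" for K
  proof -
    have "(\<Sum>p\<in>P K. g p) \<le> (\<Sum>k<K. W k * z ^ k)"
      unfolding Wz by (intro sum_mono) (use pw in \<open>auto simp: P_def\<close>)
    also have "\<dots> \<le> (\<Sum>k. W k * z ^ k)" by (intro sum_le_suminf s) (use W0 z in auto)
    finally show ?thesis by (simp add: gP)
  qed
  hence "suminf g \<le> (\<Sum>k. W k * z ^ k)" by (intro tendsto_upperbound[OF lim]) auto
  thus "(\<Sum>n. if prime n then real n powr (- 1 - \<sigma>) else 0) \<le> (\<Sum>k. W k * exp (-\<sigma>) ^ k)"
    by (simp add: z_def g_def[abs_def])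
qed

text \<open>The excess of \<open>- ln (1 - 1 / p)\<close> over its first-order term, that is the gap
  between Mertens' second and third theorems. It is extended by 0 to all \<open>n\<close> in order
  to be summed as a series.\<close>

definition prime_ln_error :: "nat \<Rightarrow> real" where
  "prime_ln_error n = (if prime n then - ln (1 - 1 / real n) - 1 / real n else 0)"

lemma prime_ln_error_bounds: "0 \<le> prime_ln_error n" "prime_ln_error n \<le> 2 * (1 / real n ^ 2)"
proof -
  have "0 \<le> prime_ln_error n \<and> prime_ln_error n \<le> 2 * (1 / real n ^ 2)"
  proof (cases "prime n")
    case True
    have "1 / real n \<le> 1 / 2" using prime_ge_2_nat[OF True] by (intro divide_left_mono) auto
    thus ?thesis using ln_one_minus_bounds[of "1 / real n"] True by (auto simp: prime_ln_error_def power_divide)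
  qed (auto simp: prime_ln_error_def)
  thus "0 \<le> prime_ln_error n" "prime_ln_error n \<le> 2 * (1 / real n ^ 2)" by auto
qed

lemma summable_prime_ln_error: "summable prime_ln_error"
proof (rule summable_comparison_test'[of "\<lambda>n. 2 * (1 / real n ^ 2)" 0])
  show "summable (\<lambda>n. 2 * (1 / real n ^ 2))" 
    using inverse_power_summable[of 2, where 'a = real] by (intro summable_mult) (simp add: inverse_eq_divide)
qed (use prime_ln_error_bounds in auto)

text \<open>The logarithm of zeta at \<open>1 + \<sigma>\<close> is
  \<open>ln (1 / \<sigma>) + o(1)\<close>, and it equals \<open>G1 + E\<close>. The remainder
  \<open>E\<close> tends to the sum of \<open>prime_ln_error\<close>. As to \<open>G1\<close>, the
  partial sums of \<open>W\<close> are \<open>ln K + B + o(1)\<close> and those of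
  \<open>1 / Suc k\<close> are \<open>ln K + euler_mascheroni + o(1)\<close>, so the difference
  series \<open>c\<close> has the sum \<open>B - euler_mascheroni\<close>. Abel's theorem then
  compares \<open>G\<close>, which encloses \<open>G1\<close> up to the factor \<open>z\<close>,
  with \<open>- ln (1 - z) / z\<close>, again \<open>ln (1 / \<sigma>) + o(1)\<close>.\<close>

lemma mertens_constant:
  assumes B: "\<And>N. N \<ge> 2 \<Longrightarrow> \<bar>(\<Sum>p | prime p \<and> p < N. 1 / real p) - ln (ln (real N)) - B\<bar> \<le> 13 / ln (real N)"
  shows "B + suminf prime_ln_error = euler_mascheroni"
proof -
  define W where "W k = (\<Sum>p | prime p \<and> nat \<lfloor>ln (real p)\<rfloor> = k. 1 / real p)" for k :: nat
  define \<sigma> where "\<sigma> N = 1 / real (Suc N)" for N :: nat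
  define z where "z N = exp (- \<sigma> N)" for N :: nat
  define G where "G N = (\<Sum>k. W k * z N ^ k)" for N
  define G1 where "G1 N = (\<Sum>n. if prime n then real n powr (- 1 - \<sigma> N) else 0)" for N
  define E where "E N = (\<Sum>n. if prime n then - ln (1 - real n powr (- 1 - \<sigma> N)) - real n powr (- 1 - \<sigma> N) else 0)" for N
  define c where "c k = W k - 1 / real (Suc k)" for k
  have \<sigma>: "\<sigma> N > 0" for N by (simp add: \<sigma>_def)
  have z: "0 < z N" "z N < 1" for N using \<sigma> by (auto simp: z_def)
  note gr = prime_series_grouped[OF \<sigma>, folded W_def z_def]
  have ceil: "nat \<lceil>exp (real K)\<rceil> \<ge> 2" "real (nat \<lceil>exp (real K)\<rceil>) \<ge> exp (real K)"
    "real (nat \<lceil>exp (real K)\<rceil>) \<le> exp (real K) + 1" if "K \<ge> 1" for K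
  proof -
    have "1 + 1 \<le> exp (real K)" using exp_ge_add_one_self[of "real K"] that by linarith
    thus "nat \<lceil>exp (real K)\<rceil> \<ge> 2" "real (nat \<lceil>exp (real K)\<rceil>) \<ge> exp (real K)"
    "real (nat \<lceil>exp (real K)\<rceil>) \<le> exp (real K) + 1" by linarith+
  qed
  \<comment> \<open>Rounding \<open>exp K\<close> up to an integer changes the iterated logarithm
    only by a null sequence.\<close>
  have lnlim: "(\<lambda>K. ln (ln (real (nat \<lceil>exp (real K)\<rceil>))) - ln (real K)) \<longlonglongrightarrow> 0"
  proof (rule tendsto_sandwich[of "\<lambda>_. 0" _ _ "\<lambda>K. ln (ln (exp (real K) + 1)) - ln (real K)"])
    show "eventually (\<lambda>K. 0 \<le> ln (ln (real (nat \<lceil>exp (real K)\<rceil>))) - ln (real K)) sequentially"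
      using eventually_ge_at_top[of 1]
    proof eventually_elim
      case (elim K)
      have "real K \<le> ln (real (nat \<lceil>exp (real K)\<rceil>))" using ceil[OF elim] 
        by (metis exp_gt_zero ln_exp ln_mono)
      thus ?case using elim by (simp add: ln_mono)
    qed
    show "eventually (\<lambda>K. ln (ln (real (nat \<lceil>exp (real K)\<rceil>))) - ln (real K) \<le> ln (ln (exp (real K) + 1)) - ln (real K)) sequentially"
      using eventually_ge_at_top[of 1]
    proof eventually_elim
      case (elim K)
      have "ln (real (nat \<lceil>exp (real K)\<rceil>)) \<le> ln (exp (real K) + 1)" using ceil[OF elim] by (intro ln_mono) auto
      moreover have "ln (real (nat \<lceil>exp (real K)\<rceil>)) > 0" using ceil(1)[OF elim] by (intro ln_gt_zero) linarith
      ultimately show ?case by (simp add: ln_mono)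
    qed
    show "(\<lambda>K. ln (ln (exp (real K) + 1)) - ln (real K)) \<longlonglongrightarrow> 0" by real_asymp
  qed auto
  have Wlim: "(\<lambda>K. (\<Sum>k<K. W k) - ln (real K)) \<longlonglongrightarrow> B"
  proof -
    have "(\<lambda>K. (\<Sum>k<K. W k) - ln (ln (real (nat \<lceil>exp (real K)\<rceil>))) - B) \<longlonglongrightarrow> 0"
    proof (rule Lim_null_comparison)
      show "(\<lambda>K. 13 / real K) \<longlonglongrightarrow> 0" by real_asymp
      show "eventually (\<lambda>K. norm ((\<Sum>k<K. W k) - ln (ln (real (nat \<lceil>exp (real K)\<rceil>))) - B) \<le> 13 / real K) sequentially"
        using eventually_ge_at_top[of 1]
      proof eventually_elim
        case (elim K)
        have "real K \<le> ln (real (nat \<lceil>exp (real K)\<rceil>))" using ceil[OF elim] 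
          by (metis exp_gt_zero ln_exp ln_mono)
        hence "13 / ln (real (nat \<lceil>exp (real K)\<rceil>)) \<le> 13 / real K"
          using elim by (intro divide_left_mono mult_pos_pos) auto
        thus ?case using B[OF ceil(1)[OF elim]] unfolding gr(4) real_norm_def by linarith
      qed
    qed
    from tendsto_add[OF tendsto_add[OF this lnlim] tendsto_const[of B]] show ?thesis by simp
  qed
  have "(\<lambda>K. ((\<Sum>k<K. W k) - ln (real K)) - (harm K - ln (real K))) \<longlonglongrightarrow> B - euler_mascheroni"
    by (intro tendsto_diff Wlim euler_mascheroni_LIMSEQ)
  also have "(\<lambda>K. ((\<Sum>k<K. W k) - ln (real K)) - (harm K - ln (real K))) = (\<lambda>K. \<Sum>k<K. c k)"
    by (auto simp: c_def sum_subtractf harm_altdef inverse_eq_divide)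
  finally have c: "c sums (B - euler_mascheroni)" by (simp add: sums_def)
  have logs: "(\<lambda>k. z N ^ k * (1 / real (Suc k))) sums (- ln (1 - z N) / z N)" for N
  proof -
    have "(\<lambda>n. - ((- (- z N)) ^ n) / real n) sums ln (1 + (- z N))"
      by (rule ln_series') (use z[of N] in auto)
    hence "(\<lambda>n. - (1 / z N) * (- ((- (- z N)) ^ n) / real n)) sums (- (1 / z N) * ln (1 + (- z N)))"
      by (rule sums_mult)
    also have "(\<lambda>n. - (1 / z N) * (- ((- (- z N)) ^ n) / real n)) = (\<lambda>n. (1 / z N) * (z N ^ n / real n))"
      by auto
    finally have "(\<lambda>n. (1 / z N) * (z N ^ Suc n / real (Suc n))) sums (- (1 / z N) * ln (1 + (- z N)))"
      by (intro sums_Suc_iff[THEN iffD2]) simp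
    moreover have "(1 / z N) * (z N ^ Suc n / real (Suc n)) = z N ^ n * (1 / real (Suc n))" for n
      using z(1)[of N] by (simp add: field_simps)
    ultimately show ?thesis by simp
  qed
  have sc: "summable (\<lambda>k. z N ^ k * c k)" for N
    using summable_diff[OF gr(1) sums_summable[OF logs], of N N]
    by (simp add: c_def algebra_simps)
  have creg: "(\<lambda>N. \<Sum>k. z N ^ k * c k) \<longlonglongrightarrow> B - euler_mascheroni"
    unfolding sums_unique[OF c]
  proof (rule tendsto_suminf_regular[OF sums_summable[OF c]])
    show "(\<lambda>N. z N ^ k) \<longlonglongrightarrow> 1" for k
    proof -
      have "z \<longlonglongrightarrow> 1" unfolding z_def \<sigma>_def by real_asymp
      from tendsto_power[OF this, of k] show ?thesis by simp
    qed
  qed (use z sc in \<open>auto simp: power_le_one mult_left_le_one_le less_imp_le\<close>)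
  have G: "G N = (\<Sum>k. z N ^ k * c k) + (- ln (1 - z N) / z N)" for N
  proof -
    have "G N = (\<Sum>k. z N ^ k * c k + z N ^ k * (1 / real (Suc k)))"
      unfolding G_def by (intro suminf_cong) (simp add: c_def algebra_simps)
    also have "\<dots> = (\<Sum>k. z N ^ k * c k) + (\<Sum>k. z N ^ k * (1 / real (Suc k)))"
      by (intro suminf_add[symmetric] sc sums_summable[OF logs])
    finally show ?thesis by (simp only: sums_unique[OF logs, symmetric])
  qed
  have l1: "(\<lambda>N. - ln (1 - z N) / z N - ln (1 / \<sigma> N)) \<longlonglongrightarrow> 0" unfolding z_def \<sigma>_def by real_asymp
  have l2: "(\<lambda>N. - ln (1 - z N) - ln (1 / \<sigma> N)) \<longlonglongrightarrow> 0" unfolding z_def \<sigma>_def by real_asymp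
  have l3: "z \<longlonglongrightarrow> 1" unfolding z_def \<sigma>_def by real_asymp
  have up: "(\<lambda>N. G N - ln (1 / \<sigma> N)) \<longlonglongrightarrow> B - euler_mascheroni"
    using tendsto_add[OF creg l1] by (simp add: G algebra_simps)
  \<comment> \<open>The factor \<open>z\<close> of the lower bound cancels the denominator of
    \<open>- ln (1 - z) / z\<close>, so that no product of a null sequence with
    \<open>ln (1 / \<sigma>)\<close> has to be estimated.\<close>
  have lo: "(\<lambda>N. z N * G N - ln (1 / \<sigma> N)) \<longlonglongrightarrow> B - euler_mascheroni"
  proof -
    have eq: "z N * G N - ln (1 / \<sigma> N) = z N * (\<Sum>k. z N ^ k * c k) + (- ln (1 - z N) - ln (1 / \<sigma> N))" for N
      using z(1)[of N] by (simp add: G field_simps)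
    show ?thesis unfolding eq using tendsto_add[OF tendsto_mult[OF l3 creg] l2] by (simp only: mult_1 add_0_right)
  qed
  have G1: "(\<lambda>N. G1 N - ln (1 / \<sigma> N)) \<longlonglongrightarrow> B - euler_mascheroni"
    by (rule tendsto_sandwich[OF _ _ lo up]) (use gr(2,3) in \<open>auto simp: G1_def G_def\<close>)
  have E: "E \<longlonglongrightarrow> suminf prime_ln_error"
    unfolding E_def
  proof (rule tannerys_theorem[THEN conjunct2, THEN conjunct2])
    show "summable (\<lambda>n. 2 * (1 / real n ^ 2))"
      using inverse_power_summable[of 2, where 'a = real] by (intro summable_mult) (simp add: inverse_eq_divide)
    show "\<forall>\<^sub>F (k, n) in at_top \<times>\<^sub>F sequentially.
       norm (if prime k then - ln (1 - real k powr (- 1 - \<sigma> n)) - real k powr (- 1 - \<sigma> n) else 0) \<le> 2 * (1 / real k ^ 2)"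
    proof (rule always_eventually, safe)
      fix k n :: nat
      show "norm (if prime k then - ln (1 - real k powr (- 1 - \<sigma> n)) - real k powr (- 1 - \<sigma> n) else 0) \<le> 2 * (1 / real k ^ 2)"
      proof (cases "prime k")
        case True
        note half = powr_neg_le_half[OF prime_ge_2_nat[OF True] less_imp_le[OF \<sigma>], of n]
        have "(real k powr (- 1 - \<sigma> n))\<^sup>2 \<le> (1 / real k)\<^sup>2" using half by (intro power_mono) auto
        thus ?thesis using ln_one_minus_bounds[of "real k powr (- 1 - \<sigma> n)"] half True
          by (simp add: power_divide)
      qed auto
    qed
    show "(\<lambda>n. if prime k then - ln (1 - real k powr (- 1 - \<sigma> n)) - real k powr (- 1 - \<sigma> n) else 0) \<longlonglongrightarrow> prime_ln_error k" for k
    proof (cases "prime k")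
      case True
      have k: "real k > 1" using prime_gt_1_nat[OF True] by simp
      have "\<sigma> \<longlonglongrightarrow> 0" unfolding \<sigma>_def by real_asymp
      hence "(\<lambda>n. real k powr (- 1 - \<sigma> n)) \<longlonglongrightarrow> real k powr (- 1 - 0)"
        using k by (intro tendsto_intros) auto
      hence l: "(\<lambda>n. real k powr (- 1 - \<sigma> n)) \<longlonglongrightarrow> 1 / real k" by (simp add: powr_minus_divide)
      show ?thesis using True k unfolding prime_ln_error_def
        by (auto intro!: tendsto_intros l)
    qed (auto simp: prime_ln_error_def)
  qed auto
  have lnZ: "(\<lambda>N. ln (\<Sum>n. real n powr (- 1 - \<sigma> N)) - ln (1 / \<sigma> N)) \<longlonglongrightarrow> 0"
  proof (rule tendsto_sandwich[of "\<lambda>_. 0" _ _ "\<lambda>N. ln (1 + \<sigma> N)"])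
    show "(\<lambda>N. ln (1 + \<sigma> N)) \<longlonglongrightarrow> 0" unfolding \<sigma>_def by real_asymp
    show "eventually (\<lambda>N. 0 \<le> ln (\<Sum>n. real n powr (- 1 - \<sigma> N)) - ln (1 / \<sigma> N)) sequentially"
      using zeta_bounds(1)[OF \<sigma>] \<sigma> by (auto intro!: always_eventually ln_mono)
    show "eventually (\<lambda>N. ln (\<Sum>n. real n powr (- 1 - \<sigma> N)) - ln (1 / \<sigma> N) \<le> ln (1 + \<sigma> N)) sequentially"
    proof (intro always_eventually allI)
      fix N
      have pos: "(\<Sum>n. real n powr (- 1 - \<sigma> N)) > 0" 
        using zeta_bounds(1)[OF \<sigma>, of N] \<sigma>[of N] by (meson divide_pos_pos less_le_trans zero_less_one)
      have "ln (\<Sum>n. real n powr (- 1 - \<sigma> N)) \<le> ln ((1 + \<sigma> N) * (1 / \<sigma> N))"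
        using zeta_bounds(2)[OF \<sigma>, of N] \<sigma>[of N] pos by (intro ln_mono) (auto simp: field_simps)
      also have "\<dots> = ln (1 + \<sigma> N) + ln (1 / \<sigma> N)" using \<sigma>[of N] by (intro ln_mult_pos) auto
      finally show "ln (\<Sum>n. real n powr (- 1 - \<sigma> N)) - ln (1 / \<sigma> N) \<le> ln (1 + \<sigma> N)" by simp
    qed
  qed auto
  have "(\<lambda>N. (G1 N - ln (1 / \<sigma> N)) + E N) \<longlonglongrightarrow> (B - euler_mascheroni) + suminf prime_ln_error"
    by (intro tendsto_add G1 E)
  also have "(\<lambda>N. (G1 N - ln (1 / \<sigma> N)) + E N) = (\<lambda>N. ln (\<Sum>n. real n powr (- 1 - \<sigma> N)) - ln (1 / \<sigma> N))"
    by (auto simp: ln_zeta_eq[OF \<sigma>] G1_def E_def)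
  finally have "B - euler_mascheroni + suminf prime_ln_error = 0"
    using lnZ LIMSEQ_unique by blast
  thus ?thesis by simp
qed

text \<open>The constant is 13 from the second theorem plus 4 from the tail of
  \<open>prime_ln_error\<close>, which is at most \<open>4 / N\<close>.\<close>

lemma mertens_third_ln:
  assumes "N \<ge> 2"
  shows "\<bar>(\<Sum>p | prime p \<and> p < N. - ln (1 - 1 / real p)) - ln (ln (real N)) - euler_mascheroni\<bar> \<le> 17 / ln (real N)"
proof -
  obtain B where B: "\<And>N. N \<ge> 2 \<Longrightarrow> \<bar>(\<Sum>p | prime p \<and> p < N. 1 / real p) - ln (ln (real N)) - B\<bar> \<le> 13 / ln (real N)"
    using mertens_second by blast
  have Beq: "B + suminf prime_ln_error = euler_mascheroni" by (rule mertens_constant[OF B])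
  have "(\<Sum>p | prime p \<and> p < N. - ln (1 - 1 / real p)) = 
      (\<Sum>p | prime p \<and> p < N. 1 / real p) + (\<Sum>p | prime p \<and> p < N. prime_ln_error p)"
    unfolding sum.distrib[symmetric] by (intro sum.cong) (auto simp: prime_ln_error_def)
  also have "(\<Sum>p | prime p \<and> p < N. prime_ln_error p) = (\<Sum>n<N. prime_ln_error n)"
    by (intro sum.mono_neutral_left) (auto simp: prime_ln_error_def)
  also have "\<dots> = suminf prime_ln_error - (\<Sum>n. prime_ln_error (n + N))"
    using suminf_split_initial_segment[OF summable_prime_ln_error, of N] by simp
  finally have eq: "(\<Sum>p | prime p \<and> p < N. - ln (1 - 1 / real p)) - ln (ln (real N)) - euler_mascheroni =
     ((\<Sum>p | prime p \<and> p < N. 1 / real p) - ln (ln (real N)) - B) - (\<Sum>n. prime_ln_error (n + N))"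
    using Beq by simp
  have s: "summable (\<lambda>n. prime_ln_error (n + N))"
    by (rule summable_ignore_initial_segment[OF summable_prime_ln_error])
  have "0 \<le> (\<Sum>n. prime_ln_error (n + N))" by (rule suminf_nonneg[OF s]) (rule prime_ln_error_bounds)
  moreover have "(\<Sum>n. prime_ln_error (n + N)) \<le> (\<Sum>n. 2 * (1 / real (n + N) ^ 2))"
    by (intro suminf_le s prime_ln_error_bounds summable_mult suminf_inverse_square_tail_le(1)[OF assms])
  moreover have "(\<Sum>n. 2 * (1 / real (n + N) ^ 2)) \<le> 2 * (2 / real N)"
    by (subst suminf_mult[OF suminf_inverse_square_tail_le(1)[OF assms]])
       (intro mult_left_mono suminf_inverse_square_tail_le[OF assms], simp)
  moreover have "2 * (2 / real N) \<le> 4 / ln (real N)"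
  proof -
    have "ln (real N) \<le> real N" using assms ln_le_minus_one[of "real N"] by simp
    hence "4 / real N \<le> 4 / ln (real N)" using assms by (intro divide_left_mono) auto
    thus ?thesis by simp
  qed
  ultimately show ?thesis unfolding eq using B[OF assms] by linarith
qed

lemma prod_one_minus_inverse_square:
  assumes "N \<ge> 2"
  shows "\<bar>pi\<^sup>2 / 6 * (\<Prod>p | prime p \<and> p < N. 1 - 1 / real p ^ 2) - 1\<bar> \<le> 2 / real N"
proof -
  define f where "f n = 1 / real n ^ 2" for n :: nat
  have s: "(\<lambda>n. f (Suc n)) sums (pi\<^sup>2 / 6)" using inverse_squares_sums by (simp add: f_def)
  hence fs: "f sums (pi\<^sup>2 / 6)" by (subst (asm) sums_Suc_iff) (simp add: f_def)
  have m: "max 1 (N - 1) = N - 1" using assms by simp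
  have "norm (suminf f * (\<Prod>q | prime q \<and> q \<le> N - 1. 1 - f q) - 1) \<le> (\<Sum>n. norm (f (n + Suc (max 1 (N - 1)))))"
  proof (rule euler_product_error)
    show "summable (\<lambda>n. norm (f n))" using sums_summable[OF fs] by (simp add: f_def[abs_def])
  qed (auto simp: f_def power_mult_distrib)
  also have "(\<Sum>n. norm (f (n + Suc (max 1 (N - 1))))) = (\<Sum>n. 1 / real (n + N) ^ 2)"
    unfolding m using assms by (simp add: f_def)
  also have "\<dots> \<le> 2 / real N" by (rule suminf_inverse_square_tail_le[OF assms])
  also have "{q. prime q \<and> q \<le> N - 1} = {q. prime q \<and> q < N}" using assms by auto
  finally show ?thesis unfolding sums_unique[OF fs, symmetric] by (simp add: f_def)
qed

lemma abs_exp_minus_one_le: "\<bar>exp x - 1\<bar> \<le> \<bar>x\<bar> * exp \<bar>x\<bar>" for x :: real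
proof (cases "x \<ge> 0")
  case True
  have "1 - x \<le> exp (- x)" using exp_ge_add_one_self[of "-x"] by simp
  hence "exp x * (1 - x) \<le> exp x * exp (- x)" by (intro mult_left_mono) auto
  hence "exp x - 1 \<le> x * exp x" by (simp add: exp_minus algebra_simps)
  thus ?thesis using True by simp
next
  case False
  have "1 - exp x \<le> - x" using exp_ge_add_one_self[of x] by linarith
  also have "\<dots> \<le> \<bar>x\<bar> * exp \<bar>x\<bar>" using False mult_left_mono[of 1 "exp (-x)" "-x"] by simp
  finally show ?thesis using False by simp
qed

definition prime_ratio_prod :: "nat \<Rightarrow> real" where
  "prime_ratio_prod N = (\<Prod>p | prime p \<and> p < N. (real p + 1) / (real p - 1))"

theorem prime_ratio_prod_asymp:
  "\<exists>C. \<forall>N\<ge>2. \<bar>prime_ratio_prod N - 6 / pi\<^sup>2 * exp (2 * euler_mascheroni) * (ln (real N))\<^sup>2\<bar> \<le> C * ln (real N)"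
proof -
  define D where "D = 34 / ln (2::real)"
  define A where "A = 6 / pi\<^sup>2 * exp (2 * euler_mascheroni :: real)"
  define C where "C = A * (34 * exp D * 2 + 4)"
  have A0: "A > 0" by (simp add: A_def)
  show ?thesis unfolding A_def[symmetric]
  proof (intro exI[of _ C] allI impI)
    fix N :: nat assume N: "N \<ge> 2"
    define L where "L = ln (real N)"
    have L: "L \<ge> ln 2" "L > 0" unfolding L_def using N by (auto intro!: ln_mono)
    define d where "d = (\<Sum>p | prime p \<and> p < N. - ln (1 - 1 / real p)) - ln L - euler_mascheroni"
    define u where "u = pi\<^sup>2 / 6 * (\<Prod>p | prime p \<and> p < N. 1 - 1 / real p ^ 2) - 1"
    have d: "\<bar>d\<bar> \<le> 17 / L" using mertens_third_ln[OF N] by (simp add: d_def L_def)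
    have u: "\<bar>u\<bar> \<le> 2 / real N" using prod_one_minus_inverse_square[OF N] by (simp add: u_def)
    have fin: "finite {p. prime p \<and> p < N}" by (rule finite_subset[of _ "{..<N}"]) auto
    have lt: "1 / real p < 1" if "p \<in> {p. prime p \<and> p < N}" for p using that prime_gt_1_nat[of p] by simp
    \<comment> \<open>This factorisation is the origin of both constants: the first factor gives
      \<open>6 / pi^2\<close>, the square gives \<open>exp (2 * euler_mascheroni)\<close> and the
      squared logarithm.\<close>
    have "prime_ratio_prod N = (\<Prod>p | prime p \<and> p < N. (1 - 1 / real p ^ 2) * (inverse (1 - 1 / real p))\<^sup>2)"
      unfolding prime_ratio_prod_def
    proof (intro prod.cong refl)
      fix p assume "p \<in> {p. prime p \<and> p < N}"
      hence "real p > 1" using prime_gt_1_nat by auto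
      thus "(real p + 1) / (real p - 1) = (1 - 1 / real p ^ 2) * (inverse (1 - 1 / real p))\<^sup>2"
        by (simp add: divide_simps) (simp add: power2_eq_square algebra_simps)
    qed
    also have "\<dots> = (\<Prod>p | prime p \<and> p < N. 1 - 1 / real p ^ 2) * (\<Prod>p | prime p \<and> p < N. inverse (1 - 1 / real p))\<^sup>2"
      by (simp add: prod.distrib prod_power_distrib)
    also have "(\<Prod>p | prime p \<and> p < N. inverse (1 - 1 / real p)) = (\<Prod>p | prime p \<and> p < N. exp (- ln (1 - 1 / real p)))"
      using lt by (intro prod.cong) (auto simp: exp_minus)
    also have "\<dots> = exp (d + ln L + euler_mascheroni)"
      using fin by (simp add: exp_sum[symmetric] d_def)
    also have "\<dots>\<^sup>2 = exp (2 * d) * L\<^sup>2 * exp (2 * euler_mascheroni)"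
      using L by (simp add: exp_add exp_double power_mult_distrib)
    also have "(\<Prod>p | prime p \<and> p < N. 1 - 1 / real p ^ 2) = 6 / pi\<^sup>2 * (1 + u)"
      by (simp add: u_def field_simps)
    finally have eq: "prime_ratio_prod N = A * L\<^sup>2 * ((1 + u) * exp (2 * d))" by (simp add: A_def)
    \<comment> \<open>\<open>L \<ge> ln 2\<close> bounds the exponent by \<open>D\<close> for all
      \<open>N\<close>, which keeps \<open>exp (2 * d) - 1\<close> linear in
      \<open>1 / L\<close>.\<close>
    have "17 / L \<le> 17 / ln 2" using L by (intro divide_left_mono) auto
    hence dD: "\<bar>2 * d\<bar> \<le> D" using d by (simp add: D_def)
    have "\<bar>exp (2 * d) - 1\<bar> \<le> \<bar>2 * d\<bar> * exp \<bar>2 * d\<bar>" by (rule abs_exp_minus_one_le)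
    also have "\<dots> \<le> (34 / L) * exp D" using d dD L by (intro mult_mono) auto
    finally have e: "\<bar>exp (2 * d) - 1\<bar> \<le> (34 / L) * exp D" .
    have "L \<le> real N" using N ln_le_minus_one[of "real N"] by (simp add: L_def)
    hence "2 / real N \<le> 2 / L" using L by (intro divide_left_mono) auto
    hence uL: "\<bar>u\<bar> \<le> 2 / L" using u by linarith
    have "2 / real N \<le> 1" using N by simp
    hence u1: "\<bar>u\<bar> \<le> 1" using u by linarith
    have "\<bar>(1 + u) * exp (2 * d) - 1\<bar> = \<bar>(1 + u) * (exp (2 * d) - 1) + u\<bar>" by (simp add: algebra_simps)
    also have "\<dots> \<le> \<bar>1 + u\<bar> * \<bar>exp (2 * d) - 1\<bar> + \<bar>u\<bar>" by (metis abs_mult abs_triangle_ineq)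
    also have "\<dots> \<le> 2 * ((34 / L) * exp D) + 2 / L" using u1 e uL by (intro add_mono mult_mono) auto
    also have "\<dots> \<le> (34 * exp D * 2 + 4) / L" using L by (simp add: field_simps)
    finally have f: "\<bar>(1 + u) * exp (2 * d) - 1\<bar> \<le> (34 * exp D * 2 + 4) / L" .
    have "prime_ratio_prod N - A * L\<^sup>2 = A * L\<^sup>2 * ((1 + u) * exp (2 * d) - 1)" unfolding eq by (simp add: algebra_simps)
    hence "\<bar>prime_ratio_prod N - A * L\<^sup>2\<bar> = A * L\<^sup>2 * \<bar>(1 + u) * exp (2 * d) - 1\<bar>" using A0 by (simp add: abs_mult)
    also have "\<dots> \<le> A * L\<^sup>2 * ((34 * exp D * 2 + 4) / L)" using f A0 by (intro mult_left_mono) auto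
    also have "\<dots> = C * L" using L by (simp add: C_def power2_eq_square)
    finally show "\<bar>prime_ratio_prod N - A * (ln (real N))\<^sup>2\<bar> \<le> C * ln (real N)" by (simp add: L_def)
  qed
qed

section \<open>Bounded characters\<close>

text \<open>\<open>ln x / x\<close> decreases from \<open>exp 1\<close> on, hence the start at
  3.\<close>

lemma ln_div_self_decreasing:
  assumes "n \<ge> 3"
  shows "ln (real (Suc n)) / real (Suc n) \<le> ln (real n) / real n"
proof -
  have "exp 1 \<le> real n" using exp_le assms by linarith
  hence "1 \<le> ln (real n)" using assms by (subst ln_ge_iff) auto
  moreover have "real n * (ln (real (Suc n)) - ln (real n)) \<le> 1"
    using ln_diff_le[of "real (Suc n)" "real n"] assms by (simp add: field_simps)
  ultimately have "real n * ln (real (Suc n)) \<le> real (Suc n) * ln (real n)" by (simp add: algebra_simps)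
  thus ?thesis using assms by (simp add: divide_simps mult.commute)
qed

text \<open>The properties of a non-principal character on which the estimates near
  \<open>s = 1\<close> rest: complete multiplicativity and bounded block sums. For a character
  modulo \<open>p\<close> the constant will be \<open>2 * p\<close>.\<close>

locale bounded_character =
  fixes \<eta> :: "nat \<Rightarrow> complex" and C :: real
  assumes mult: "\<eta> (m * n) = \<eta> m * \<eta> n"
    and zero: "\<eta> 0 = 0" and one: "\<eta> 1 = 1"
    and norm_le_1: "norm (\<eta> n) \<le> 1"
    and partial_sums: "norm (\<Sum>i=m..<n. \<eta> i) \<le> C"
begin

lemma C_ge_1: "C \<ge> 1"
  using partial_sums[of 1 2] one by (simp add: numeral_2_eq_2)

definition Lval :: "real \<Rightarrow> complex" where
  "Lval s = (\<Sum>n. (real n powr (-s)) *\<^sub>R \<eta> n)"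

lemma summable_Lval: "s > 0 \<Longrightarrow> summable (\<lambda>n. (real n powr (-s)) *\<^sub>R \<eta> n)"
  and Lval_tail: "s > 0 \<Longrightarrow> m \<ge> 1 \<Longrightarrow> norm (Lval s - (\<Sum>n<m. (real n powr (-s)) *\<^sub>R \<eta> n)) \<le> C * real m powr (-s)"
proof -
  assume s: "s > 0"
  have lim: "(\<lambda>n. real n powr (-s)) \<longlonglongrightarrow> 0" using s by real_asymp
  have dec: "real (Suc k) powr (-s) \<le> real k powr (-s)" if "k \<ge> 1" for k
    using s that by (intro powr_mono2') auto
  show "summable (\<lambda>n. (real n powr (-s)) *\<^sub>R \<eta> n)"
    by (rule dirichlet_test(1)[where ?m0.0 = 1, OF _ _ lim]) (use partial_sums dec in auto)
  assume "m \<ge> 1"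
  show "norm (Lval s - (\<Sum>n<m. (real n powr (-s)) *\<^sub>R \<eta> n)) \<le> C * real m powr (-s)"
    unfolding Lval_def
    by (rule dirichlet_test(2)[where ?m0.0 = 1, OF _ _ lim \<open>m \<ge> 1\<close>]) (use partial_sums dec in auto)
qed

lemma norm_Lval_le: "s > 0 \<Longrightarrow> norm (Lval s) \<le> C"
  using Lval_tail[of s 1] by simp

text \<open>Both series are cut at \<open>N\<close>, with tails at most \<open>C / N\<close>; for
  \<open>n < N\<close> the two weights differ by at most \<open>ln n / (N * n)\<close>, because
  \<open>1 - exp (- x) \<le> x\<close>.\<close>

lemma Lval_diff_le:
  assumes "N \<ge> 1"
  shows "norm (Lval (1 + 1 / real N) - Lval 1) \<le> (ln (real N) * (1 + ln (real N)) + 2 * C) / real N"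
proof -
  define \<sigma> where "\<sigma> = 1 / real N"
  have \<sigma>: "\<sigma> > 0" using assms by (simp add: \<sigma>_def)
  have tail: "norm (Lval s - (\<Sum>n<N. (real n powr (-s)) *\<^sub>R \<eta> n)) \<le> C / real N" if "s \<ge> 1" for s
  proof -
    have "norm (Lval s - (\<Sum>n<N. (real n powr (-s)) *\<^sub>R \<eta> n)) \<le> C * real N powr (-s)"
      using that assms by (intro Lval_tail) auto
    also have "\<dots> \<le> C * real N powr (-1)" using that assms C_ge_1 by (intro mult_left_mono powr_mono) auto
    finally show ?thesis using assms by (simp add: powr_minus_divide)
  qed
  have "norm ((\<Sum>n<N. (real n powr (-(1 + \<sigma>))) *\<^sub>R \<eta> n) - (\<Sum>n<N. (real n powr (-1)) *\<^sub>R \<eta> n))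
     \<le> (\<Sum>n<N. \<bar>real n powr (-(1 + \<sigma>)) - real n powr (-1)\<bar>)"
    unfolding sum_subtractf[symmetric] scaleR_diff_left[symmetric]
    by (intro order.trans[OF norm_sum] sum_mono) (use norm_le_1 in \<open>auto intro: mult_left_le\<close>)
  also have "\<dots> = (\<Sum>n=1..<N. \<bar>real n powr (-(1 + \<sigma>)) - real n powr (-1)\<bar>)"
    by (intro sum.mono_neutral_right) (auto simp: not_le)
  also have "\<dots> \<le> (\<Sum>n=1..<N. \<sigma> * ln (real N) * (1 / real n))"
  proof (rule sum_mono)
    fix n assume n: "n \<in> {1..<N}"
    have "real n powr (-(1 + \<sigma>)) = real n powr (-1) * real n powr (-\<sigma>)"
      by (simp only: powr_add[symmetric]) simp
    also have "real n powr (-1) = 1 / real n" by (simp add: powr_minus_divide)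
    also have "real n powr (-\<sigma>) = exp (-\<sigma> * ln (real n))" using n by (simp add: powr_def)
    finally have "real n powr (-(1 + \<sigma>)) = 1 / real n * exp (-\<sigma> * ln (real n))" .
    moreover have "real n powr (-1) = 1 / real n" by (simp add: powr_minus_divide)
    ultimately have "\<bar>real n powr (-(1 + \<sigma>)) - real n powr (-1)\<bar> = 1 / real n * (1 - exp (-\<sigma> * ln (real n)))"
      using n \<sigma> by (simp add: field_simps)
    also have "\<dots> \<le> 1 / real n * (\<sigma> * ln (real n))"
      using exp_ge_add_one_self[of "-\<sigma> * ln (real n)"] by (intro mult_left_mono) (linarith, simp)
    also have "\<dots> \<le> 1 / real n * (\<sigma> * ln (real N))" using n \<sigma> by (intro mult_left_mono ln_mono) auto
    finally show "\<bar>real n powr (-(1 + \<sigma>)) - real n powr (-1)\<bar> \<le> \<sigma> * ln (real N) * (1 / real n)" by (simp add: mult_ac)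
  qed
  also have "\<dots> = \<sigma> * ln (real N) * (\<Sum>n=1..<N. 1 / real n)" by (simp add: sum_distrib_left)
  also have "\<dots> \<le> \<sigma> * ln (real N) * (1 + ln (real N))"
  proof (intro mult_left_mono)
    have "(\<Sum>n=1..<N. 1 / real n) \<le> harm N" unfolding harm_def
      by (subst inverse_eq_divide, intro sum_mono2) auto
    also have "\<dots> \<le> 1 + ln (real N)" 
      using euler_mascheroni_sequence_decreasing[of 1 N] assms by (auto simp: harm_def)
    finally show "(\<Sum>n=1..<N. 1 / real n) \<le> 1 + ln (real N)" .
  qed (use \<sigma> assms in auto)
  finally have le: "norm ((\<Sum>n<N. (real n powr (-(1 + \<sigma>))) *\<^sub>R \<eta> n) - (\<Sum>n<N. (real n powr (-1)) *\<^sub>R \<eta> n))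
     \<le> \<sigma> * ln (real N) * (1 + ln (real N))" .
  have tri: "norm (a + b - c) \<le> norm a + norm b + norm c" for a b c :: complex
    using norm_triangle_ineq4[of "a + b" c] norm_triangle_ineq[of a b] by linarith
  from le have "norm ((Lval (1 + \<sigma>) - (\<Sum>n<N. (real n powr (-(1 + \<sigma>))) *\<^sub>R \<eta> n)) +
      ((\<Sum>n<N. (real n powr (-(1 + \<sigma>))) *\<^sub>R \<eta> n) - (\<Sum>n<N. (real n powr (-1)) *\<^sub>R \<eta> n)) -
      (Lval 1 - (\<Sum>n<N. (real n powr (-1)) *\<^sub>R \<eta> n))) \<le> C / real N + \<sigma> * ln (real N) * (1 + ln (real N)) + C / real N"
    using tail[of "1 + \<sigma>"] tail[of 1] \<sigma> by (intro order.trans[OF tri] add_mono) auto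
  hence "norm (Lval (1 + \<sigma>) - Lval 1) \<le> C / real N + \<sigma> * ln (real N) * (1 + ln (real N)) + C / real N"
    by simp
  also have "\<dots> = (ln (real N) * (1 + ln (real N)) + 2 * C) / real N"
    using assms by (simp add: \<sigma>_def field_simps)
  finally show ?thesis by (simp add: \<sigma>_def)
qed

text \<open>Mertens' argument: \<open>ln\<close> is the divisor sum of \<open>mangoldt\<close>, so
  the bounded sum \<open>S\<close> of \<open>\<eta> n * ln n / n\<close> equals the sum over
  \<open>d\<close> of \<open>\<eta> d * mangoldt d / d * T (N div d)\<close>. Each
  \<open>T (N div d)\<close> is \<open>Lval 1\<close> up to \<open>C * d / N\<close>, and by
  Chebyshev's bound these errors amount to at most \<open>3 * C\<close>. A lower bound for
  \<open>norm (Lval 1)\<close> thus becomes an upper bound for the twisted sum.\<close>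

lemma Lval_1_times_mangoldt_sum:
  assumes "N > 0"
  shows "norm (Lval 1) * norm (\<Sum>n=1..N. \<eta> n * mangoldt n / of_nat n) \<le> 5 * C"
proof -
  define S where "S = (\<Sum>n=1..N. (ln (real n) / real n) *\<^sub>R \<eta> n)"
  define \<Sigma> where "\<Sigma> = (\<Sum>n=1..N. \<eta> n * mangoldt n / of_nat n)"
  define T where "T M = (\<Sum>m=1..M. \<eta> m / of_nat m)" for M
  have T: "norm (T M - Lval 1) \<le> C / real (Suc M)" for M
  proof -
    have "T M = (\<Sum>n<Suc M. (real n powr (-1)) *\<^sub>R \<eta> n)"
      unfolding T_def by (intro sum.mono_neutral_cong_left) (auto simp: powr_minus_divide scaleR_conv_of_real)
    thus ?thesis using Lval_tail[of 1 "Suc M"] by (simp add: powr_minus_divide norm_minus_commute del: of_nat_Suc)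
  qed
  have "S = (\<Sum>n=1..N. \<Sum>d | d dvd n. (\<eta> d * mangoldt d / of_nat d) * (\<eta> (n div d) / of_nat (n div d)))"
    unfolding S_def
  proof (intro sum.cong refl)
    fix n assume n: "n \<in> {1..N}"
    have "(\<Sum>d | d dvd n. (\<eta> d * mangoldt d / of_nat d) * (\<eta> (n div d) / of_nat (n div d))) =
       (\<Sum>d | d dvd n. mangoldt d * (\<eta> n / of_nat n))"
    proof (intro sum.cong refl)
      fix d assume "d \<in> {d. d dvd n}"
      then obtain m where m: "n = d * m" by auto
      with n have "d > 0" "m > 0" by auto
      thus "(\<eta> d * mangoldt d / of_nat d) * (\<eta> (n div d) / of_nat (n div d)) = mangoldt d * (\<eta> n / of_nat n)"
        by (simp add: m mult)
    qed
    also have "\<dots> = of_real (ln (real n)) * (\<eta> n / of_nat n)"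
      using n by (subst sum_distrib_right[symmetric], subst mangoldt_sum) auto
    finally show "(ln (real n) / real n) *\<^sub>R \<eta> n = (\<Sum>d | d dvd n. (\<eta> d * mangoldt d / of_nat d) * (\<eta> (n div d) / of_nat (n div d)))"
      by (simp add: scaleR_conv_of_real)
  qed
  also have "\<dots> = (\<Sum>d=1..N. \<Sum>m=1..N div d. (\<eta> d * mangoldt d / of_nat d) * (\<eta> m / of_nat m))"
    by (rule sum_divisors_swap[of "\<lambda>d m. (\<eta> d * mangoldt d / of_nat d) * (\<eta> m / of_nat m)"])
  also have "\<dots> = (\<Sum>d=1..N. (\<eta> d * mangoldt d / of_nat d) * T (N div d))"
    by (simp add: T_def sum_distrib_left)
  finally have LS: "Lval 1 * \<Sigma> = S - (\<Sum>d=1..N. (\<eta> d * mangoldt d / of_nat d) * (T (N div d) - Lval 1))"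
    by (simp add: \<Sigma>_def sum_distrib_left sum_subtractf diff_divide_distrib ring_distribs mult_ac)
  moreover have "norm (\<Sum>d=1..N. (\<eta> d * mangoldt d / of_nat d) * (T (N div d) - Lval 1)) \<le> 3 * C"
  proof -
    have "norm (\<Sum>d=1..N. (\<eta> d * mangoldt d / of_nat d) * (T (N div d) - Lval 1)) \<le> (\<Sum>d=1..N. mangoldt d * (C / real N))"
    proof (intro order.trans[OF norm_sum] sum_mono)
      fix d assume d: "d \<in> {1..N}"
      have "N < d * Suc (N div d)" using d dividend_less_times_div[of d N] by simp
      hence "real N \<le> real d * real (Suc (N div d))" by (simp only: of_nat_mult[symmetric] of_nat_le_iff)
      hence "C / real (Suc (N div d)) \<le> C * real d / real N"
        using C_ge_1 assms by (simp add: field_simps del: of_nat_Suc)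
      hence 1: "norm (T (N div d) - Lval 1) \<le> C * real d / real N" using T[of "N div d"] by linarith
      have "norm (\<eta> d * mangoldt d / of_nat d) \<le> mangoldt d / real d"
        using norm_le_1[of d] by (auto simp: norm_mult norm_divide mangoldt_nonneg intro!: divide_right_mono mult_left_le_one_le)
      hence "norm ((\<eta> d * mangoldt d / of_nat d) * (T (N div d) - Lval 1)) \<le> mangoldt d / real d * (C * real d / real N)"
        unfolding norm_mult using 1 by (intro mult_mono) (auto simp: mangoldt_nonneg)
      thus "norm ((\<eta> d * mangoldt d / of_nat d) * (T (N div d) - Lval 1)) \<le> mangoldt d * (C / real N)"
        using d by simp
    qed
    also have "\<dots> = (\<Sum>d=1..N. mangoldt d) * (C / real N)" by (simp only: sum_distrib_right)
    also have "\<dots> \<le> (3 * real N) * (C / real N)"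
      using C_ge_1 by (intro mult_right_mono chebyshev_psi_le) auto
    finally show ?thesis using assms by simp
  qed
  moreover have "norm S \<le> C + 1"
  proof -
    define f where "f n = ln (real n) / real n" for n :: nat
    have f3: "f n \<le> 1" for n
    proof (cases "n = 0")
      case False
      thus ?thesis using ln_le_minus_one[of "real n"] by (simp add: f_def field_simps)
    qed (auto simp: f_def)
    have "norm (\<Sum>i=3..<max 3 (Suc N). f i *\<^sub>R \<eta> i) \<le> C * f 3"
      by (rule norm_sum_scaleR_decreasing_le)
         (use partial_sums ln_div_self_decreasing in \<open>auto simp: f_def simp del: of_nat_Suc\<close>)
    also have "\<dots> \<le> C * 1" using C_ge_1 f3 by (intro mult_left_mono) auto
    finally have 1: "norm (\<Sum>i=3..<max 3 (Suc N). f i *\<^sub>R \<eta> i) \<le> C" by simp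
    \<comment> \<open>The weights decrease only from 3 on, so the indices 1 and 2 are taken
      separately; together they are worth at most 1.\<close>
    have Seq: "S = (\<Sum>i\<in>{1..N} \<inter> {1,2}. f i *\<^sub>R \<eta> i) + (\<Sum>i=3..<max 3 (Suc N). f i *\<^sub>R \<eta> i)"
      unfolding S_def f_def[symmetric] by (subst sum.union_disjoint[symmetric]) (auto intro!: sum.cong)
    moreover have "norm (\<Sum>i\<in>{1..N} \<inter> {1,2}. f i *\<^sub>R \<eta> i) \<le> 1"
    proof -
      have "norm (\<Sum>i\<in>{1..N} \<inter> {1,2}. f i *\<^sub>R \<eta> i) \<le> (\<Sum>i\<in>{1..N} \<inter> {1,2}. norm (f i *\<^sub>R \<eta> i))" by (rule norm_sum)
      also have "\<dots> \<le> (\<Sum>i\<in>{1,2}. norm (f i *\<^sub>R \<eta> i))" by (intro sum_mono2) auto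
      also have "\<dots> = \<bar>f 2\<bar> * norm (\<eta> 2)" by (simp add: f_def)
      also have "\<dots> \<le> 1 * 1" using f3[of 2] norm_le_1[of 2] by (intro mult_mono) (auto simp: f_def)
      finally show ?thesis by simp
    qed
    ultimately show ?thesis
      unfolding Seq using 1 norm_triangle_ineq[of "\<Sum>i\<in>{1..N} \<inter> {1,2}. f i *\<^sub>R \<eta> i" "\<Sum>i=3..<max 3 (Suc N). f i *\<^sub>R \<eta> i"]
      by linarith
  qed
  ultimately have "norm (Lval 1 * \<Sigma>) \<le> (C + 1) + 3 * C"
    unfolding LS using norm_triangle_ineq4[of S "\<Sum>d=1..N. (\<eta> d * mangoldt d / of_nat d) * (T (N div d) - Lval 1)"] by linarith
  also have "\<dots> \<le> 5 * C" using C_ge_1 by simp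
  finally show ?thesis by (simp add: \<Sigma>_def norm_mult)
qed

end

section \<open>Lower bound for L(1) of a real character\<close>

text \<open>With the geometric sums \<open>A\<close> and \<open>B\<close> the claim becomes
  \<open>n * (n + 1) * z ^ n \<le> A * B\<close>. By the inequality of the arithmetic and geometric
  means, applied to \<open>z ^ i\<close> and its mirror image, a geometric sum of length
  \<open>m\<close> is at least \<open>m * z powr ((m - 1) / 2)\<close>; for lengths \<open>n\<close>
  and \<open>n + 1\<close> the exponents add up to \<open>n - 1 / 2\<close>, less than
  \<open>n\<close>.\<close>

lemma lambert_coefficient_decreasing:
  fixes z :: real
  assumes z: "0 < z" "z < 1" and n: "n \<ge> 1"
  shows "1 / (real (Suc n) * (1 - z)) - z ^ Suc n / (1 - z ^ Suc n) \<le> 1 / (real n * (1 - z)) - z ^ n / (1 - z ^ n)"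
proof -
  have amgm: "real m * z powr ((real m - 1) / 2) \<le> (\<Sum>i<m. z ^ i)" for m
  proof -
    have "2 * (real m * z powr ((real m - 1) / 2)) = (\<Sum>i<m. 2 * z powr ((real m - 1) / 2))" by simp
    also have "\<dots> \<le> (\<Sum>i<m. z ^ i + z ^ (m - Suc i))"
    proof (rule sum_mono)
      fix i assume "i \<in> {..<m}"
      hence i: "i < m" by simp
      define a b where "a = z powr (real i / 2)" and "b = z powr (real (m - Suc i) / 2)"
      have "a\<^sup>2 = z ^ i" "b\<^sup>2 = z ^ (m - Suc i)"
        using z by (simp_all add: a_def b_def power2_eq_square powr_add[symmetric] powr_realpow)
      moreover have "a * b = z powr ((real m - 1) / 2)"
        using i by (simp add: a_def b_def powr_add[symmetric] of_nat_diff field_simps)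
      moreover have "2 * (a * b) \<le> a\<^sup>2 + b\<^sup>2" using sum_squares_bound[of a b] by simp
      ultimately show "2 * z powr ((real m - 1) / 2) \<le> z ^ i + z ^ (m - Suc i)" by simp
    qed
    also have "\<dots> = 2 * (\<Sum>i<m. z ^ i)" by (simp add: sum.distrib sum.nat_diff_reindex)
    finally show ?thesis by simp
  qed
  define A B where "A = (\<Sum>i<n. z ^ i)" and "B = (\<Sum>i<Suc n. z ^ i)"
  have A: "1 - z ^ n = (1 - z) * A" and B: "1 - z ^ Suc n = (1 - z) * B"
    unfolding A_def B_def by (rule one_diff_power_eq)+
  have "{..<n} \<noteq> {}" using n by (auto simp: lessThan_empty_iff)
  hence pos: "A > 0" "B > 0" unfolding A_def B_def using z by (auto intro!: sum_pos simp del: sum.lessThan_Suc)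
  have "real n * real (Suc n) * z ^ n = (real n * real (Suc n)) * z powr (real n)" using z by (simp add: powr_realpow)
  also have "\<dots> \<le> (real n * real (Suc n)) * z powr (real n - 1 / 2)"
    using z by (intro mult_left_mono powr_mono') auto
  also have "\<dots> = (real n * z powr ((real n - 1) / 2)) * (real (Suc n) * z powr ((real (Suc n) - 1) / 2))"
  proof -
    have "(real n - 1) / 2 + (real (Suc n) - 1) / 2 = real n - 1 / 2" by (simp add: field_simps)
    hence "z powr (real n - 1 / 2) = z powr ((real n - 1) / 2) * z powr ((real (Suc n) - 1) / 2)"
      by (metis powr_add)
    thus ?thesis by (simp only: mult_ac)
  qed
  also have "\<dots> \<le> A * B" unfolding A_def B_def using amgm[of n] amgm[of "Suc n"]
    using z by (intro mult_mono) (auto intro!: sum_nonneg simp del: of_nat_Suc)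
  finally have key: "real n * real (Suc n) * z ^ n \<le> A * B" .
  have "z ^ n / (1 - z ^ n) - z ^ Suc n / (1 - z ^ Suc n) = z ^ n / ((1 - z) * (A * B))"
  proof -
    have "z ^ n / (1 - z ^ n) - z ^ Suc n / (1 - z ^ Suc n) = z ^ n * ((1 - z ^ Suc n) - z * (1 - z ^ n)) / ((1 - z ^ n) * (1 - z ^ Suc n))"
      using z pos A B by (subst diff_frac_eq) (auto simp: algebra_simps)
    also have "(1 - z ^ Suc n) - z * (1 - z ^ n) = 1 - z" by (simp add: algebra_simps)
    also have "z ^ n * (1 - z) / ((1 - z ^ n) * (1 - z ^ Suc n)) = z ^ n / ((1 - z) * (A * B))"
      unfolding A B using z by (simp add: divide_simps)
    finally show ?thesis .
  qed
  also have "\<dots> \<le> 1 / ((1 - z) * (real n * real (Suc n)))"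
    using key z pos n by (simp add: divide_simps mult_ac del: of_nat_Suc)
  also have "\<dots> = 1 / (real n * (1 - z)) - 1 / (real (Suc n) * (1 - z))"
    using z n by (simp add: divide_simps) 
  finally show ?thesis by simp
qed

text \<open>\<open>\<psi>\<close> is \<open>\<eta>\<close> as a real-valued function, so that signs
  and order make sense.\<close>

locale real_bounded_character = bounded_character +
  fixes \<psi> :: "nat \<Rightarrow> real"
  assumes eta_eq: "\<eta> n = of_real (\<psi> n)"
    and psi_values: "\<psi> n \<in> {-1, 0, 1}"
begin

lemma \<psi>_mult: "\<psi> (m * n) = \<psi> m * \<psi> n"
  using mult[of m n] by (simp add: eta_eq flip: of_real_mult)

lemma \<psi>_one: "\<psi> 1 = 1" and \<psi>_zero: "\<psi> 0 = 0"
  using one zero by (simp_all add: eta_eq)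

text \<open>The Dirichlet convolution of \<open>\<psi>\<close> with 1, that is the coefficients of
  zeta times the L-series of \<open>\<psi>\<close>.\<close>

definition div_sum :: "nat \<Rightarrow> real" where
  "div_sum m = (\<Sum>d | d dvd m. \<psi> d)"

lemma div_sum_prime_power:
  assumes p: "prime p" and n: "\<not> p dvd n" "n > 0"
  shows "div_sum (p ^ k * n) = (\<Sum>i\<le>k. \<psi> p ^ i) * div_sum n"
proof (induction k)
  case 0
  show ?case by simp
next
  case (Suc k)
  define M where "M = p ^ k * n"
  have p0: "p > 0" using p by (rule prime_gt_0_nat)
  have M: "M > 0" using p0 n by (simp add: M_def)
  \<comment> \<open>A divisor of \<open>p * M\<close> is a multiple of \<open>p\<close> or prime to
    \<open>p\<close>, and in the latter case it divides \<open>n\<close>.\<close>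
  have "{d. d dvd p * M} = (\<lambda>d. p * d) ` {d. d dvd M} \<union> {d. d dvd n}"
  proof (intro equalityI subsetI)
    fix d assume d: "d \<in> {d. d dvd p * M}"
    show "d \<in> (\<lambda>d. p * d) ` {d. d dvd M} \<union> {d. d dvd n}"
    proof (cases "p dvd d")
      case True
      then obtain e where "d = p * e" by auto
      with d p0 show ?thesis by auto
    next
      case False
      hence "coprime d (p ^ Suc k)" using p 
        by (metis coprime_commute coprime_power_right_iff prime_imp_coprime)
      moreover have "d dvd p ^ Suc k * n" using d by (simp add: M_def mult_ac)
      ultimately show ?thesis by (simp add: coprime_dvd_mult_right_iff del: power_Suc)
    qed
  qed (auto simp: M_def)
  hence "div_sum (p * M) = (\<Sum>d\<in>(\<lambda>d. p * d) ` {d. d dvd M} \<union> {d. d dvd n}. \<psi> d)" by (simp add: div_sum_def)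
  also have "\<dots> = (\<Sum>d\<in>(\<lambda>d. p * d) ` {d. d dvd M}. \<psi> d) + div_sum n"
    unfolding div_sum_def
  proof (rule sum.union_disjoint)
    show "(\<lambda>d. p * d) ` {d. d dvd M} \<inter> {d. d dvd n} = {}" using n(1) by (auto dest: dvd_mult_left)
  qed (use M n in auto)
  also have "(\<Sum>d\<in>(\<lambda>d. p * d) ` {d. d dvd M}. \<psi> d) = \<psi> p * div_sum M"
    using p0 by (subst sum.reindex) (auto simp: inj_on_def \<psi>_mult div_sum_def sum_distrib_left)
  also have "div_sum M = (\<Sum>i\<le>k. \<psi> p ^ i) * div_sum n" unfolding M_def by (rule Suc.IH)
  finally have "div_sum (p * M) = (\<psi> p * (\<Sum>i\<le>k. \<psi> p ^ i) + 1) * div_sum n" by (simp add: algebra_simps)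
  also have "\<psi> p * (\<Sum>i\<le>k. \<psi> p ^ i) + 1 = (\<Sum>i\<le>Suc k. \<psi> p ^ i)"
    by (subst sum.atMost_Suc_shift) (simp add: sum_distrib_left)
  finally show ?case by (simp add: M_def mult_ac)
qed

lemma geometric_sum_values:
  "(\<Sum>i\<le>k. \<psi> p ^ i) \<ge> 0" "even k \<Longrightarrow> (\<Sum>i\<le>k. \<psi> p ^ i) \<ge> 1"
proof -
  have m1: "(\<Sum>i\<le>k. (-1::real) ^ i) = (if even k then 1 else 0)" by (induction k) auto
  have z: "(\<Sum>i\<le>k. (0::real) ^ i) = 1" by (induction k) auto
  show "(\<Sum>i\<le>k. \<psi> p ^ i) \<ge> 0" "even k \<Longrightarrow> (\<Sum>i\<le>k. \<psi> p ^ i) \<ge> 1"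
    using psi_values[of p] m1 z by auto
qed

text \<open>One prime is split off with its full power: its factor is nonnegative, and at least 1
  for an even exponent. Being a square is expressed by even multiplicities because this form passes
  to the cofactor \<open>n\<close>.\<close>

lemma div_sum_nonneg_aux:
  "m > 0 \<Longrightarrow> div_sum m \<ge> 0 \<and> ((\<forall>q. prime q \<longrightarrow> even (multiplicity q m)) \<longrightarrow> div_sum m \<ge> 1)"
proof (induction m rule: less_induct)
  case (less m)
  show ?case
  proof (cases "m = 1")
    case True
    thus ?thesis using \<psi>_one by (simp add: div_sum_def)
  next
    case False
    then obtain p where p: "prime p" "p dvd m" using prime_factor_nat by blast
    define k where "k = multiplicity p m"
    obtain n where n: "m = p ^ k * n" "\<not> p dvd n"
      using multiplicity_decompose'[of m p] less.prems p unfolding k_def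
      by (metis gr_implies_not0 not_prime_unit)
    have n0: "n > 0" using n less.prems by (cases n) auto
    have "k > 0" unfolding k_def using p less.prems by (simp add: prime_multiplicity_gt_zero_iff)
    hence "p ^ k > 1" using prime_gt_1_nat[OF p(1)] by (intro one_less_power)
    hence "n < m" using n n0 by simp
    note IH = less.IH[OF this n0]
    have eq: "div_sum m = (\<Sum>i\<le>k. \<psi> p ^ i) * div_sum n"
      unfolding n(1) by (rule div_sum_prime_power[OF p(1) n(2) n0])
    have ev: "even (multiplicity q n)" if "prime q" "\<forall>q. prime q \<longrightarrow> even (multiplicity q m)" for q
    proof (cases "q = p")
      case True
      thus ?thesis using n(2) by (simp add: not_dvd_imp_multiplicity_0)
    next
      case False
      hence "multiplicity q m = multiplicity q n"
        unfolding n(1) using that p n0 prime_gt_0_nat[OF p(1)]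
        by (subst prime_elem_multiplicity_mult_distrib)
           (auto simp: prime_elem_multiplicity_power_distrib prime_multiplicity_other)
      moreover have "even (multiplicity q m)" using that by blast
      ultimately show ?thesis by simp
    qed
    show ?thesis unfolding eq
    proof (intro conjI impI)
      show "0 \<le> (\<Sum>i\<le>k. \<psi> p ^ i) * div_sum n" using IH geometric_sum_values by (intro mult_nonneg_nonneg) auto
      assume a: "\<forall>q. prime q \<longrightarrow> even (multiplicity q m)"
      hence "even k" using p by (simp add: k_def)
      moreover have "div_sum n \<ge> 1" using IH ev a by blast
      ultimately have "1 * 1 \<le> (\<Sum>i\<le>k. \<psi> p ^ i) * div_sum n"
        using geometric_sum_values by (intro mult_mono) auto
      thus "1 \<le> (\<Sum>i\<le>k. \<psi> p ^ i) * div_sum n" by simp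
    qed
  qed
qed

lemma div_sum_nonneg: "m > 0 \<Longrightarrow> div_sum m \<ge> 0"
  using div_sum_nonneg_aux by blast

lemma div_sum_square: "j > 0 \<Longrightarrow> div_sum (j\<^sup>2) \<ge> 1"
  using div_sum_nonneg_aux[of "j\<^sup>2"] by (auto simp: prime_elem_multiplicity_power_distrib)

text \<open>
  Monsky's argument: the Lambert series \<open>\<Sum>n. \<psi> n * z ^ n / (1 - z ^ n)\<close> has nonnegative power series
  coefficients, which are at least 1 at squares, and it differs from \<open>L(1,\<psi>) / (1 - z)\<close> by at most \<open>C\<close>.
\<close>

lemma lambert_lower_bound:
  assumes z: "0 < z" "z < 1" and J: "J\<^sup>2 \<le> M"
  shows "(\<Sum>n=1..M. \<psi> n / real n) / (1 - z) \<ge> (\<Sum>j=1..J. z ^ (j\<^sup>2)) - real M * z ^ M / (1 - z) - C"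
proof -
  \<comment> \<open>The coefficients of the difference between the sum of
    \<open>\<psi> n / n\<close> divided by \<open>1 - z\<close> and the Lambert series. They
    decrease from \<open>b 1 = 1\<close> and stay nonnegative, so Abel summation bounds the
    difference by \<open>C\<close>.\<close>
  define b where "b n = 1 / (real n * (1 - z)) - z ^ n / (1 - z ^ n)" for n
  have zn: "z ^ n < 1" if "n \<ge> 1" for n using z that by (simp add: power_less_one_iff)
  have b0: "b n \<ge> 0" if "n \<ge> 1" for n
  proof -
    have "real n * z ^ n = (\<Sum>i<n. z ^ n)" by simp
    also have "\<dots> \<le> (\<Sum>i<n. z ^ i)" using z by (intro sum_mono power_decreasing) auto
    finally have "(1 - z) * (real n * z ^ n) \<le> (1 - z) * (\<Sum>i<n. z ^ i)" using z by (intro mult_left_mono) auto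
    also have "\<dots> = 1 - z ^ n" by (simp add: one_diff_power_eq)
    finally show ?thesis using zn[OF that] z that by (simp add: b_def divide_simps mult_ac)
  qed
  have "norm (\<Sum>i=1..<Suc M. b i *\<^sub>R \<eta> i) \<le> C * b 1"
    by (rule norm_sum_scaleR_decreasing_le)
       (use partial_sums lambert_coefficient_decreasing[OF z] b0 in \<open>auto simp: b_def simp del: of_nat_Suc power_Suc\<close>)
  also have "b 1 = 1" using z by (simp add: b_def divide_simps)
  also have "(\<Sum>i=1..<Suc M. b i *\<^sub>R \<eta> i) = of_real (\<Sum>i=1..M. b i * \<psi> i)"
    by (simp add: eta_eq scaleR_conv_of_real atLeastLessThanSuc_atLeastAtMost)
  finally have 1: "\<bar>\<Sum>i=1..M. b i * \<psi> i\<bar> \<le> C" by (simp only: norm_of_real mult_1_right)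
  have "(\<Sum>i=1..M. b i * \<psi> i) = (\<Sum>n=1..M. \<psi> n / real n) / (1 - z) - (\<Sum>n=1..M. \<psi> n * (z ^ n / (1 - z ^ n)))"
    by (simp add: b_def algebra_simps sum_subtractf sum_divide_distrib)
  with 1 have 2: "(\<Sum>n=1..M. \<psi> n / real n) / (1 - z) \<ge> (\<Sum>n=1..M. \<psi> n * (z ^ n / (1 - z ^ n))) - C" by linarith
  \<comment> \<open>Only the terms with \<open>n * k \<le> M\<close> are kept, to make the
    rearrangement by \<open>m = n * k\<close> finite; each tail costs at most
    \<open>z ^ M / (1 - z)\<close>, and even \<open>M\<close> of them vanish as \<open>M\<close>
    grows.\<close>
  have "(\<Sum>n=1..M. \<psi> n * (z ^ n / (1 - z ^ n))) \<ge> (\<Sum>n=1..M. \<psi> n * (\<Sum>k=1..M div n. z ^ (n * k)) - z ^ M / (1 - z))"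
  proof (rule sum_mono)
    fix n assume n: "n \<in> {1..M}"
    define K where "K = M div n"
    have "(\<Sum>k=1..K. z ^ (n * k)) = z ^ n * (\<Sum>k<K. (z ^ n) ^ k)"
      unfolding sum_distrib_left
      by (rule sum.reindex_bij_witness[of _ Suc "\<lambda>k. k - 1"]) (auto simp: power_mult simp flip: power_Suc)
    also have "\<dots> = (z ^ n - z ^ n * (z ^ n) ^ K) / (1 - z ^ n)"
    proof -
      have "(\<Sum>k<K. (z ^ n) ^ k) = (1 - (z ^ n) ^ K) / (1 - z ^ n)"
        using zn[of n] n one_diff_power_eq[of "z ^ n" K] by (simp add: eq_divide_eq mult.commute)
      thus ?thesis by (simp add: right_diff_distrib)
    qed
    finally have e: "z ^ n / (1 - z ^ n) - (\<Sum>k=1..K. z ^ (n * k)) = z ^ (n * Suc K) / (1 - z ^ n)"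
      by (simp add: diff_divide_distrib power_mult power_add)
    have "M < n * Suc K" unfolding K_def using n dividend_less_times_div[of n M] by simp
    hence "z ^ (n * Suc K) \<le> z ^ M" using z by (intro power_decreasing) auto
    moreover have "z ^ n \<le> z ^ 1" using z n by (intro power_decreasing) auto
    ultimately have "z ^ (n * Suc K) / (1 - z ^ n) \<le> z ^ M / (1 - z)" using z by (intro frac_le) auto
    moreover have "z ^ (n * Suc K) / (1 - z ^ n) \<ge> 0" using z zn[of n] n by (intro divide_nonneg_pos) auto
    ultimately have "\<bar>z ^ n / (1 - z ^ n) - (\<Sum>k=1..K. z ^ (n * k))\<bar> \<le> z ^ M / (1 - z)" unfolding e by linarith
    moreover have "\<bar>\<psi> n\<bar> \<le> 1" using psi_values[of n] by auto
    ultimately have "\<bar>\<psi> n\<bar> * \<bar>z ^ n / (1 - z ^ n) - (\<Sum>k=1..K. z ^ (n * k))\<bar> \<le> 1 * (z ^ M / (1 - z))"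
      by (intro mult_mono) auto
    hence "\<bar>\<psi> n * (z ^ n / (1 - z ^ n) - (\<Sum>k=1..K. z ^ (n * k)))\<bar> \<le> z ^ M / (1 - z)"
      by (simp only: abs_mult mult_1)
    hence "\<bar>\<psi> n * (z ^ n / (1 - z ^ n)) - \<psi> n * (\<Sum>k=1..K. z ^ (n * k))\<bar> \<le> z ^ M / (1 - z)"
      by (simp only: right_diff_distrib)
    thus "\<psi> n * (\<Sum>k=1..M div n. z ^ (n * k)) - z ^ M / (1 - z) \<le> \<psi> n * (z ^ n / (1 - z ^ n))"
      unfolding K_def by linarith
  qed
  also have "(\<Sum>n=1..M. \<psi> n * (\<Sum>k=1..M div n. z ^ (n * k)) - z ^ M / (1 - z))
     = (\<Sum>n=1..M. \<Sum>k=1..M div n. \<psi> n * z ^ (n * k)) - real M * z ^ M / (1 - z)"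
    by (simp add: sum_subtractf sum_distrib_left)
  finally have 3: "(\<Sum>n=1..M. \<psi> n * (z ^ n / (1 - z ^ n))) \<ge> (\<Sum>n=1..M. \<Sum>k=1..M div n. \<psi> n * z ^ (n * k)) - real M * z ^ M / (1 - z)" .
  have "(\<Sum>n=1..M. \<Sum>k=1..M div n. \<psi> n * z ^ (n * k)) = (\<Sum>m=1..M. \<Sum>d | d dvd m. \<psi> d * z ^ (d * (m div d)))"
    by (rule sum_divisors_swap[of "\<lambda>d m. \<psi> d * z ^ (d * m)", symmetric])
  also have "\<dots> = (\<Sum>m=1..M. div_sum m * z ^ m)"
    by (intro sum.cong refl) (simp add: div_sum_def sum_distrib_right)
  also have "\<dots> \<ge> (\<Sum>m\<in>(\<lambda>j. j\<^sup>2) ` {1..J}. div_sum m * z ^ m)"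
  proof (rule sum_mono2)
    show "(\<lambda>j. j\<^sup>2) ` {1..J} \<subseteq> {1..M}" using J by (auto intro: order.trans[OF power_mono])
  qed (use z div_sum_nonneg in auto)
  also have "(\<Sum>m\<in>(\<lambda>j. j\<^sup>2) ` {1..J}. div_sum m * z ^ m) = (\<Sum>j=1..J. div_sum (j\<^sup>2) * z ^ (j\<^sup>2))"
    by (subst sum.reindex) (auto simp: inj_on_def)
  also have "\<dots> \<ge> (\<Sum>j=1..J. 1 * z ^ (j\<^sup>2))"
    using z by (intro sum_mono mult_right_mono div_sum_square) auto
  finally show ?thesis using 2 3 by simp
qed

lemma Lval_1_eq: "(\<lambda>M. \<Sum>n=1..M. \<psi> n / real n) \<longlonglongrightarrow> Re (Lval 1)"
proof -
  have "(\<lambda>M. \<Sum>n<Suc M. (real n powr (-1)) *\<^sub>R \<eta> n) \<longlonglongrightarrow> Lval 1"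
    unfolding Lval_def by (intro LIMSEQ_Suc summable_LIMSEQ summable_Lval) auto
  hence "(\<lambda>M. Re (\<Sum>n<Suc M. (real n powr (-1)) *\<^sub>R \<eta> n)) \<longlonglongrightarrow> Re (Lval 1)"
    by (rule tendsto_Re)
  also have "(\<lambda>M. Re (\<Sum>n<Suc M. (real n powr (-1)) *\<^sub>R \<eta> n)) = (\<lambda>M. \<Sum>n=1..M. \<psi> n / real n)"
  proof
    fix M
    have "Re (\<Sum>n<Suc M. (real n powr (-1)) *\<^sub>R \<eta> n) = (\<Sum>n<Suc M. \<psi> n / real n)"
      by (simp add: eta_eq powr_minus_divide del: sum.lessThan_Suc)
    also have "\<dots> = (\<Sum>n=1..M. \<psi> n / real n)"
      by (intro sum.mono_neutral_right) (auto simp: \<psi>_zero)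
    finally show "Re (\<Sum>n<Suc M. (real n powr (-1)) *\<^sub>R \<eta> n) = (\<Sum>n=1..M. \<psi> n / real n)" .
  qed
  finally show ?thesis .
qed

text \<open>With \<open>N = (2 * h)^2\<close> and \<open>z = 1 - 1 / N\<close>, the
  \<open>2 * h\<close> squares up to \<open>N\<close> contribute at least
  \<open>z ^ N \<ge> 1 / 4\<close> each, so \<open>h / 2\<close> in all. Subtracting
  \<open>C \<le> h / 4\<close> leaves \<open>h / 4\<close>, to be divided by
  \<open>1 / (1 - z) = 4 * h^2\<close>.\<close>

lemma Lval_1_ge:
  assumes h: "h \<ge> 1" "real h \<ge> 4 * C"
  shows "norm (Lval 1) \<ge> 1 / (16 * real h)"
proof -
  define N :: nat where "N = (2 * h)\<^sup>2"
  define z where "z = 1 - 1 / real N"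
  have N: "N \<ge> 4" using h power_mono[of 2 "2 * h" 2] by (simp add: N_def)
  have z: "0 < z" "z < 1" using N by (auto simp: z_def)
  have zN: "z ^ N \<ge> 1 / 4"
  proof -
    have "N = 2 * h\<^sup>2 * 2" by (simp add: N_def power2_eq_square)
    \<comment> \<open>Bernoulli's inequality with half the exponent gives \<open>1 / 2\<close>, then
      squared; with the full exponent \<open>N\<close> it would give only 0.\<close>
    moreover have "1 + real (2 * h\<^sup>2) * (- (1 / real N)) \<le> (1 + (- (1 / real N))) ^ (2 * h\<^sup>2)"
      using N by (intro Bernoulli_inequality) auto
    hence "1 / 2 \<le> z ^ (2 * h\<^sup>2)" using h by (simp add: z_def N_def power2_eq_square)
    hence "(1 / 2)\<^sup>2 \<le> (z ^ (2 * h\<^sup>2))\<^sup>2" by (intro power_mono) auto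
    ultimately show ?thesis by (simp only: power_mult) (simp add: power2_eq_square)
  qed
  have "(\<Sum>j=1..2*h. z ^ (j\<^sup>2)) \<ge> (\<Sum>j=1..2*h. 1 / 4)"
  proof (rule sum_mono)
    fix j assume "j \<in> {1..2*h}"
    hence "j\<^sup>2 \<le> N" unfolding N_def by (intro power_mono) auto
    hence "z ^ N \<le> z ^ (j\<^sup>2)" using z by (intro power_decreasing) auto
    thus "1 / 4 \<le> z ^ (j\<^sup>2)" using zN by linarith
  qed
  hence sq: "(\<Sum>j=1..2*h. z ^ (j\<^sup>2)) \<ge> real h / 2" by simp
  have "(\<lambda>M. (\<Sum>n=1..M. \<psi> n / real n) / (1 - z)) \<longlonglongrightarrow> Re (Lval 1) / (1 - z)"
    by (intro tendsto_divide Lval_1_eq) (use z in auto)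
  moreover have "(\<lambda>M. real h / 2 - real M * z ^ M / (1 - z) - C) \<longlonglongrightarrow> real h / 2 - 0 / (1 - z) - C"
  proof (intro tendsto_intros)
    show "(\<lambda>M. real M * z ^ M) \<longlonglongrightarrow> 0" using powser_times_n_limit_0[of z] z by simp
  qed (use z in auto)
  moreover have "eventually (\<lambda>M. real h / 2 - real M * z ^ M / (1 - z) - C \<le> (\<Sum>n=1..M. \<psi> n / real n) / (1 - z)) sequentially"
    using eventually_ge_at_top[of N]
  proof eventually_elim
    case (elim M)
    thus ?case using lambert_lower_bound[OF z, of "2 * h" M] sq by (simp add: N_def)
  qed
  ultimately have "real h / 2 - 0 / (1 - z) - C \<le> Re (Lval 1) / (1 - z)"
    using tendsto_le[OF sequentially_bot] by blast
  hence "real h / 2 - C \<le> Re (Lval 1) / (1 - z)" by simp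
  hence "real h / 4 \<le> Re (Lval 1) / (1 - z)" using h(2) by linarith
  also have "1 - z = 1 / real N" by (simp add: z_def)
  finally have "real h / 4 \<le> Re (Lval 1) * real N" by simp
  hence "1 / (16 * real h) \<le> Re (Lval 1)" using h by (simp add: N_def field_simps power2_eq_square)
  also have "\<dots> \<le> norm (Lval 1)" by (rule complex_Re_le_cmod)
  finally show ?thesis .
qed

end

section \<open>Characters modulo a prime\<close>

text \<open>The residues modulo a prime form a cyclic group, so a primitive root \<open>g\<close>
  makes all characters explicit: powers of a root of unity with the discrete logarithm
  \<open>ind\<close> as exponent.\<close>

locale prime_characters =
  fixes p g :: nat
  assumes prime_p: "prime p" and primroot: "residue_primroot p g"
begin

definition ind :: "nat \<Rightarrow> nat" where
  "ind n = inv_into {..<p - 1} (\<lambda>i. g ^ i mod p) (n mod p)"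

definition w :: complex where
  "w = exp (2 * of_real pi * \<i> / of_nat (p - 1))"

definition char :: "nat \<Rightarrow> nat \<Rightarrow> complex" where
  "char k n = (if p dvd n then 0 else w ^ (k * ind n))"

lemma p_ge_2: "p \<ge> 2" using prime_p by (rule prime_ge_2_nat)

lemma bij: "bij_betw (\<lambda>i. g ^ i mod p) {..<p - 1} {0<..<p}"
  using residue_primroot_is_generator[OF _ primroot] p_ge_2 prime_p
  by (simp add: totient_prime totatives_prime)

lemma ind_less: "\<not> p dvd n \<Longrightarrow> ind n < p - 1"
  and power_ind: "\<not> p dvd n \<Longrightarrow> g ^ ind n mod p = n mod p"
proof -
  assume "\<not> p dvd n"
  hence "n mod p \<in> {0<..<p}" using p_ge_2 by (auto simp: dvd_eq_mod_eq_0)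
  hence im: "n mod p \<in> (\<lambda>i. g ^ i mod p) ` {..<p - 1}" using bij by (simp add: bij_betw_def)
  show "ind n < p - 1" using inv_into_into[OF im] by (simp add: ind_def)
  show "g ^ ind n mod p = n mod p" using f_inv_into_f[OF im] by (simp add: ind_def)
qed

lemma w_power_eq_1_iff: "w ^ j = 1 \<longleftrightarrow> (p - 1) dvd j"
proof -
  have "w ^ j = exp (2 * of_real pi * \<i> * of_nat j / of_nat (p - 1))"
    by (simp add: w_def exp_of_nat_mult[symmetric] mult_ac)
  thus ?thesis using complex_root_unity_eq_1[of "p - 1" j] p_ge_2 by simp
qed

lemma norm_w: "norm w = 1"
  by (simp add: w_def norm_exp_eq_Re)

lemma w_nonzero: "w \<noteq> 0"
  by (simp add: w_def)

lemma w_power_cong: "[i = j] (mod (p - 1)) \<Longrightarrow> w ^ i = w ^ j"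
proof (induction i j rule: linorder_wlog)
  case (le a b)
  hence "(p - 1) dvd (b - a)" by (metis cong_altdef_nat cong_sym)
  hence "w ^ (b - a) = 1" by (simp add: w_power_eq_1_iff)
  moreover have "w ^ b = w ^ a * w ^ (b - a)" using le by (simp flip: power_add)
  ultimately show ?case by simp
next
  case (sym a b)
  thus ?case by (metis cong_sym)
qed

lemma ind_cong:
  assumes "\<not> p dvd n" "[g ^ i = n] (mod p)"
  shows "[i = ind n] (mod (p - 1))"
proof -
  have "[g ^ i = g ^ ind n] (mod p)" using assms power_ind[of n] by (simp add: cong_def)
  moreover have "coprime p g" "ord p g = p - 1"
    using primroot prime_p by (auto simp: residue_primroot_def totient_prime)
  ultimately show ?thesis using order_divides_expdiff[of p g i "ind n"] by simp
qed

lemma char_mult: "char k (m * n) = char k m * char k n"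
proof (cases "p dvd m \<or> p dvd n")
  case True
  thus ?thesis by (auto simp: char_def)
next
  case False
  hence nd: "\<not> p dvd m * n" using prime_p by (simp add: prime_dvd_mult_iff)
  have "[g ^ (ind m + ind n) = m * n] (mod p)"
    using False power_ind[of m] power_ind[of n] unfolding power_add by (intro cong_mult) (auto simp: cong_def)
  from ind_cong[OF nd this] have "[k * (ind m + ind n) = k * ind (m * n)] (mod (p - 1))"
    by (rule cong_scalar_left)
  from w_power_cong[OF this] show ?thesis using False nd by (simp add: char_def power_add distrib_left)
qed

lemma char_zero: "char k 0 = 0" by (simp add: char_def)

lemma char_one: "char k 1 = 1"
proof -
  have "\<not> p dvd 1" using p_ge_2 by simp
  from ind_cong[OF this, of 0] have "[0 = ind 1] (mod (p - 1))" by simp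
  hence "ind 1 = 0" using ind_less[OF \<open>\<not> p dvd 1\<close>] by (simp add: cong_def)
  thus ?thesis using \<open>\<not> p dvd 1\<close> by (simp add: char_def)
qed

lemma char_norm: "norm (char k n) \<le> 1"
  by (simp add: char_def norm_power norm_w)

lemma char_mod: "char k (n mod p) = char k n"
  by (simp add: char_def ind_def dvd_mod_iff)

text \<open>One geometric sum behind both orthogonality relations, over the residues and over the
  characters.\<close>

lemma sum_w_powers: "(\<Sum>i<p - 1. (w ^ j) ^ i) = (if (p - 1) dvd j then of_nat (p - 1) else 0)"
proof (cases "(p - 1) dvd j")
  case True
  thus ?thesis using w_power_eq_1_iff[of j] by simp
next
  case False
  hence "w ^ j \<noteq> 1" by (simp add: w_power_eq_1_iff)
  moreover have "(w ^ j) ^ (p - 1) = 1" by (simp add: power_mult[symmetric] w_power_eq_1_iff)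
  ultimately show ?thesis using False by (simp add: geometric_sum)
qed

lemma sum_char_period:
  assumes "0 < k" "k < p - 1"
  shows "(\<Sum>n<p. char k n) = 0"
proof -
  have "(\<Sum>n<p. char k n) = (\<Sum>n\<in>{0<..<p}. char k n)"
    by (rule sum.mono_neutral_right) (auto simp: char_zero not_less)
  also have "\<dots> = (\<Sum>i<p - 1. char k (g ^ i mod p))"
    by (rule sum.reindex_bij_betw[OF bij, symmetric])
  also have "\<dots> = (\<Sum>i<p - 1. (w ^ k) ^ i)"
  proof (intro sum.cong refl)
    fix i assume "i \<in> {..<p - 1}"
    hence nd: "\<not> p dvd g ^ i" using bij 
      by (auto simp: bij_betw_def dvd_eq_mod_eq_0)
    have "[k * i = k * ind (g ^ i)] (mod (p - 1))" by (intro cong_scalar_left ind_cong nd) auto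
    from w_power_cong[OF this] show "char k (g ^ i mod p) = (w ^ k) ^ i"
      using nd by (simp add: char_mod) (simp add: char_def power_mult)
  qed
  also have "\<dots> = 0" unfolding sum_w_powers using assms by (auto dest: dvd_imp_le)
  finally show ?thesis .
qed

lemma sum_over_chars: "(\<Sum>k<p - 1. char k n) = (if [n = 1] (mod p) then of_nat (p - 1) else 0)"
proof (cases "p dvd n")
  case True
  hence "\<not> [n = 1] (mod p)" using p_ge_2 by (auto simp: cong_def dvd_eq_mod_eq_0)
  thus ?thesis using True by (simp add: char_def)
next
  case False
  have "(\<Sum>k<p - 1. char k n) = (\<Sum>k<p - 1. (w ^ ind n) ^ k)"
    using False by (simp add: char_def power_mult[symmetric] mult.commute)
  moreover have "(p - 1) dvd ind n \<longleftrightarrow> [n = 1] (mod p)"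
  proof
    assume "(p - 1) dvd ind n"
    hence "ind n = 0" using ind_less[OF False] by (auto dest: dvd_imp_le)
    thus "[n = 1] (mod p)" using power_ind[OF False] by (simp add: cong_def)
  next
    assume "[n = 1] (mod p)"
    hence "[g ^ 0 = n] (mod p)" by (simp add: cong_sym)
    from cong_sym[OF ind_cong[OF False this]] show "(p - 1) dvd ind n" by (simp add: cong_0_iff)
  qed
  ultimately show ?thesis by (simp only: sum_w_powers)
qed

lemma cnj_char:
  assumes "k < p - 1"
  shows "cnj (char k n) = char (p - 1 - k) n"
proof (cases "p dvd n")
  case False
  have "cnj w * w = 1" using norm_w by (simp add: complex_norm_square[symmetric] mult.commute)
  hence "(cnj w * w) ^ (k * ind n) = 1" by simp
  hence 1: "cnj w ^ (k * ind n) * w ^ (k * ind n) = 1" by (simp add: power_mult_distrib)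
  have "w ^ ((p - 1 - k) * ind n) * w ^ (k * ind n) = w ^ ((p - 1) * ind n)"
    using assms by (simp add: power_add[symmetric] distrib_right[symmetric])
  also have "\<dots> = 1" by (simp add: w_power_eq_1_iff)
  finally have "cnj w ^ (k * ind n) = w ^ ((p - 1 - k) * ind n)"
    using 1 w_nonzero by (metis mult_right_cancel power_not_zero)
  thus ?thesis using False by (simp add: char_def)
qed (auto simp: char_def)

lemma char_partial_sums:
  assumes k: "0 < k" "k < p - 1"
  shows "norm (\<Sum>i=m..<n. char k i) \<le> 2 * real p"
proof -
  have 1: "norm (\<Sum>i<n. char k i) \<le> real p" for n
  proof (induction n rule: less_induct)
    case (less n)
    show ?case
    proof (cases "n < p")
      case True
      have "norm (\<Sum>i<n. char k i) \<le> (\<Sum>i<n. 1)"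
        by (intro order.trans[OF norm_sum] sum_mono char_norm)
      thus ?thesis using True by simp
    next
      case False
      then obtain r where r: "n = p + r" by (metis le_iff_add not_less)
      have "(\<Sum>i<p + r. char k i) = (\<Sum>i<p. char k i) + (\<Sum>i<r. char k (p + i))"
        by (induction r) auto
      also have "\<dots> = (\<Sum>i<r. char k i)"
      proof -
        have "char k (p + i) = char k i" for i using char_mod[of k "p + i"] char_mod[of k i] by simp
        thus ?thesis using sum_char_period[OF k] by simp
      qed
      finally show ?thesis using less.IH[of r] p_ge_2 r by simp
    qed
  qed
  show ?thesis
  proof (cases "m \<le> n")
    case True
    have "(\<Sum>i=m..<n. char k i) = (\<Sum>i<n. char k i) - (\<Sum>i<m. char k i)"
      using sum_diff_nat_ivl[of 0 m n "char k"] True by (simp add: lessThan_atLeast0)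
    also have "norm \<dots> \<le> real p + real p"
      by (intro order.trans[OF norm_triangle_ineq4] add_mono 1)
    finally show ?thesis by simp
  qed auto
qed

lemma bounded_char:
  assumes "0 < k" "k < p - 1"
  shows "bounded_character (char k) (2 * real p)"
  by unfold_locales (use char_mult char_zero char_one char_norm char_partial_sums[OF assms] in auto)

text \<open>Minus the logarithm of the product is the sum over \<open>n\<close> of
  \<open>x ^ n / n\<close> times the sum of \<open>char k (q ^ n)\<close> over \<open>k\<close>; by
  orthogonality the inner sum is 0 or \<open>p - 1\<close>, never negative.\<close>

lemma prod_char_factor_le_1:
  fixes x :: real
  assumes "0 \<le> x" "x < 1"
  shows "(\<Prod>k<p - 1. norm (1 - char k q * of_real x)) \<le> 1"
proof -
  define u where "u k = char k q * of_real x" for k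
  have u: "norm (u k) < 1" for k
  proof -
    have "norm (u k) = norm (char k q) * x" using assms by (simp add: u_def norm_mult)
    also have "\<dots> \<le> 1 * x" using assms char_norm by (intro mult_right_mono) auto
    finally show ?thesis using assms by simp
  qed
  have "(\<lambda>n. - (u k ^ n) / of_nat n) sums ln (1 - u k)" for k
    using Ln_series'[of "- u k"] u[of k] by simp
  hence "(\<lambda>n. \<Sum>k<p - 1. - (u k ^ n) / of_nat n) sums (\<Sum>k<p - 1. ln (1 - u k))"
    by (intro sums_sum)
  hence s: "(\<lambda>n. Re (\<Sum>k<p - 1. - (u k ^ n) / of_nat n)) sums Re (\<Sum>k<p - 1. ln (1 - u k))"
    by (rule sums_Re)
  have "Re (\<Sum>k<p - 1. - (u k ^ n) / of_nat n) \<le> 0" for n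
  proof -
    have cp: "char k q ^ n = char k (q ^ n)" for k by (induction n) (simp_all add: char_mult char_one[simplified])
    have "(\<Sum>k<p - 1. - (u k ^ n) / of_nat n) = - (of_real (x ^ n / real n) * (\<Sum>k<p - 1. char k (q ^ n)))"
      unfolding sum_distrib_left sum_negf[symmetric]
      by (intro sum.cong refl) (simp add: u_def power_mult_distrib cp)
    also have "Re \<dots> \<le> 0" unfolding sum_over_chars using assms by simp
    finally show ?thesis .
  qed
  hence "Re (\<Sum>k<p - 1. ln (1 - u k)) \<le> 0" by (intro sums_le[OF _ s sums_zero]) auto
  moreover have "(\<Prod>k<p - 1. norm (1 - u k)) = exp (Re (\<Sum>k<p - 1. ln (1 - u k)))"
  proof -
    have "norm (1 - u k) = exp (Re (ln (1 - u k)))" for k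
    proof -
      have "1 - u k \<noteq> 0" using u[of k] by auto
      thus ?thesis by (simp add: norm_exp_eq_Re[symmetric])
    qed
    thus ?thesis by (simp add: exp_sum)
  qed
  ultimately show ?thesis by (simp add: u_def)
qed

text \<open>Each L-series times its truncated inverse Euler product tends to 1, and multiplied over
  all characters the truncated inverse products have norm at most 1, by the preceding bound at each
  prime.\<close>

lemma prod_Lseries_ge_1:
  fixes \<sigma> :: real
  assumes \<sigma>: "\<sigma> > 0"
  shows "(\<Prod>k<p - 1. norm (\<Sum>n. (real n powr (- 1 - \<sigma>)) *\<^sub>R char k n)) \<ge> 1"
proof -
  define f where "f k n = (real n powr (- 1 - \<sigma>)) *\<^sub>R char k n" for k n
  define E where "E k Q = (\<Prod>q | prime q \<and> q \<le> Q. 1 - f k q)" for k Q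
  have sn: "summable (\<lambda>n. norm (f k n))" for k
  proof (rule summable_comparison_test'[OF summable_powr_neg[OF \<sigma>], of 0])
    fix n show "norm (norm (f k n)) \<le> real n powr (- 1 - \<sigma>)"
      using mult_left_mono[OF char_norm[of k n], of "real n powr (- 1 - \<sigma>)"] by (simp add: f_def)
  qed
  have lim: "(\<lambda>Q. suminf (f k) * E k Q) \<longlonglongrightarrow> 1" for k
    unfolding E_def
  proof (rule euler_product_tendsto[OF _ _ _ sn])
    show "f k (m * n) = f k m * f k n" for m n by (simp add: f_def char_mult powr_mult)
    show "f k 0 = 0" by (simp add: f_def)
    show "f k 1 = 1" using char_one by (simp add: f_def)
  qed
  have "(\<lambda>Q. \<Prod>k<p - 1. norm (suminf (f k) * E k Q)) \<longlonglongrightarrow> (\<Prod>k<p - 1. norm (1::complex))"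
    by (intro tendsto_intros lim)
  hence lim2: "(\<lambda>Q. \<Prod>k<p - 1. norm (suminf (f k) * E k Q)) \<longlonglongrightarrow> 1" by simp
  have "(\<Prod>k<p - 1. norm (suminf (f k) * E k Q)) \<le> (\<Prod>k<p - 1. norm (suminf (f k)))" for Q
  proof -
    have "(\<Prod>k<p - 1. norm (E k Q)) = (\<Prod>q | prime q \<and> q \<le> Q. \<Prod>k<p - 1. norm (1 - f k q))"
      unfolding E_def by (simp only: prod_norm[symmetric]) (rule prod.swap)
    also have "\<dots> \<le> 1"
    proof (rule prod_le_1, rule conjI)
      fix q assume "q \<in> {q. prime q \<and> q \<le> Q}"
      hence "q \<ge> 2" using prime_ge_2_nat by auto
      hence "real q powr (- 1 - \<sigma>) < 1" using powr_neg_le_half[of q \<sigma>] \<sigma> by auto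
      from prod_char_factor_le_1[OF _ this, of q] show "(\<Prod>k<p - 1. norm (1 - f k q)) \<le> 1"
        by (simp add: f_def scaleR_conv_of_real mult.commute)
    qed (auto intro: prod_nonneg)
    finally have "(\<Prod>k<p - 1. norm (suminf (f k))) * (\<Prod>k<p - 1. norm (E k Q)) \<le> (\<Prod>k<p - 1. norm (suminf (f k))) * 1"
      by (intro mult_left_mono prod_nonneg) auto
    thus ?thesis by (simp add: norm_mult prod.distrib)
  qed
  hence "1 \<le> (\<Prod>k<p - 1. norm (suminf (f k)))" by (intro tendsto_upperbound[OF lim2]) auto
  thus ?thesis by (simp add: f_def[abs_def])
qed

end

section \<open>Primes congruent to 1 modulo p, lower bound\<close>

context prime_characters
begin

abbreviation L1 :: "nat \<Rightarrow> complex" where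
  "L1 k \<equiv> bounded_character.Lval (char k) 1"

text \<open>
  Here \<open>N = (2 p) ^ (4 p)\<close>: at \<open>s = 1 + 1 / N\<close> the product of all the L-series is at least 1, and a
  non-real character contributes two factors of the same size.
\<close>

lemma L1_complex_ge:
  assumes k: "0 < k" "k < p - 1" "2 * k \<noteq> p - 1"
  shows "norm (L1 k) \<ge> 1 / (2 * real p) ^ (4 * p)"
proof -
  define a where "a = 2 * real p"
  define N where "N = (2 * p) ^ (4 * p)"
  define \<sigma> where "\<sigma> = 1 / real N"
  have Na: "real N = a ^ (4 * p)" by (simp add: N_def a_def)
  \<comment> \<open>An index strictly between 0 and \<open>p - 1\<close> other than
    \<open>(p - 1) / 2\<close> exists only for \<open>p \<ge> 5\<close>.\<close>
  have p5: "p \<ge> 5"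
  proof -
    have "p \<noteq> 4" using prime_p by auto
    moreover have "p \<noteq> 2" "p \<noteq> 3" using k by auto
    ultimately show ?thesis using p_ge_2 by linarith
  qed
  have a: "a \<ge> 10" using p5 by (simp add: a_def)
  have N1: "N \<ge> 1" using p_ge_2 by (simp add: N_def)
  have \<sigma>: "\<sigma> > 0" using N1 by (simp add: \<sigma>_def)
  interpret K: bounded_character "char k" "2 * real p" by (rule bounded_char[OF k(1,2)])
  define Lf where "Lf j = (\<Sum>n. (real n powr (- 1 - \<sigma>)) *\<^sub>R char j n)" for j
  have LfK: "Lf k = K.Lval (1 + 1 / real N)" by (simp add: Lf_def K.Lval_def \<sigma>_def)
  have sn: "summable (\<lambda>n. norm ((real n powr (- 1 - \<sigma>)) *\<^sub>R char j n))" for j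
  proof (rule summable_comparison_test'[OF summable_powr_neg[OF \<sigma>], of 0])
    fix n show "norm (norm ((real n powr (- 1 - \<sigma>)) *\<^sub>R char j n)) \<le> real n powr (- 1 - \<sigma>)"
      using mult_left_mono[OF char_norm[of j n], of "real n powr (- 1 - \<sigma>)"] by simp
  qed
  have L0: "norm (Lf 0) \<le> 2 * real N"
  proof -
    have "norm (Lf 0) \<le> (\<Sum>n. norm ((real n powr (- 1 - \<sigma>)) *\<^sub>R char 0 n))"
      unfolding Lf_def by (rule summable_norm[OF sn])
    also have "\<dots> \<le> (\<Sum>n. real n powr (- 1 - \<sigma>))"
    proof (rule suminf_le[OF _ sn summable_powr_neg[OF \<sigma>]])
      fix n show "norm ((real n powr (- 1 - \<sigma>)) *\<^sub>R char 0 n) \<le> real n powr (- 1 - \<sigma>)"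
        using mult_left_mono[OF char_norm[of 0 n], of "real n powr (- 1 - \<sigma>)"] by simp
    qed
    also have "\<dots> \<le> 1 + 1 / \<sigma>" by (rule zeta_bounds(2)[OF \<sigma>])
    also have "\<dots> \<le> 2 * real N" using N1 by (simp add: \<sigma>_def)
    finally show ?thesis .
  qed
  define k' where "k' = p - 1 - k"
  have k': "0 < k'" "k' < p - 1" "k' \<noteq> k" using k by (auto simp: k'_def)
  have "Lf k' = cnj (Lf k)"
  proof -
    have "(\<lambda>n. cnj ((real n powr (- 1 - \<sigma>)) *\<^sub>R char k n)) sums cnj (Lf k)"
      unfolding Lf_def using summable_norm_cancel[OF sn] by (intro sums_cnj[THEN iffD2] summable_sums)
    also have "(\<lambda>n. cnj ((real n powr (- 1 - \<sigma>)) *\<^sub>R char k n)) = (\<lambda>n. (real n powr (- 1 - \<sigma>)) *\<^sub>R char k' n)"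
      using k by (simp add: cnj_char k'_def)
    finally show ?thesis unfolding Lf_def using sums_unique by metis
  qed
  hence Lk': "norm (Lf k') = norm (Lf k)" by simp
  have Lle: "norm (Lf j) \<le> a" if "0 < j" "j < p - 1" for j
    using bounded_character.norm_Lval_le[OF bounded_char[OF that], of "1 + \<sigma>"] \<sigma>
      bounded_character.Lval_def[OF bounded_char[OF that], of "1 + \<sigma>"] by (simp add: Lf_def a_def)
  define R where "R = {..<p - 1} - {0, k, k'}"
  have "1 \<le> (\<Prod>j<p - 1. norm (Lf j))" unfolding Lf_def by (rule prod_Lseries_ge_1[OF \<sigma>])
  also have "{..<p - 1} = insert 0 (insert k (insert k' R))" using k k' by (auto simp: R_def)
  also have "(\<Prod>j\<in>insert 0 (insert k (insert k' R)). norm (Lf j)) = norm (Lf 0) * (norm (Lf k))\<^sup>2 * (\<Prod>j\<in>R. norm (Lf j))"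
    using k k' by (simp add: R_def Lk' power2_eq_square)
  also have "\<dots> \<le> 2 * real N * (norm (Lf k))\<^sup>2 * a ^ p"
  proof -
    have "(\<Prod>j\<in>R. norm (Lf j)) \<le> (\<Prod>j\<in>R. a)" by (intro prod_mono) (auto simp: R_def intro!: Lle)
    also have "\<dots> = a ^ card R" by simp
    also have "card R \<le> card {..<p - 1}" unfolding R_def by (intro card_mono) auto
    hence "a ^ card R \<le> a ^ p" using a by (intro power_increasing) auto
    finally have "(\<Prod>j\<in>R. norm (Lf j)) \<le> a ^ p" .
    thus ?thesis using L0 a by (intro mult_mono prod_nonneg) auto
  qed
  \<comment> \<open>Up to powers of \<open>a\<close>, this bounds \<open>norm (Lf k)\<close> below
    by order \<open>N powr (- 1 / 2)\<close>, which beats the change of order \<open>1 / N\<close>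
    on passing to \<open>s = 1\<close>. If the factor occurred only once, the bound would be of
    order \<open>1 / N\<close> and the comparison would fail.\<close>
  finally have key: "1 \<le> 2 * real N * (norm (Lf k))\<^sup>2 * a ^ p" .
  define D where "D = ln (real N) * (1 + ln (real N)) + 2 * (2 * real p)"
  have diff: "norm (Lf k - K.Lval 1) \<le> D / real N"
    unfolding LfK D_def by (rule K.Lval_diff_le[OF N1])
  have lnN: "0 \<le> ln (real N)" "ln (real N) \<le> 2 * a\<^sup>2"
  proof -
    show "0 \<le> ln (real N)" using N1 by simp
    have "ln (real N) = 2 * a * ln a" using a unfolding Na by (simp add: ln_realpow) (simp add: a_def)
    also have "\<dots> \<le> 2 * a * a" using a ln_le_minus_one[of a] by (intro mult_left_mono) auto
    finally show "ln (real N) \<le> 2 * a\<^sup>2" by (simp add: power2_eq_square)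
  qed
  have D8: "D \<le> 8 * a ^ 4" and D1: "D \<ge> 1"
  proof -
    have a2: "1 \<le> a\<^sup>2" "a \<le> a\<^sup>2" using a self_le_power[of a 2] by (auto intro: one_le_power)
    have "ln (real N) * (1 + ln (real N)) \<le> (2 * a\<^sup>2) * (3 * a\<^sup>2)"
      using lnN a2 by (intro mult_mono) auto
    moreover have "a\<^sup>2 * 1 \<le> a\<^sup>2 * a\<^sup>2" using a2 by (intro mult_left_mono) auto
    ultimately show "D \<le> 8 * a ^ 4" using a2 unfolding D_def a_def[symmetric]
      by (simp add: power4_eq_xxxx power2_eq_square mult_ac)
    have "0 \<le> ln (real N) * (1 + ln (real N))" using lnN by (intro mult_nonneg_nonneg) auto
    thus "D \<ge> 1" using p5 by (simp add: D_def)
  qed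
  \<comment> \<open>Here \<open>N = a ^ (4 * p)\<close> proves large enough:
    \<open>512 * a ^ (8 + p)\<close> has to stay below \<open>N\<close>, and
    \<open>a \<ge> 10\<close> gives \<open>512 \<le> a ^ 3\<close>, while \<open>p \<ge> 5\<close>
    gives \<open>11 + p \<le> 4 * p\<close>.\<close>
  have "(2 * D / real N)\<^sup>2 \<le> (norm (Lf k))\<^sup>2"
  proof -
    have "D\<^sup>2 \<le> (8 * a ^ 4)\<^sup>2" using D8 D1 by (intro power_mono) auto
    hence "8 * D\<^sup>2 * a ^ p \<le> 8 * (64 * a ^ 8) * a ^ p" using a
      by (intro mult_right_mono mult_left_mono) (auto simp: power_mult_distrib power_mult[symmetric])
    also have "\<dots> \<le> a ^ 3 * a ^ 8 * a ^ p"
    proof (intro mult_right_mono)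
      have "(10::real) ^ 3 \<le> a ^ 3" using a by (intro power_mono) auto
      hence "512 \<le> a ^ 3" by simp
      from mult_right_mono[OF this, of "a ^ 8"] show "8 * (64 * a ^ 8) \<le> a ^ 3 * a ^ 8" by simp
    qed (use a in auto)
    also have "\<dots> = a ^ (3 + 8 + p)" by (simp add: power_add)
    also have "\<dots> \<le> real N" unfolding Na using a p5 by (intro power_increasing) auto
    also have "\<dots> \<le> real N * (2 * real N * (norm (Lf k))\<^sup>2 * a ^ p)" using key N1 by (intro mult_le_cancel_left1[THEN iffD2]) auto
    finally have "(8 * D\<^sup>2) * a ^ p \<le> (2 * (real N)\<^sup>2 * (norm (Lf k))\<^sup>2) * a ^ p"
      by (simp add: power2_eq_square mult_ac)
    hence "8 * D\<^sup>2 \<le> 2 * (real N)\<^sup>2 * (norm (Lf k))\<^sup>2" using a by (subst (asm) mult_le_cancel_right) auto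
    thus ?thesis using N1 by (simp add: power_divide power_mult_distrib divide_le_eq mult_ac)
  qed
  hence "2 * D / real N \<le> norm (Lf k)" by (rule power2_le_imp_le) auto
  hence "D / real N \<le> norm (K.Lval 1)"
  proof -
    have "2 * D / real N = D / real N + D / real N" by simp
    with \<open>2 * D / real N \<le> norm (Lf k)\<close> show ?thesis
      using diff norm_triangle_ineq2[of "Lf k" "K.Lval 1"] by linarith
  qed
  moreover have "1 / real N \<le> D / real N" using D1 N1 by (intro divide_right_mono) auto
  ultimately show ?thesis by (simp add: N_def)
qed

text \<open>Here \<open>w ^ k\<close> is a square root of 1, so the character is real. The block
  sums are bounded by \<open>C = 2 * p\<close>, and \<open>h = 8 * p\<close> is
  \<open>4 * C\<close>.\<close>

lemma L1_real_ge:
  assumes k: "0 < k" "2 * k = p - 1"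
  shows "norm (L1 k) \<ge> 1 / (128 * real p)"
proof -
  have kp: "k < p - 1" using k by simp
  have "(w ^ k)\<^sup>2 = 1" using k w_power_eq_1_iff[of "p - 1"] by (simp add: power_mult[symmetric] mult.commute)
  hence wk: "w ^ k = 1 \<or> w ^ k = -1" by (simp add: power2_eq_1_iff)
  have vals: "char k n \<in> {-1, 0, 1}" for n
  proof (cases "p dvd n")
    case False
    have "char k n = (w ^ k) ^ ind n" using False by (simp add: char_def power_mult)
    thus ?thesis using wk by (cases "even (ind n)") auto
  qed (simp add: char_def)
  interpret K: real_bounded_character "char k" "2 * real p" "\<lambda>n. Re (char k n)"
  proof (intro real_bounded_character.intro bounded_char real_bounded_character_axioms.intro k kp)
    fix n show "char k n = of_real (Re (char k n))" "Re (char k n) \<in> {-1, 0, 1}" using vals[of n] by auto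
  qed
  have "norm (K.Lval 1) \<ge> 1 / (16 * real (8 * p))"
    by (rule K.Lval_1_ge) (use p_ge_2 in auto)
  thus ?thesis by simp
qed

lemma L1_ge:
  assumes k: "0 < k" "k < p - 1"
  shows "norm (L1 k) \<ge> 1 / (2 * real p) ^ (4 * p)"
proof (cases "2 * k = p - 1")
  case False
  thus ?thesis using L1_complex_ge k by blast
next
  case True
  have p3: "real p \<ge> 3" using k True by simp
  have "128 * real p \<le> (2 * real p) ^ 4"
  proof -
    have "3 ^ 3 \<le> real p ^ 3" using p3 by (intro power_mono) auto
    hence "8 * real p \<le> real p ^ 3 * real p" using p3 by (intro mult_right_mono) auto
    thus ?thesis by (simp add: power_mult_distrib eval_nat_numeral)
  qed
  also have "\<dots> \<le> (2 * real p) ^ (4 * p)" using p_ge_2 by (intro power_increasing) auto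
  finally have "1 / (2 * real p) ^ (4 * p) \<le> 1 / (128 * real p)"
    using p3 by (intro divide_left_mono) auto
  also have "\<dots> \<le> norm (L1 k)" by (rule L1_real_ge) (use k True in auto)
  finally show ?thesis .
qed

text \<open>Orthogonality of the characters. The principal one gives at least
  \<open>ln N - 6\<close>; each of the others is at most \<open>10 * p * (2 * p) ^ (4 * p)\<close>
  through the lower bound for \<open>L1 k\<close>. The exponent \<open>4 * p + 3\<close> absorbs the
  constants and the summation over fewer than \<open>p\<close> characters.\<close>

lemma sum_mangoldt_mod_ge:
  assumes "N > 0"
  shows "real (p - 1) * (\<Sum>n | n \<in> {1..N} \<and> [n = 1] (mod p). mangoldt n / real n) \<ge> ln (real N) - (2 * real p) ^ (4 * p + 3)"
proof -
  define T where "T k = (\<Sum>n=1..N. char k n * mangoldt n / of_nat n)" for k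
  have "(\<Sum>k<p - 1. T k) = (\<Sum>n=1..N. mangoldt n / of_nat n * (\<Sum>k<p - 1. char k n))"
    unfolding T_def by (subst sum.swap) (simp add: sum_distrib_left mult_ac)
  also have "\<dots> = (\<Sum>n | n \<in> {1..N} \<and> [n = 1] (mod p). of_nat (p - 1) * (mangoldt n / of_nat n))"
    unfolding sum_over_chars by (subst sum.inter_filter) (auto intro!: sum.cong)
  also have "\<dots> = of_real (real (p - 1) * (\<Sum>n | n \<in> {1..N} \<and> [n = 1] (mod p). mangoldt n / real n))"
    by (simp add: sum_distrib_left)
  finally have "real (p - 1) * (\<Sum>n | n \<in> {1..N} \<and> [n = 1] (mod p). mangoldt n / real n) = Re (\<Sum>k<p - 1. T k)" by simp
  also have "{..<p - 1} = insert 0 {1..<p - 1}" using p_ge_2 by auto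
  also have "(\<Sum>k\<in>insert 0 {1..<p - 1}. T k) = T 0 + (\<Sum>k=1..<p - 1. T k)" by simp
  also have "Re \<dots> \<ge> (ln (real N) - 6) - real p * (10 * real p * (2 * real p) ^ (4 * p))"
  proof -
    have "\<bar>Re (\<Sum>k=1..<p - 1. T k)\<bar> \<le> (\<Sum>k=1..<p - 1. norm (T k))"
      by (rule order.trans[OF abs_Re_le_cmod norm_sum])
    also have "\<dots> \<le> (\<Sum>k=1..<p - 1. 10 * real p * (2 * real p) ^ (4 * p))"
    proof (rule sum_mono)
      fix k assume "k \<in> {1..<p - 1}"
      hence k: "0 < k" "k < p - 1" by auto
      have 1: "norm (L1 k) * norm (T k) \<le> 5 * (2 * real p)"
        unfolding T_def by (rule bounded_character.Lval_1_times_mangoldt_sum[OF bounded_char[OF k] assms])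
      have "1 / (2 * real p) ^ (4 * p) * norm (T k) \<le> norm (L1 k) * norm (T k)"
        by (intro mult_right_mono L1_ge k) auto
      with 1 have "norm (T k) / (2 * real p) ^ (4 * p) \<le> 10 * real p" by simp
      thus "norm (T k) \<le> 10 * real p * (2 * real p) ^ (4 * p)" using p_ge_2 by (simp add: divide_le_eq)
    qed
    also have "\<dots> \<le> real p * (10 * real p * (2 * real p) ^ (4 * p))" by simp (intro mult_right_mono, auto)
    finally have 1: "\<bar>Re (\<Sum>k=1..<p - 1. T k)\<bar> \<le> real p * (10 * real p * (2 * real p) ^ (4 * p))" .
    have "Re (T 0) = (\<Sum>n=1..N. if p dvd n then 0 else mangoldt n / real n)"
      unfolding T_def Re_sum by (intro sum.cong) (auto simp: char_def)
    \<comment> \<open>6 is 3 from Mertens' theorem, 2 for the non-primes and 1 for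
      \<open>n = p\<close>, since \<open>ln p / p \<le> 1\<close>.\<close>
    also have "\<dots> \<ge> ln (real N) - 6"
    proof -
      have "(\<Sum>n=1..N. mangoldt n / real n) = (\<Sum>n=1..N. if p dvd n then 0 else mangoldt n / real n) + (\<Sum>n=1..N. if p dvd n then mangoldt n / real n else 0)"
        unfolding sum.distrib[symmetric] by (intro sum.cong) auto
      moreover have "(\<Sum>n=1..N. if p dvd n then mangoldt n / real n else 0)
          \<le> (\<Sum>n=1..N. (if n = p then 1 else 0) + (if \<not> prime n then mangoldt n / real n else 0))"
      proof (rule sum_mono)
        fix n assume "n \<in> {1..N}"
        have "ln (real p) / real p \<le> 1" using p_ge_2 ln_le_minus_one[of "real p"] by simp
        moreover have "n = p" if "p dvd n" "prime n" using primes_dvd_imp_eq[OF prime_p that(2) that(1)] by simp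
        ultimately show "(if p dvd n then mangoldt n / real n else 0) \<le> (if n = p then 1 else 0) + (if \<not> prime n then mangoldt n / real n else 0)"
          using prime_p by (auto simp: mangoldt_nonneg)
      qed
      moreover have "(\<Sum>n=1..N. if n = p then 1 else 0) \<le> (1::real)" by simp
      moreover have "(\<Sum>n=1..N. if \<not> prime n then mangoldt n / real n else 0) \<le> 2"
        using sum_nonprime_mangoldt_le[of N] by (subst (asm) sum.inter_filter) auto
      ultimately show ?thesis using mertens_first_mangoldt[OF assms] by (simp add: sum.distrib)
    qed
    finally show ?thesis using 1 by simp
  qed
  moreover have "6 + real p * (10 * real p * (2 * real p) ^ (4 * p)) \<le> (2 * real p) ^ (4 * p + 3)"
  proof -
    define y where "y = (2 * real p) ^ (4 * p)"
    have y: "y \<ge> 1" unfolding y_def using p_ge_2 by (intro one_le_power) auto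
    have p2: "real p \<ge> 2" using p_ge_2 by simp
    have "(6::real) \<le> 6 * (real p)\<^sup>2 / 4" using power_mono[OF p2, of 2] by simp
    also have "\<dots> \<le> 6 * (real p)\<^sup>2 / 4 * y" using y by (simp add: mult_le_cancel_left1)
    finally have "6 + real p * (10 * real p * y) \<le> 16 * (real p)\<^sup>2 * y" using y by (simp add: power2_eq_square)
    also have "\<dots> \<le> (2 * real p) ^ 3 * y"
      using p2 y by (intro mult_right_mono) (auto simp: power_mult_distrib power2_eq_square power3_eq_cube)
    finally show ?thesis by (simp add: y_def power_add mult.commute)
  qed
  ultimately show ?thesis by linarith
qed

text \<open>The non-primes cost 2 and the characters \<open>y = (2 * p) ^ (4 * p + 3)\<close>; the
  two further powers of \<open>2 * p\<close> in the hypothesis make both together at most half of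
  the main term \<open>ln N / p\<close>.\<close>

lemma sum_ln_primes_mod_ge:
  assumes N: "N > 0" "ln (real N) \<ge> (2 * real p) ^ (4 * p + 5)"
  shows "(\<Sum>q | q \<in> {1..N} \<and> prime q \<and> [q = 1] (mod p). ln (real q) / real q) \<ge> ln (real N) / (2 * real p)"
proof -
  define X where "X = ln (real N)"
  define y where "y = (2 * real p) ^ (4 * p + 3)"
  define S where "S = (\<Sum>n | n \<in> {1..N} \<and> [n = 1] (mod p). mangoldt n / real n)"
  have p2: "real p \<ge> 2" using p_ge_2 by simp
  have y: "y \<ge> 2 * real p" unfolding y_def using p2 self_le_power[of "2 * real p" "4 * p + 3"] by simp
  have "2 + (4 * p + 3) = 4 * p + 5" by simp
  hence "(2 * real p)\<^sup>2 * y = (2 * real p) ^ (4 * p + 5)" unfolding y_def by (metis power_add)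
  hence "X \<ge> (2 * real p)\<^sup>2 * y" using N(2) by (simp only: X_def)
  moreover have "(2 * real p)\<^sup>2 \<ge> 4\<^sup>2" using p2 by (intro power_mono) auto
  hence "(2 * real p)\<^sup>2 * y \<ge> 16 * y" using y p2 by (intro mult_right_mono) auto
  ultimately have X: "X \<ge> 16 * y" by linarith
  have "X - y \<le> real (p - 1) * S" unfolding X_def y_def S_def by (rule sum_mangoldt_mod_ge[OF N(1)])
  also have "\<dots> \<le> real p * S" by (intro mult_right_mono) (auto simp: S_def intro!: sum_nonneg simp: mangoldt_nonneg)
  finally have S: "(X - y) / real p \<le> S" using p2 by (simp add: field_simps)
  have "S = (\<Sum>q | q \<in> {1..N} \<and> prime q \<and> [q = 1] (mod p). mangoldt q / real q) + (\<Sum>n | n \<in> {1..N} \<and> \<not> prime n \<and> [n = 1] (mod p). mangoldt n / real n)"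
    unfolding S_def by (subst sum.union_disjoint[symmetric]) (auto intro!: sum.cong)
  moreover have "(\<Sum>n | n \<in> {1..N} \<and> \<not> prime n \<and> [n = 1] (mod p). mangoldt n / real n) \<le> 2"
    by (rule order.trans[OF sum_mono2 sum_nonprime_mangoldt_le[of N]]) (auto simp: mangoldt_nonneg)
  moreover have "(\<Sum>q | q \<in> {1..N} \<and> prime q \<and> [q = 1] (mod p). mangoldt q / real q) = 
    (\<Sum>q | q \<in> {1..N} \<and> prime q \<and> [q = 1] (mod p). ln (real q) / real q)"
    by (intro sum.cong) auto
  ultimately have "(\<Sum>q | q \<in> {1..N} \<and> prime q \<and> [q = 1] (mod p). ln (real q) / real q) \<ge> (X - y) / real p - 2"
    using S by linarith
  moreover have "(X - y) / real p - 2 \<ge> X / (2 * real p)" 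
    using X y p2 by (simp add: field_simps)
  ultimately show ?thesis by (simp add: X_def)
qed

end

section \<open>From logarithmic weights to sums of reciprocals, and to numbers without such prime
  factors\<close>

definition inv_prime_sum :: "nat \<Rightarrow> nat \<Rightarrow> real" where
  "inv_prime_sum p N = (\<Sum>q | prime q \<and> [q = 1] (mod p) \<and> q \<le> N. 1 / real q)"

text \<open>The left side is \<open>(ln (n + 1) - ln n) / ln (n + 1)\<close>. Concavity of
  \<open>ln\<close> replaces the numerator by the next, smaller increment, which matches the
  denominator; hence the shift to \<open>n + 1\<close> and \<open>n + 2\<close>.\<close>

lemma ln_ln_step:
  assumes "n \<ge> 2"
  shows "ln (real n) * (1 / ln (real n) - 1 / ln (real (Suc n))) \<ge> ln (ln (real (n + 2))) - ln (ln (real (n + 1)))"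
proof -
  have pos: "0 < ln (real n)" "0 < ln (real (n + 1))" "0 < ln (real (n + 2))" using assms by auto
  have "ln (ln (real (n + 2))) - ln (ln (real (n + 1))) = ln (ln (real (n + 2)) / ln (real (n + 1)))"
    using pos by (simp add: ln_divide_pos)
  also have "\<dots> \<le> ln (real (n + 2)) / ln (real (n + 1)) - 1" using pos by (intro ln_le_minus_one) auto
  also have "\<dots> = (ln (real (n + 2)) - ln (real (n + 1))) / ln (real (n + 1))"
    using pos by (simp add: diff_divide_distrib)
  also have "\<dots> \<le> (ln (real (n + 1)) - ln (real n)) / ln (real (n + 1))"
  proof (rule divide_right_mono)
    have "real (n + 2) / real (n + 1) \<le> real (n + 1) / real n" using assms by (simp add: field_simps)
    hence "ln (real (n + 2) / real (n + 1)) \<le> ln (real (n + 1) / real n)" using assms by (intro ln_mono) auto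
    thus "ln (real (n + 2)) - ln (real (n + 1)) \<le> ln (real (n + 1)) - ln (real n)"
      using assms by (simp add: ln_divide_pos)
  qed (use pos in auto)
  also have "\<dots> = ln (real n) * (1 / ln (real n) - 1 / ln (real (Suc n)))"
    using pos by (simp add: field_simps)
  finally show ?thesis .
qed

text \<open>Abel summation with the weights \<open>1 / ln\<close>. Terms below \<open>M\<close> are
  nonnegative and are dropped, so the lower bound for the partial sums is asked for from
  \<open>M\<close> on.\<close>

lemma sum_divide_ln_ge:
  fixes a :: "nat \<Rightarrow> real"
  assumes a: "\<And>n. a n \<ge> 0" and M: "2 \<le> M" "M \<le> N" and c: "c > 0"
    and S: "\<And>n. M \<le> n \<Longrightarrow> n \<le> N \<Longrightarrow> (\<Sum>i=1..n. a i) \<ge> c * ln (real n)"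
  shows "(\<Sum>i=2..N. a i / ln (real i)) \<ge> c * (ln (ln (real (N + 1))) - ln (ln (real (M + 1)))) + (\<Sum>i=1..N. a i) / ln (real (N + 1)) - (\<Sum>i=1..1. a i) / ln 2"
proof -
  define A where "A n = (\<Sum>i=1..n. a i)" for n
  have A0: "A n \<ge> 0" for n unfolding A_def using a by (intro sum_nonneg) auto
  define f where "f n = 1 / ln (real n)" for n :: nat
  have fd: "f n - f (Suc n) \<ge> 0" if "n \<ge> 2" for n
  proof -
    have "0 < ln (real n)" "ln (real n) \<le> ln (real (Suc n))" using that by (auto intro!: ln_mono)
    thus ?thesis by (simp add: f_def frac_le)
  qed
  have abel: "(\<Sum>i=2..n. a i / ln (real i)) = (\<Sum>i=2..n. A i * (f i - f (Suc i))) + A n * f (Suc n) - A 1 * f 2" if "n \<ge> 2" for n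
    using that
  proof (induction n rule: nat_induct_at_least)
    case base
    have "A 2 = A 1 + a 2" by (simp add: A_def numeral_2_eq_2)
    thus ?case by (simp add: f_def algebra_simps)
  next
    case (Suc n)
    have "A (Suc n) = A n + a (Suc n)" by (simp add: A_def)
    with Suc show ?case by (simp add: f_def algebra_simps add_divide_distrib)
  qed
  have "(\<Sum>i=2..N. A i * (f i - f (Suc i))) \<ge> (\<Sum>i=M..N. A i * (f i - f (Suc i)))"
    using M by (intro sum_mono2) (auto intro!: mult_nonneg_nonneg A0 fd)
  moreover have "(\<Sum>i=M..N. A i * (f i - f (Suc i))) \<ge> (\<Sum>i=M..N. c * (ln (ln (real (i + 2))) - ln (ln (real (i + 1)))))"
  proof (rule sum_mono)
    fix i assume i: "i \<in> {M..N}"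
    have "c * (ln (ln (real (i + 2))) - ln (ln (real (i + 1)))) \<le> c * (ln (real i) * (f i - f (Suc i)))"
      using ln_ln_step[of i] i M c unfolding f_def by (intro mult_left_mono) auto
    also have "\<dots> \<le> A i * (f i - f (Suc i))"
      using mult_right_mono[OF S fd, of i] i M by (auto simp: A_def mult.assoc)
    finally show "c * (ln (ln (real (i + 2))) - ln (ln (real (i + 1)))) \<le> A i * (f i - f (Suc i))" .
  qed
  moreover have "(\<Sum>i=M..N. ln (ln (real (i + 2))) - ln (ln (real (i + 1)))) = ln (ln (real (N + 2))) - ln (ln (real (M + 1)))"
    using sum_Suc_diff[of M N "\<lambda>i. ln (ln (real (i + 1)))"] M by (simp add: add_ac)
  hence "(\<Sum>i=M..N. c * (ln (ln (real (i + 2))) - ln (ln (real (i + 1))))) = c * (ln (ln (real (N + 2))) - ln (ln (real (M + 1))))"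
    by (simp only: sum_distrib_left[symmetric])
  moreover have "c * (ln (ln (real (N + 2))) - ln (ln (real (M + 1)))) \<ge> c * (ln (ln (real (N + 1))) - ln (ln (real (M + 1))))"
    using c M by (intro mult_left_mono) auto
  ultimately show ?thesis using abel[of N] M by (simp add: f_def A_def)
qed

text \<open>\<open>M\<close> is the point from which the logarithmically weighted sum has its lower
  bound. What is lost is \<open>ln (ln (M + 1))\<close>, at most \<open>ln (Y + 1)\<close>, and this
  is where \<open>(4 * p + 6) * ln (2 * p)\<close> comes from.\<close>

lemma inv_prime_sum_ge:
  assumes p: "prime p" and N: "ln (real N) > (2 * real p) ^ (4 * p + 5) + 1"
  shows "inv_prime_sum p N \<ge> (ln (ln (real N)) - (4 * real p + 6) * ln (2 * real p)) / (2 * real p)"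
proof -
  obtain g where g: "residue_primroot p g" using prime_primitive_root_exists[OF prime_gt_1_nat[OF p] p] by blast
  interpret prime_characters p g by unfold_locales (use p g in auto)
  define Y where "Y = (2 * real p) ^ (4 * p + 5)"
  define M where "M = nat \<lceil>exp Y\<rceil>"
  have p2: "real p \<ge> 2" using p_ge_2 by simp
  have Y4: "Y \<ge> 4" unfolding Y_def using p2 self_le_power[of "2 * real p" "4 * p + 5"] by simp
  have eY: "exp Y \<ge> 5" using exp_ge_add_one_self[of Y] Y4 by linarith
  have M: "real M \<ge> exp Y" "real M \<le> exp Y + 1" "M \<ge> 2" unfolding M_def using eY by linarith+
  have N0: "real N > 0" using N Y4 by (cases "N = 0") (auto simp: Y_def)
  have "real N > exp (Y + 1)" using N N0 unfolding Y_def[symmetric] by (metis exp_less_cancel_iff exp_ln)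
  moreover have "exp (Y + 1) \<ge> 2 * exp Y" using exp_ge_add_one_self[of 1] by (simp add: exp_add)
  ultimately have NM: "real N \<ge> exp Y + 1" "real N \<ge> real (M + 1)" using M eY by linarith+
  define a where "a n = (if prime n \<and> [n = 1] (mod p) then ln (real n) / real n else 0)" for n
  have a0: "a n \<ge> 0" for n by (cases "n = 0") (auto simp: a_def)
  have a1: "a 1 = 0" by (simp add: a_def)
  have S: "(\<Sum>i=1..n. a i) \<ge> 1 / (2 * real p) * ln (real n)" if "M \<le> n" for n
  proof -
    have n: "real n \<ge> exp Y" using that M by linarith
    hence "ln (real n) \<ge> Y" using exp_gt_zero[of Y] by (metis ln_exp ln_mono)
    moreover have "n > 0" using that M by simp
    moreover have "(\<Sum>q | q \<in> {1..n} \<and> prime q \<and> [q = 1] (mod p). ln (real q) / real q) = (\<Sum>i=1..n. a i)"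
      unfolding a_def by (subst sum.inter_filter) auto
    ultimately show ?thesis using sum_ln_primes_mod_ge[of n] by (simp add: Y_def)
  qed
  have "inv_prime_sum p N = (\<Sum>i=2..N. a i / ln (real i))"
  proof -
    have "(\<Sum>i=2..N. a i / ln (real i)) = (\<Sum>i=2..N. if prime i \<and> [i = 1] (mod p) then 1 / real i else 0)"
      by (intro sum.cong) (auto simp: a_def)
    also have "\<dots> = (\<Sum>i\<in>{i \<in> {2..N}. prime i \<and> [i = 1] (mod p)}. 1 / real i)"
      by (rule sum.inter_filter[symmetric]) auto
    also have "{i \<in> {2..N}. prime i \<and> [i = 1] (mod p)} = {q. prime q \<and> [q = 1] (mod p) \<and> q \<le> N}"
      by (auto simp: prime_ge_2_nat)
    finally show ?thesis by (simp add: inv_prime_sum_def)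
  qed
  also have "\<dots> \<ge> 1 / (2 * real p) * (ln (ln (real (N + 1))) - ln (ln (real (M + 1)))) + (\<Sum>i=1..N. a i) / ln (real (N + 1)) - (\<Sum>i=1..1. a i) / ln 2"
    by (rule sum_divide_ln_ge[OF a0]) (use M NM S p2 in auto)
  moreover have "(\<Sum>i=1..N. a i) / ln (real (N + 1)) \<ge> 0" by (intro divide_nonneg_nonneg sum_nonneg a0) auto
  moreover have "(\<Sum>i=1..1. a i) / ln 2 = 0" using a1 by simp
  moreover have "1 / (2 * real p) * (ln (ln (real (N + 1))) - ln (ln (real (M + 1)))) \<ge> (ln (ln (real N)) - (4 * real p + 6) * ln (2 * real p)) / (2 * real p)"
  proof -
    have "ln (real N) > 0" using N Y4 by (simp add: Y_def)
    hence "ln (ln (real N)) \<le> ln (ln (real (N + 1)))" using N0 by (intro ln_mono) auto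
    moreover have "ln (ln (real (M + 1))) \<le> (4 * real p + 6) * ln (2 * real p)"
    proof -
      have "real (M + 1) \<le> exp (Y + 1)" using M eY \<open>exp (Y + 1) \<ge> 2 * exp Y\<close> by simp
      hence "ln (real (M + 1)) \<le> ln (exp (Y + 1))" by (intro ln_mono) auto
      hence "ln (real (M + 1)) \<le> Y + 1" by (simp only: ln_exp)
      also have "4 * Y \<le> 2 * real p * Y" using p2 Y4 by (intro mult_right_mono) auto
      hence "Y + 1 \<le> 2 * real p * Y" using Y4 by linarith
      also have "\<dots> = (2 * real p) ^ (4 * p + 6)" 
      proof -
        have "4 * p + 6 = Suc (4 * p + 5)" by simp
        thus ?thesis unfolding Y_def by (metis power_Suc)
      qed
      finally have "ln (ln (real (M + 1))) \<le> ln ((2 * real p) ^ (4 * p + 6))" using M by (intro ln_mono) auto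
      also have "\<dots> = (4 * real p + 6) * ln (2 * real p)" by (subst ln_realpow) auto
      finally show ?thesis .
    qed
    ultimately have "ln (ln (real N)) - (4 * real p + 6) * ln (2 * real p) \<le> ln (ln (real (N + 1))) - ln (ln (real (M + 1)))" by linarith
    thus ?thesis using p2 by (simp add: divide_right_mono)
  qed
  ultimately show ?thesis by linarith
qed

text \<open>Chebyshev's inequality, applied to the number of \<open>q \<in> Q\<close> dividing a random \<open>n \<le> N\<close>.\<close>

lemma card_no_prime_factor_le:
  assumes Q: "finite Q" "\<And>q. q \<in> Q \<Longrightarrow> prime q \<and> q \<le> N" and S: "S = (\<Sum>q\<in>Q. 1 / real q)" "S > 0"
  shows "real (card {n \<in> {1..N}. \<forall>q\<in>Q. \<not> q dvd n}) \<le> 3 * real N / S"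
proof -
  define om where "om n = real (card {q \<in> Q. q dvd n})" for n
  have om: "om n = (\<Sum>q\<in>Q. if q dvd n then 1 else 0)" for n
    using Q(1) by (simp add: om_def sum.inter_filter[symmetric])
  have cnt: "(\<Sum>n=1..N. if d dvd n then 1 else 0 :: real) = real (N div d)" if "d > 0" for d
  proof -
    have "(\<Sum>n=1..N. if d dvd n then 1 else 0 :: real) = real (card {n \<in> {1..N}. d dvd n})"
      by (simp add: sum.inter_filter[symmetric])
    also have "{n \<in> {1..N}. d dvd n} = (\<lambda>m. d * m) ` {1..N div d}"
      using that by (auto simp: less_eq_div_iff_mult_less_eq mult.commute elim!: dvdE)
    also have "card \<dots> = N div d" using that by (subst card_image) (auto simp: inj_on_def)
    finally show ?thesis .
  qed
  have Q0: "q > 0" if "q \<in> Q" for q using Q that prime_gt_0_nat by blast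
  have m1: "(\<Sum>n=1..N. om n) \<ge> real N * S - real N"
  proof -
    have "(\<Sum>n=1..N. om n) = (\<Sum>q\<in>Q. real (N div q))"
      unfolding om by (subst sum.swap) (intro sum.cong refl cnt Q0)
    also have "\<dots> \<ge> (\<Sum>q\<in>Q. real N / real q - 1)"
    proof (rule sum_mono)
      fix q assume "q \<in> Q"
      hence "N < q * Suc (N div q)" using Q0 dividend_less_times_div[of q N] by simp
      hence "real N < real q * real (Suc (N div q))" by (simp only: of_nat_mult[symmetric] of_nat_less_iff)
      thus "real N / real q - 1 \<le> real (N div q)" using Q0[OF \<open>q \<in> Q\<close>] by (simp add: field_simps)
    qed
    moreover have "Q \<subseteq> {1..N}"
    proof
      fix q assume "q \<in> Q"
      thus "q \<in> {1..N}" using Q(2)[of q] Q0[of q] by simp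
    qed
    hence "card Q \<le> card {1..N}" by (intro card_mono) auto
    ultimately show ?thesis by (simp add: S(1) sum_subtractf sum_distrib_left)
  qed
  have m2: "(\<Sum>n=1..N. (om n)\<^sup>2) \<le> real N * S\<^sup>2 + real N * S"
  proof -
    have "(\<Sum>n=1..N. (om n)\<^sup>2) = (\<Sum>n=1..N. \<Sum>q\<in>Q. \<Sum>r\<in>Q. if q dvd n \<and> r dvd n then 1 else 0)"
      unfolding om power2_eq_square sum_product by (intro sum.cong refl) auto
    also have "\<dots> = (\<Sum>q\<in>Q. \<Sum>r\<in>Q. \<Sum>n=1..N. if q dvd n \<and> r dvd n then 1 else 0)"
      by (rule trans[OF sum.swap], rule sum.cong[OF refl], rule sum.swap)
    also have "\<dots> \<le> (\<Sum>q\<in>Q. \<Sum>r\<in>Q. real N / (real q * real r) + (if q = r then real N / real q else 0))"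
    proof (intro sum_mono)
      fix q r assume qr: "q \<in> Q" "r \<in> Q"
      show "(\<Sum>n=1..N. if q dvd n \<and> r dvd n then 1 else 0) \<le> real N / (real q * real r) + (if q = r then real N / real q else 0)"
      proof (cases "q = r")
        case True
        have "(\<Sum>n=1..N. if q dvd n \<and> r dvd n then 1 else 0) = real (N div q)"
          using cnt[OF Q0[OF qr(1)]] True by simp
        moreover have "\<dots> \<le> real N / real q" by (rule of_nat_div_le_of_nat)
        moreover have "0 \<le> real N / (real q * real r)" by simp
        ultimately have "(\<Sum>n=1..N. if q dvd n \<and> r dvd n then 1 else 0) \<le> real N / (real q * real r) + real N / real q"
          by linarith
        thus ?thesis using True by (simp only: if_True simp_thms)
      next
        case False
        hence "coprime q r" using Q qr by (simp add: primes_coprime)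
        hence "q dvd n \<and> r dvd n \<longleftrightarrow> q * r dvd n" for n using divides_mult by (auto dest: dvd_mult_left dvd_mult_right)
        hence "(\<Sum>n=1..N. if q dvd n \<and> r dvd n then 1 else 0) = real (N div (q * r))"
          using cnt[of "q * r"] Q0 qr by simp
        also have "\<dots> \<le> real N / real (q * r)" by (rule of_nat_div_le_of_nat)
        finally show ?thesis using False by simp
      qed
    qed
    also have "\<dots> = real N * (\<Sum>q\<in>Q. \<Sum>r\<in>Q. (1 / real q) * (1 / real r)) + real N * S"
      using Q(1) by (simp add: sum.distrib S(1) sum_distrib_left)
    also have "(\<Sum>q\<in>Q. \<Sum>r\<in>Q. (1 / real q) * (1 / real r)) = S\<^sup>2"
      unfolding S(1) power2_eq_square sum_product ..
    finally show ?thesis .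
  qed
  define Z where "Z = {n \<in> {1..N}. \<forall>q\<in>Q. \<not> q dvd n}"
  \<comment> \<open>On \<open>Z\<close> the count is 0, so each element contributes
    \<open>S^2\<close> to a sum of squared deviations that is at most \<open>3 * N * S\<close>: one
    \<open>N * S\<close> comes from the diagonal pairs \<open>q = r\<close>, two from the rounding
    in the first moment.\<close>
  have "real (card Z) * S\<^sup>2 = (\<Sum>n\<in>Z. (om n - S)\<^sup>2)"
  proof -
    have "om n = 0" if "n \<in> Z" for n using that by (auto simp: om Z_def intro!: sum.neutral)
    thus ?thesis by simp
  qed
  also have "\<dots> \<le> (\<Sum>n=1..N. (om n - S)\<^sup>2)" by (intro sum_mono2) (auto simp: Z_def)
  also have "\<dots> = (\<Sum>n=1..N. (om n)\<^sup>2) - 2 * S * (\<Sum>n=1..N. om n) + real N * S\<^sup>2"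
    by (simp add: power2_diff sum.distrib sum_subtractf sum_distrib_left mult_ac)
  also have "\<dots> \<le> (real N * S\<^sup>2 + real N * S) - 2 * S * (real N * S - real N) + real N * S\<^sup>2"
    using m1 m2 S(2) by (intro add_mono diff_mono mult_left_mono) auto
  also have "\<dots> = 3 * real N * S" by (simp add: power2_eq_square algebra_simps)
  finally have "(real (card Z) * S) * S \<le> (3 * real N) * S" by (simp add: power2_eq_square mult_ac)
  hence "real (card Z) * S \<le> 3 * real N" using S(2) by simp
  thus ?thesis using S(2) by (simp add: Z_def field_simps)
qed

section \<open>Prime factors of Euler's function\<close>

lemma dedekind_psi_totient_ratio:
  assumes "m > 0"
  shows "dedekind_psi m / real (totient m) = (\<Prod>p\<in>prime_factors m. (real p + 1) / (real p - 1))"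
proof -
  have "real (totient m) = real m * (\<Prod>p\<in>prime_factors m. 1 - 1 / real p)"
    using totient_formula2[of m] by simp
  hence "dedekind_psi m / real (totient m) = (\<Prod>p\<in>prime_factors m. (1 + 1 / real p) / (1 - 1 / real p))"
    using assms by (simp add: dedekind_psi_def prod_dividef)
  also have "\<dots> = (\<Prod>p\<in>prime_factors m. (real p + 1) / (real p - 1))"
  proof (intro prod.cong refl)
    fix p assume "p \<in> prime_factors m"
    hence "p > 1" using prime_gt_1_nat by auto
    thus "(1 + 1 / real p) / (1 - 1 / real p) = (real p + 1) / (real p - 1)" by (simp add: divide_simps)
  qed
  finally show ?thesis .
qed

lemma K_eq: "n > 0 \<Longrightarrow> K n = (\<Prod>p\<in>prime_factors (totient n). (real p + 1) / (real p - 1))"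
  unfolding K_def by (rule dedekind_psi_totient_ratio) simp

lemma ratio_ge_1: "prime p \<Longrightarrow> (real p + 1) / (real p - 1) \<ge> 1"
  using prime_gt_1_nat[of p] by simp

text \<open>For a prime \<open>q\<close> dividing \<open>n\<close>, this collects the primes
  \<open>r \<ge> Y\<close> that \<open>q\<close> can bring into \<open>totient n\<close>. They
  divide \<open>q - 1\<close>, or are \<open>q\<close> itself; the latter happens when
  \<open>q^2\<close> divides \<open>n\<close> and is allowed for in any case.\<close>

definition big_factor :: "nat \<Rightarrow> nat \<Rightarrow> real" where
  "big_factor Y q = (\<Prod>r | r \<in> prime_factors (q * (q - 1)) \<and> r \<ge> Y. (real r + 1) / (real r - 1))"

lemma big_factor_ge_1: "big_factor Y q \<ge> 1"
  unfolding big_factor_def by (intro prod_ge_1 ratio_ge_1) auto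

lemma prod_UN_le:
  fixes f :: "'a \<Rightarrow> real"
  assumes "finite I" "\<And>i. i \<in> I \<Longrightarrow> finite (A i)" "\<And>i x. i \<in> I \<Longrightarrow> x \<in> A i \<Longrightarrow> f x \<ge> 1"
  shows "(\<Prod>x\<in>(\<Union>i\<in>I. A i). f x) \<le> (\<Prod>i\<in>I. \<Prod>x\<in>A i. f x)"
  using assms
proof (induction I rule: finite_induct)
  case (insert j I)
  define U where "U = (\<Union>i\<in>I. A i)"
  have U: "finite U" "\<And>x. x \<in> U \<Longrightarrow> f x \<ge> 1" using insert by (auto simp: U_def)
  have "(\<Prod>x\<in>(\<Union>i\<in>insert j I. A i). f x) = (\<Prod>x\<in>A j \<union> (U - A j). f x)"
    by (intro prod.cong) (auto simp: U_def)
  also have "\<dots> = (\<Prod>x\<in>A j. f x) * (\<Prod>x\<in>U - A j. f x)"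
    using insert.prems U by (intro prod.union_disjoint) auto
  also have "\<dots> \<le> (\<Prod>x\<in>A j. f x) * (\<Prod>i\<in>I. \<Prod>x\<in>A i. f x)"
  proof (rule mult_left_mono)
    have "(\<Prod>x\<in>U - A j. f x) \<le> (\<Prod>x\<in>U. f x)"
      using U by (intro prod_mono2) (auto intro: order.trans[OF zero_le_one])
    also have "(\<Prod>x\<in>U. f x) \<le> (\<Prod>i\<in>I. \<Prod>x\<in>A i. f x)"
      unfolding U_def by (rule insert.IH) (use insert.prems in auto)
    finally show "(\<Prod>x\<in>U - A j. f x) \<le> (\<Prod>i\<in>I. \<Prod>x\<in>A i. f x)" .
    show "(\<Prod>x\<in>A j. f x) \<ge> 0"
      using insert.prems by (intro prod_nonneg) (auto intro: order.trans[OF zero_le_one])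
  qed
  finally show ?case using insert.hyps by simp
qed auto

lemma prime_dvd_totient:
  assumes "prime p" "p dvd totient n" "n > 0"
  obtains q where "q \<in> prime_factors n" "p dvd q * (q - 1)"
proof -
  have "p dvd (\<Prod>q\<in>prime_factors n. q ^ (multiplicity q n - 1) * (q - 1))"
    using assms totient_formula1[of n] by simp
  then obtain q where q: "q \<in> prime_factors n" "p dvd q ^ (multiplicity q n - 1) * (q - 1)"
    using assms(1) by (subst (asm) prime_dvd_prod_iff) auto
  hence "p dvd q * (q - 1)" using assms(1) by (auto simp: prime_dvd_mult_iff dest: prime_dvd_power)
  with q that show ?thesis by blast
qed

text \<open>All primes below \<open>Y\<close> are counted as present, and a larger prime of
  \<open>totient n\<close> is counted once for every \<open>q\<close> that may produce it. Since the
  ratios are at least 1, overcounting only increases the product.\<close>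

lemma K_le:
  assumes "n > 0"
  shows "K n \<le> prime_ratio_prod Y * (\<Prod>q\<in>prime_factors n. big_factor Y q)"
proof -
  define f where "f r = (real r + 1) / (real r - 1)" for r :: nat
  define A where "A q = {r \<in> prime_factors (q * (q - 1)). r \<ge> Y}" for q
  define U where "U = (\<Union>q\<in>prime_factors n. A q)"
  have finA: "finite (A q)" for q by (simp add: A_def)
  have f1: "f r \<ge> 1" if "prime r" for r using ratio_ge_1[OF that] by (simp add: f_def)
  have finP: "finite {p. prime p \<and> p < Y}" by (rule finite_subset[of _ "{..<Y}"]) auto
  have sub: "prime_factors (totient n) \<subseteq> {p. prime p \<and> p < Y} \<union> U"
  proof
    fix p assume "p \<in> prime_factors (totient n)"
    hence p: "prime p" "p dvd totient n" by auto
    obtain q where q: "q \<in> prime_factors n" "p dvd q * (q - 1)" by (rule prime_dvd_totient[OF p assms])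
    have "q > 1" using q(1) prime_gt_1_nat by auto
    hence "p \<in> prime_factors (q * (q - 1))" using q p by (intro prime_factorsI) auto
    thus "p \<in> {p. prime p \<and> p < Y} \<union> U" using p q by (auto simp: U_def A_def)
  qed
  have "K n = (\<Prod>p\<in>prime_factors (totient n). f p)" using K_eq[OF assms] by (simp add: f_def)
  also have "\<dots> \<le> (\<Prod>p\<in>{p. prime p \<and> p < Y} \<union> U. f p)"
    using sub finP finA by (intro prod_mono2) (auto simp: U_def A_def intro!: f1 order.trans[OF zero_le_one f1])
  also have "\<dots> = (\<Prod>p | prime p \<and> p < Y. f p) * (\<Prod>p\<in>U. f p)"
    using finP finA by (intro prod.union_disjoint) (auto simp: U_def A_def)
  also have "\<dots> \<le> (\<Prod>p | prime p \<and> p < Y. f p) * (\<Prod>q\<in>prime_factors n. \<Prod>r\<in>A q. f r)"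
    unfolding U_def by (intro mult_left_mono prod_UN_le prod_nonneg) 
      (auto simp: A_def intro!: f1 order.trans[OF zero_le_one f1])
  finally show ?thesis by (simp add: prime_ratio_prod_def big_factor_def f_def A_def)
qed

lemma prod_ge_one_minus_sum:
  fixes a :: "'a \<Rightarrow> real"
  assumes "finite A" "\<And>x. x \<in> A \<Longrightarrow> 0 \<le> a x \<and> a x \<le> 1"
  shows "(\<Prod>x\<in>A. 1 - a x) \<ge> 1 - (\<Sum>x\<in>A. a x)"
  using assms
proof (induction A rule: finite_induct)
  case (insert y A)
  have P: "0 \<le> (\<Prod>x\<in>A. 1 - a x)" "(\<Prod>x\<in>A. 1 - a x) \<le> 1"
    using insert.prems by (auto intro!: prod_nonneg prod_le_1)
  have "a y * (\<Prod>x\<in>A. 1 - a x) \<le> a y * 1" using P insert.prems by (intro mult_left_mono) auto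
  moreover have "1 - (\<Sum>x\<in>A. a x) \<le> (\<Prod>x\<in>A. 1 - a x)" using insert by auto
  ultimately show ?case using insert.hyps by (simp add: algebra_simps)
qed auto

text \<open>The weight is \<open>2 / (p + 1)\<close> because leaving out \<open>p\<close> multiplies
  a product of ratios by \<open>(p - 1) / (p + 1) = 1 - 2 / (p + 1)\<close>.\<close>

definition missing_weight :: "nat \<Rightarrow> nat \<Rightarrow> real" where
  "missing_weight Y n = (\<Sum>p | prime p \<and> p < Y. if p dvd totient n then 0 else 2 / (real p + 1))"

lemma missing_weight_nonneg: "missing_weight Y n \<ge> 0"
  unfolding missing_weight_def by (intro sum_nonneg) auto

lemma prime_ratio_prod_ge_1: "prime_ratio_prod Y \<ge> 1"
  unfolding prime_ratio_prod_def by (intro prod_ge_1 ratio_ge_1) auto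

text \<open>Weierstrass's product inequality turns the missing factors into a sum, whose mean over
  \<open>n\<close> can be computed prime by prime. For exceptional \<open>n\<close> the bound may be
  negative, which does no harm on average.\<close>

lemma K_ge:
  assumes "n > 0"
  shows "K n \<ge> prime_ratio_prod Y * (1 - missing_weight Y n)"
proof -
  define f where "f r = (real r + 1) / (real r - 1)" for r :: nat
  define P where "P = {p. prime p \<and> p < Y}"
  define a where "a p = (if p dvd totient n then 0 else 2 / (real p + 1))" for p
  have finP: "finite P" unfolding P_def by (rule finite_subset[of _ "{..<Y}"]) auto
  have f1: "f r \<ge> 1" if "prime r" for r using ratio_ge_1[OF that] by (simp add: f_def)
  have "prime_ratio_prod Y * (1 - missing_weight Y n) \<le> prime_ratio_prod Y * (\<Prod>p\<in>P. 1 - a p)"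
  proof (intro mult_left_mono)
    have "1 - (\<Sum>p\<in>P. a p) \<le> (\<Prod>p\<in>P. 1 - a p)"
      using finP by (intro prod_ge_one_minus_sum) (auto simp: a_def P_def dest: prime_gt_1_nat)
    thus "1 - missing_weight Y n \<le> (\<Prod>p\<in>P. 1 - a p)" by (simp add: missing_weight_def P_def a_def)
  qed (use prime_ratio_prod_ge_1[of Y] in simp)
  also have "\<dots> = (\<Prod>p\<in>P. f p * (1 - a p))"
    unfolding prime_ratio_prod_def P_def f_def by (rule prod.distrib[symmetric])
  also have "\<dots> = (\<Prod>p\<in>P. if p dvd totient n then f p else 1)"
  proof (intro prod.cong refl)
    fix p assume "p \<in> P"
    hence "real p > 1" using prime_gt_1_nat by (auto simp: P_def)
    thus "f p * (1 - a p) = (if p dvd totient n then f p else 1)" by (simp add: f_def a_def divide_simps)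
  qed
  also have "\<dots> = (\<Prod>p\<in>{p \<in> P. p dvd totient n}. f p)" by (rule prod.inter_filter[OF finP, symmetric])
  also have "\<dots> \<le> (\<Prod>p\<in>prime_factors (totient n). f p)"
    using assms by (intro prod_mono2) (auto simp: P_def prime_factors_dvd intro!: f1 order.trans[OF zero_le_one f1])
  also have "\<dots> = K n" using K_eq[OF assms] by (simp add: f_def)
  finally show ?thesis .
qed

text \<open>\<open>p\<close> fails to divide \<open>totient n\<close> only if \<open>n\<close> has
  no prime factor congruent to 1 modulo \<open>p\<close>, and the proportion of such
  \<open>n\<close> is at most \<open>3 * p / s\<close>. The weight, less than \<open>2 / p\<close>,
  cancels the \<open>p\<close>, so that each of at most \<open>Y\<close> primes costs
  \<open>6 / s\<close>.\<close>

lemma sum_missing_weight_le: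
  assumes S: "\<And>p. prime p \<Longrightarrow> p < Y \<Longrightarrow> inv_prime_sum p N \<ge> s / real p" and s: "s > 0"
  shows "(\<Sum>n=1..N. missing_weight Y n) \<le> 6 * real N * real Y / s"
proof -
  have c: "real (card {n \<in> {1..N}. \<not> p dvd totient n}) \<le> 3 * real N * real p / s" if p: "prime p" "p < Y" for p
  proof -
    define Q where "Q = {q. prime q \<and> [q = 1] (mod p) \<and> q \<le> N}"
    define T where "T = (\<Sum>q\<in>Q. 1 / real q)"
    have p0: "real p > 0" using p prime_gt_0_nat by auto
    have finQ: "finite Q" unfolding Q_def by (rule finite_subset[of _ "{..N}"]) auto
    have T: "T \<ge> s / real p" using S[OF p] by (simp add: T_def Q_def inv_prime_sum_def)
    have sp: "s / real p > 0" using s p0 by simp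
    have "real (card {n \<in> {1..N}. \<not> p dvd totient n}) \<le> real (card {n \<in> {1..N}. \<forall>q\<in>Q. \<not> q dvd n})"
    proof (intro of_nat_mono card_mono)
      show "{n \<in> {1..N}. \<not> p dvd totient n} \<subseteq> {n \<in> {1..N}. \<forall>q\<in>Q. \<not> q dvd n}"
      proof safe
        fix n q assume n: "n \<in> {1..N}" "\<not> p dvd totient n" "q \<in> Q" "q dvd n"
        hence q: "prime q" "[q = 1] (mod p)" by (auto simp: Q_def)
        have "p dvd q - 1" using q prime_ge_1_nat[of q] cong_to_1_nat by blast
        also have "q - 1 = totient q" using q(1) by (simp add: totient_prime)
        also have "totient q dvd totient n" using n(4) by (rule totient_dvd)
        finally show False using n(2) by simp
      qed
    qed auto
    also have "\<dots> \<le> 3 * real N / T"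
      by (rule card_no_prime_factor_le[OF finQ _ T_def]) (use T sp in \<open>auto simp: Q_def\<close>)
    also have "\<dots> \<le> 3 * real N / (s / real p)" using T sp by (intro divide_left_mono mult_pos_pos) auto
    finally show ?thesis by simp
  qed
  have "(\<Sum>n=1..N. missing_weight Y n) = (\<Sum>p | prime p \<and> p < Y. \<Sum>n=1..N. if p dvd totient n then 0 else 2 / (real p + 1))"
    unfolding missing_weight_def by (rule sum.swap)
  also have "\<dots> \<le> (\<Sum>p | prime p \<and> p < Y. 6 * real N / s)"
  proof (rule sum_mono)
    fix p assume "p \<in> {p. prime p \<and> p < Y}"
    hence p: "prime p" "p < Y" by auto
    have p0: "real p > 0" using p prime_gt_0_nat by auto
    have "(\<Sum>n=1..N. if p dvd totient n then 0 else 2 / (real p + 1)) = (\<Sum>n=1..N. if \<not> p dvd totient n then 2 / (real p + 1) else 0)"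
      by (intro sum.cong) auto
    also have "\<dots> = real (card {n \<in> {1..N}. \<not> p dvd totient n}) * (2 / (real p + 1))"
      by (subst sum.inter_filter[symmetric]) auto
    also have "\<dots> \<le> (3 * real N * real p / s) * (2 / (real p + 1))" by (intro mult_right_mono c p) auto
    also have "\<dots> \<le> (3 * real N * real p / s) * (2 / real p)" 
      using p0 s by (intro mult_left_mono divide_left_mono) auto
    also have "\<dots> = 6 * real N / s" using p0 by simp
    finally show "(\<Sum>n=1..N. if p dvd totient n then 0 else 2 / (real p + 1)) \<le> 6 * real N / s" .
  qed
  also have "\<dots> = real (card {p. prime p \<and> p < Y}) * (6 * real N / s)" by simp
  also have "\<dots> \<le> real Y * (6 * real N / s)"
  proof (intro mult_right_mono of_nat_mono)
    have "card {p. prime p \<and> p < Y} \<le> card {..<Y}" by (intro card_mono) auto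
    thus "card {p. prime p \<and> p < Y} \<le> Y" by simp
  qed (use s in auto)
  finally show ?thesis by (simp add: mult_ac)
qed

section \<open>Mean value of the contribution of the large primes\<close>

text \<open>Induction over the primes: the multiples of \<open>r\<close> are \<open>r * m\<close>
  with \<open>m \<le> N div r\<close>, which is why \<open>N\<close> is general in the induction. As
  \<open>b\<close> is nonnegative, replacing \<open>N div r\<close> by \<open>N / r\<close> is an
  upper bound with no error term to accumulate.\<close>

lemma sum_prod_prime_divisors_le:
  fixes b :: "nat \<Rightarrow> real"
  assumes "finite A" "\<And>q. q \<in> A \<Longrightarrow> prime q" "\<And>q. b q \<ge> 0"
  shows "(\<Sum>n=1..N. \<Prod>q\<in>A. if q dvd n then 1 + b q else 1) \<le> real N * (\<Prod>q\<in>A. 1 + b q / real q)"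
  using assms(1,2)
proof (induction A arbitrary: N rule: finite_induct)
  case (insert r A)
  define F where "F n = (\<Prod>q\<in>A. if q dvd n then 1 + b q else 1)" for n
  define P where "P = (\<Prod>q\<in>A. 1 + b q / real q)"
  have P0: "P \<ge> 0" unfolding P_def using assms(3) by (intro prod_nonneg) (auto intro!: add_nonneg_nonneg divide_nonneg_nonneg)
  have r: "prime r" "r > 0" using insert.prems prime_gt_0_nat by auto
  have IH: "(\<Sum>n=1..M. F n) \<le> real M * P" for M unfolding F_def P_def using insert by auto
  have Fr: "F (r * m) = F m" for m
    unfolding F_def
  proof (intro prod.cong refl)
    fix q assume "q \<in> A"
    hence "\<not> q dvd r" using insert primes_dvd_imp_eq r by blast
    hence "q dvd r * m \<longleftrightarrow> q dvd m" using insert.prems \<open>q \<in> A\<close> by (auto simp: prime_dvd_mult_iff)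
    thus "(if q dvd r * m then 1 + b q else 1) = (if q dvd m then 1 + b q else 1)" by simp
  qed
  have "(\<Sum>n=1..N. \<Prod>q\<in>insert r A. if q dvd n then 1 + b q else 1) = (\<Sum>n=1..N. F n + (if r dvd n then b r * F n else 0))"
    using insert.hyps by (intro sum.cong) (auto simp: F_def algebra_simps)
  also have "\<dots> = (\<Sum>n=1..N. F n) + (\<Sum>n | n \<in> {1..N} \<and> r dvd n. b r * F n)"
  proof -
    have "(\<Sum>n | n \<in> {1..N} \<and> r dvd n. b r * F n) = (\<Sum>n=1..N. if r dvd n then b r * F n else 0)"
      by (rule sum.inter_filter) simp
    thus ?thesis by (simp only: sum.distrib)
  qed
  also have "{n. n \<in> {1..N} \<and> r dvd n} = (\<lambda>m. r * m) ` {1..N div r}"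
    using r by (auto simp: less_eq_div_iff_mult_less_eq mult.commute elim!: dvdE)
  also have "(\<Sum>n\<in>(\<lambda>m. r * m) ` {1..N div r}. b r * F n) = b r * (\<Sum>m=1..N div r. F m)"
    using r by (subst sum.reindex) (auto simp: inj_on_def Fr sum_distrib_left)
  also have "(\<Sum>n=1..N. F n) + b r * (\<Sum>m=1..N div r. F m) \<le> real N * P + b r * (real (N div r) * P)"
    using assms(3) by (intro add_mono mult_left_mono IH) auto
  also have "\<dots> \<le> real N * P + b r * (real N / real r * P)"
    using assms(3) P0 by (intro add_left_mono mult_left_mono mult_right_mono of_nat_div_le_of_nat) auto
  also have "\<dots> = real N * ((1 + b r / real r) * P)" by (simp add: algebra_simps)
  finally show ?case using insert.hyps by (simp add: P_def)
qed auto

lemma cong_1_iff_dvd: "q \<ge> 1 \<Longrightarrow> [q = 1] (mod m) \<longleftrightarrow> m dvd q - 1" for q m :: nat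
  by (simp add: cong_altdef_nat)

text \<open>The factor \<open>1 + 2 / (r - 1)\<close> is \<open>(r + 1) / (r - 1)\<close>, the
  contribution of \<open>r\<close> to \<open>big_factor\<close>. Multiplying out over
  \<open>B\<close> leads to conditions modulo products of members of \<open>B\<close>; the parameter
  \<open>d\<close> records the modulus reached so far.\<close>

definition twisted_sum :: "nat \<Rightarrow> nat \<Rightarrow> nat set \<Rightarrow> real" where
  "twisted_sum N d B = (\<Sum>q | prime q \<and> [q = 1] (mod d) \<and> q \<le> N.
     (1 / real q) * (\<Prod>r\<in>B. if r dvd q - 1 then 1 + 2 / (real r - 1) else 1))"

lemma twisted_sum_insert:
  assumes "finite B" "r \<notin> B" "coprime d r"
  shows "twisted_sum N d (insert r B) = twisted_sum N d B + 2 / (real r - 1) * twisted_sum N (d * r) B"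
proof -
  define A where "A = {q. prime q \<and> [q = 1] (mod d) \<and> q \<le> N}"
  define f where "f q = (1 / real q) * (\<Prod>r\<in>B. if r dvd q - 1 then 1 + 2 / (real r - 1) else 1)" for q
  have fin: "finite A" unfolding A_def by (rule finite_subset[of _ "{..N}"]) auto
  have sub: "{q \<in> A. r dvd q - 1} = {q. prime q \<and> [q = 1] (mod (d * r)) \<and> q \<le> N}"
    unfolding A_def using assms(3) 
    by (auto simp: cong_1_iff_dvd[OF prime_ge_1_nat, simplified] intro: divides_mult dest: dvd_mult_left dvd_mult_right)
  have "twisted_sum N d (insert r B) = (\<Sum>q\<in>A. f q + (if r dvd q - 1 then 2 / (real r - 1) * f q else 0))"
    unfolding twisted_sum_def A_def[symmetric]
  proof (intro sum.cong refl)
    fix q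
    define c where "c = 2 / (real r - 1)"
    define P where "P = (\<Prod>r\<in>B. if r dvd q - 1 then 1 + 2 / (real r - 1) else 1)"
    show "1 / real q * (\<Prod>r\<in>insert r B. if r dvd q - 1 then 1 + 2 / (real r - 1) else 1) =
        f q + (if r dvd q - 1 then 2 / (real r - 1) * f q else 0)"
      unfolding f_def prod.insert[OF assms(1,2)] P_def[symmetric] c_def[symmetric] by (simp add: algebra_simps add_divide_distrib)
  qed
  also have "\<dots> = (\<Sum>q\<in>A. f q) + (\<Sum>q\<in>{q \<in> A. r dvd q - 1}. 2 / (real r - 1) * f q)"
    by (simp only: sum.distrib sum.inter_filter[OF fin])
  finally show ?thesis unfolding sub by (simp add: twisted_sum_def f_def A_def sum_distrib_left)
qed

lemma inv_prime_sum_le: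
  assumes "d \<ge> 2" "N \<le> 2 ^ J"
  shows "inv_prime_sum d N \<le> 9 * harm J * (ln (real d) / real d)"
proof -
  have "inv_prime_sum d N \<le> (\<Sum>q | prime q \<and> [q = 1] (mod d) \<and> q \<le> d * 2 ^ J. 1 / real q)"
    unfolding inv_prime_sum_def
  proof (rule sum_mono2)
    show "finite {q. prime q \<and> [q = 1] (mod d) \<and> q \<le> d * 2 ^ J}"
      by (rule finite_subset[of _ "{..d * 2 ^ J}"]) auto
    have "1 * 2 ^ J \<le> d * 2 ^ J" using assms by (intro mult_right_mono) auto
    hence "N \<le> d * 2 ^ J" using assms by linarith
    thus "{q. prime q \<and> [q = 1] (mod d) \<and> q \<le> N} \<subseteq> {q. prime q \<and> [q = 1] (mod d) \<and> q \<le> d * 2 ^ J}"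
      by auto
  qed auto
  also have "\<dots> \<le> 9 * (ln (real d) / real d) * harm J" by (rule sum_inverse_primes_mod_le[OF assms(1)])
  finally show ?thesis by (simp add: mult_ac)
qed

lemma ln_ge_2: "x \<ge> 8 \<Longrightarrow> ln x \<ge> (2::real)"
proof -
  assume "x \<ge> 8"
  hence "ln (2 ^ 3) \<le> ln x" by (intro ln_mono) auto
  also have "ln (2 ^ 3 :: real) = 3 * ln 2" by (subst ln_realpow) auto
  finally show ?thesis using ln2_ge_two_thirds by linarith
qed

text \<open>Submultiplicativity of \<open>ln d / d\<close>, valid because both logarithms are at
  least 2. It turns the bound for a composite modulus into a product over its primes and is the
  origin of the threshold 8.\<close>

lemma ln_mult_div_le:
  assumes "d \<ge> 8" "r \<ge> (8::real)"
  shows "ln (d * r) / (d * r) \<le> (ln d / d) * (ln r / r)"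
proof -
  have "ln d \<ge> 2" "ln r \<ge> 2" using assms ln_ge_2 by auto
  moreover from this have "0 \<le> (ln d - 2) * (ln r - 2)" by (intro mult_nonneg_nonneg) auto
  ultimately have "0 \<le> (ln d - 2) * (ln r - 2) + (ln d - 2) + (ln r - 2)" by linarith
  hence "ln d + ln r \<le> ln d * ln r" by (simp add: algebra_simps)
  hence "ln (d * r) \<le> ln d * ln r" using assms by (simp add: ln_mult_pos)
  hence "ln (d * r) / (d * r) \<le> (ln d * ln r) / (d * r)" using assms by (intro divide_right_mono) auto
  thus ?thesis by simp
qed

text \<open>Each \<open>r\<close> adds the sum to the modulus \<open>d * r\<close> with coefficient
  \<open>2 / (r - 1)\<close>, and by submultiplicativity this is at most
  \<open>2 * ln r / (r * (r - 1))\<close> times the bound for \<open>d\<close>.\<close>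

lemma twisted_sum_le:
  assumes "finite B" "\<And>r. r \<in> B \<Longrightarrow> prime r \<and> r \<ge> 8 \<and> coprime d r" "d \<ge> 8" "N \<le> 2 ^ J"
  shows "twisted_sum N d B \<le> 9 * harm J * (ln (real d) / real d) * (\<Prod>r\<in>B. 1 + 2 * ln (real r) / (real r * (real r - 1)))"
  using assms(1-3)
proof (induction B arbitrary: d rule: finite_induct)
  case empty
  thus ?case using inv_prime_sum_le[of d N J] assms(4) by (simp add: twisted_sum_def inv_prime_sum_def)
next
  case (insert r B)
  define P where "P = (\<Prod>r\<in>B. 1 + 2 * ln (real r) / (real r * (real r - 1)))"
  define C where "C = (9 * harm J :: real)"
  have C: "C \<ge> 0" by (simp add: C_def harm_nonneg)
  have P: "P \<ge> 0" unfolding P_def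
  proof (intro prod_nonneg)
    fix s assume "s \<in> B"
    hence "s \<ge> 8" using insert.prems by auto
    thus "0 \<le> 1 + 2 * ln (real s) / (real s * (real s - 1))" by (intro add_nonneg_nonneg divide_nonneg_nonneg) auto
  qed
  have r: "prime r" "r \<ge> 8" "coprime d r" using insert.prems by auto
  have 1: "twisted_sum N d B \<le> C * (ln (real d) / real d) * P"
    unfolding C_def P_def using insert by auto
  have 2: "twisted_sum N (d * r) B \<le> C * (ln (real (d * r)) / real (d * r)) * P"
    unfolding C_def P_def
  proof (rule insert.IH)
    fix s assume s: "s \<in> B"
    hence "coprime r s" using insert r by (intro primes_coprime) auto
    thus "prime s \<and> s \<ge> 8 \<and> coprime (d * r) s" using insert.prems s by simp
  next
    have "8 * 1 \<le> d * r" using insert.prems(2) r(2) by (intro mult_le_mono) auto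
    thus "8 \<le> d * r" by simp
  qed
  have "twisted_sum N d (insert r B) = twisted_sum N d B + 2 / (real r - 1) * twisted_sum N (d * r) B"
    by (rule twisted_sum_insert) (use insert r in auto)
  also have "\<dots> \<le> C * (ln (real d) / real d) * P + 2 / (real r - 1) * (C * ((ln (real d) / real d) * (ln (real r) / real r)) * P)"
  proof (intro add_mono 1 mult_left_mono)
    have "C * (ln (real (d * r)) / real (d * r)) * P \<le> C * ((ln (real d) / real d) * (ln (real r) / real r)) * P"
      using ln_mult_div_le[of "real d" "real r"] insert.prems r C P
      by (intro mult_right_mono mult_left_mono) auto
    with 2 show "twisted_sum N (d * r) B \<le> C * ((ln (real d) / real d) * (ln (real r) / real r)) * P" by linarith
  qed (use r in auto)
  also have "\<dots> = C * (ln (real d) / real d) * ((1 + 2 * ln (real r) / (real r * (real r - 1))) * P)"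
    by (simp add: algebra_simps)
  finally show ?case using insert.hyps by (simp add: P_def C_def)
qed

text \<open>The plain sum over all primes, by itself of the size of \<open>ln (ln N)\<close>, is
  subtracted. What remains involves only moduli divisible by some \<open>r\<close> in
  \<open>B\<close>, for which the factor \<open>ln d / d\<close> is small.\<close>

lemma twisted_sum_diff_le:
  assumes "finite B" "\<And>r. r \<in> B \<Longrightarrow> prime r \<and> r \<ge> 8" "N \<le> 2 ^ J"
  shows "twisted_sum N 1 B - twisted_sum N 1 {} \<le> 9 * harm J * ((\<Prod>r\<in>B. 1 + 2 * ln (real r) / (real r * (real r - 1))) - 1)"
  using assms(1,2)
proof (induction B rule: finite_induct)
  case (insert r B)
  define P where "P = (\<Prod>r\<in>B. 1 + 2 * ln (real r) / (real r * (real r - 1)))"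
  define C where "C = (9 * harm J :: real)"
  have r: "prime r" "r \<ge> 8" using insert.prems by auto
  have IH: "twisted_sum N 1 B - twisted_sum N 1 {} \<le> C * (P - 1)" unfolding C_def P_def using insert by auto
  have 2: "twisted_sum N r B \<le> C * (ln (real r) / real r) * P"
    unfolding C_def P_def
  proof (rule twisted_sum_le)
    fix s assume s: "s \<in> B"
    hence "coprime r s" using insert r by (intro primes_coprime) auto
    thus "prime s \<and> s \<ge> 8 \<and> coprime r s" using insert.prems s by simp
  qed (use insert r assms(3) in auto)
  have "twisted_sum N 1 (insert r B) = twisted_sum N 1 B + 2 / (real r - 1) * twisted_sum N (1 * r) B"
    by (rule twisted_sum_insert) (use insert in auto)
  also have "2 / (real r - 1) * twisted_sum N (1 * r) B \<le> 2 / (real r - 1) * (C * (ln (real r) / real r) * P)"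
    using 2 r by (intro mult_left_mono) auto
  finally have "twisted_sum N 1 (insert r B) - twisted_sum N 1 {} \<le> C * (P - 1) + 2 / (real r - 1) * (C * (ln (real r) / real r) * P)"
    using IH by linarith
  also have "\<dots> = C * ((1 + 2 * ln (real r) / (real r * (real r - 1))) * P - 1)" by (simp add: algebra_simps)
  finally show ?case using insert.hyps by (simp add: P_def C_def)
qed auto

text \<open>The primes counted are \<open>q\<close> itself, with the factor \<open>1 + a\<close>,
  and divisors of \<open>q - 1\<close>, with the product \<open>h\<close>. As
  \<open>a \<le> 1\<close> and \<open>h \<ge> 1\<close>, the excess \<open>(1 + a) * h - 1\<close>
  is at most \<open>a + 2 * (h - 1)\<close>, two terms that can be summed over \<open>q\<close>
  separately.\<close>

lemma big_factor_le:
  assumes q: "prime q" "q \<le> N" and Y: "Y \<ge> 8"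
  shows "big_factor Y q - 1 \<le> (if q \<ge> Y then 2 / (real q - 1) else 0) +
    2 * ((\<Prod>r | prime r \<and> Y \<le> r \<and> r \<le> N. if r dvd q - 1 then 1 + 2 / (real r - 1) else 1) - 1)"
proof -
  define f where "f r = (real r + 1) / (real r - 1)" for r :: nat
  define B where "B = {r. prime r \<and> Y \<le> r \<and> r \<le> N}"
  define a where "a = (if q \<ge> Y then 2 / (real q - 1) else 0)"
  define h where "h = (\<Prod>r\<in>B. if r dvd q - 1 then 1 + 2 / (real r - 1) else 1)"
  have f: "f r = 1 + 2 / (real r - 1)" if "prime r" for r
    using prime_gt_1_nat[OF that] by (simp add: f_def field_simps)
  have q1: "q > 1" using q prime_gt_1_nat by auto
  have finB: "finite B" unfolding B_def by (rule finite_subset[of _ "{..N}"]) auto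
  have "{r. r \<in> prime_factors (q * (q - 1)) \<and> r \<ge> Y} = {r \<in> {q}. r \<ge> Y} \<union> {r \<in> B. r dvd q - 1}"
  proof (intro equalityI subsetI)
    fix r assume "r \<in> {r. r \<in> prime_factors (q * (q - 1)) \<and> r \<ge> Y}"
    hence r: "prime r" "r dvd q * (q - 1)" "r \<ge> Y" by auto
    hence "r dvd q \<or> r dvd q - 1" by (simp add: prime_dvd_mult_iff)
    thus "r \<in> {r \<in> {q}. r \<ge> Y} \<union> {r \<in> B. r dvd q - 1}"
    proof
      assume "r dvd q"
      hence "r = q" using primes_dvd_imp_eq[OF r(1) q(1)] by simp
      thus ?thesis using r by simp
    next
      assume "r dvd q - 1"
      moreover from this have "r \<le> q - 1" using q1 by (intro dvd_imp_le) auto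
      moreover from this have "r \<le> N" using q by linarith
      ultimately show ?thesis using r by (simp add: B_def)
    qed
  next
    fix r assume r: "r \<in> {r \<in> {q}. r \<ge> Y} \<union> {r \<in> B. r dvd q - 1}"
    hence "prime r" "r dvd q * (q - 1)" using q by (auto simp: B_def)
    hence "r \<in> prime_factors (q * (q - 1))" using q1 by (intro prime_factorsI) auto
    thus "r \<in> {r. r \<in> prime_factors (q * (q - 1)) \<and> r \<ge> Y}" using r by (auto simp: B_def)
  qed
  hence "big_factor Y q = (\<Prod>r\<in>{r \<in> {q}. r \<ge> Y} \<union> {r \<in> B. r dvd q - 1}. f r)"
    by (simp add: big_factor_def f_def)
  also have "\<dots> = (\<Prod>r\<in>{r \<in> {q}. r \<ge> Y}. f r) * (\<Prod>r\<in>{r \<in> B. r dvd q - 1}. f r)"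
  proof (rule prod.union_disjoint)
    have "\<not> q dvd q - 1" using q1 by (auto dest: dvd_imp_le)
    thus "{r \<in> {q}. r \<ge> Y} \<inter> {r \<in> B. r dvd q - 1} = {}" by auto
  qed (use finB in auto)
  also have "(\<Prod>r\<in>{r \<in> {q}. r \<ge> Y}. f r) = 1 + a"
    using f[OF q(1)] by (subst prod.inter_filter) (auto simp: a_def)
  also have "(\<Prod>r\<in>{r \<in> B. r dvd q - 1}. f r) = h"
    unfolding h_def prod.inter_filter[OF finB] by (intro prod.cong refl) (auto simp: B_def f)
  finally have eq: "big_factor Y q = (1 + a) * h" .
  have "h \<ge> 1" unfolding h_def
  proof (intro prod_ge_1)
    fix r assume "r \<in> B"
    hence "real r > 1" using prime_gt_1_nat by (auto simp: B_def)
    thus "1 \<le> (if r dvd q - 1 then 1 + 2 / (real r - 1) else 1)" by simp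
  qed
  moreover have "a \<le> 1" using Y by (auto simp: a_def)
  ultimately have "a * (h - 1) \<le> 1 * (h - 1)" by (intro mult_right_mono) auto
  hence "(1 + a) * h - 1 \<le> a + 2 * (h - 1)" by (simp add: algebra_simps)
  thus ?thesis by (simp add: eq a_def h_def B_def)
qed

text \<open>\<open>X\<close> bounds the sum of \<open>2 * ln r / (r * (r - 1))\<close> over
  \<open>r \<ge> Y\<close>. It enters once for the primes \<open>q \<ge> Y\<close> themselves and
  once, through \<open>exp X - 1\<close>, for the prime factors of \<open>q - 1\<close>. With
  \<open>J\<close> of order \<open>ln N\<close>, the exponent is small as soon as
  \<open>Y / ln Y\<close> is large against \<open>ln (ln N)\<close>.\<close>

lemma sum_prod_big_factor_le:
  fixes N Y J :: nat
  assumes Y: "Y \<ge> 8" and J: "N \<le> 2 ^ J"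
  defines "X \<equiv> 2 * (ln (real Y - 1) + 2) / (real Y - 1)"
  shows "(\<Sum>n=1..N. \<Prod>q\<in>prime_factors n. big_factor Y q) \<le> real N * exp (X + 18 * harm J * (exp X - 1))"
proof -
  define A where "A = {q. prime q \<and> q \<le> N}"
  define B where "B = {r. prime r \<and> Y \<le> r \<and> r \<le> N}"
  define b where "b q = big_factor Y q - 1" for q
  define x where "x r = 2 * (ln (real r) / (real r * (real r - 1)))" for r :: nat
  have fin: "finite A" "finite B" unfolding A_def B_def by (rule finite_subset[of _ "{..N}"], auto)+
  have b0: "b q \<ge> 0" for q using big_factor_ge_1[of Y q] by (simp add: b_def)
  have xX: "(\<Sum>r\<in>B. x r) \<le> X"
  proof -
    \<comment> \<open>The lower limit \<open>Y - 1 + 1\<close> is the form of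
      \<open>sum_ln_div_square_le\<close> with \<open>m = Y - 1\<close>.\<close>
    have "(\<Sum>r\<in>B. x r) \<le> (\<Sum>r=Y-1+1..N. x r)"
      using Y by (intro sum_mono2) (auto simp: B_def x_def)
    also have "\<dots> = 2 * (\<Sum>r=Y-1+1..N. ln (real r) / (real r * (real r - 1)))"
      by (simp add: x_def sum_distrib_left)
    also have "\<dots> \<le> 2 * ((ln (real (Y - 1)) + 2) / real (Y - 1))"
      using Y by (intro mult_left_mono sum_ln_div_square_le) auto
    finally show ?thesis using Y by (simp add: X_def of_nat_diff)
  qed
  have x0: "x r \<ge> 0" if "r \<in> B" for r using that Y by (auto simp: B_def x_def)
  have "(\<Sum>q\<in>A. b q / real q) \<le> X + 2 * (9 * harm J * (exp X - 1))"
  proof -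
    define h where "h q = (\<Prod>r\<in>B. if r dvd q - 1 then 1 + 2 / (real r - 1) else 1)" for q
    define a where "a q = (if q \<ge> Y then 2 / (real q - 1) else 0)" for q
    have "(\<Sum>q\<in>A. b q / real q) \<le> (\<Sum>q\<in>A. a q / real q + 2 * ((1 / real q) * h q - (1 / real q)))"
    proof (rule sum_mono)
      fix q assume "q \<in> A"
      hence q: "prime q" "q \<le> N" by (auto simp: A_def)
      have "b q \<le> a q + 2 * (h q - 1)" 
        using big_factor_le[OF q Y] by (simp add: b_def a_def h_def B_def)
      hence "b q / real q \<le> (a q + 2 * (h q - 1)) / real q" by (intro divide_right_mono) auto
      thus "b q / real q \<le> a q / real q + 2 * ((1 / real q) * h q - (1 / real q))"
        by (simp add: add_divide_distrib diff_divide_distrib algebra_simps)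
    qed
    also have "\<dots> = (\<Sum>q\<in>A. a q / real q) + 2 * ((\<Sum>q\<in>A. (1 / real q) * h q) - (\<Sum>q\<in>A. 1 / real q))"
      by (simp only: sum.distrib sum_distrib_left[symmetric] sum_subtractf)
    also have "(\<Sum>q\<in>A. (1 / real q) * h q) = twisted_sum N 1 B"
      by (simp add: twisted_sum_def A_def h_def)
    also have "(\<Sum>q\<in>A. 1 / real q) = twisted_sum N 1 {}"
      by (simp add: twisted_sum_def A_def)
    also have "twisted_sum N 1 B - twisted_sum N 1 {} \<le> 9 * harm J * ((\<Prod>r\<in>B. 1 + 2 * ln (real r) / (real r * (real r - 1))) - 1)"
      by (rule twisted_sum_diff_le[OF fin(2) _ J]) (use Y in \<open>auto simp: B_def\<close>)
    also have "(\<Prod>r\<in>B. 1 + 2 * ln (real r) / (real r * (real r - 1))) \<le> exp X"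
    proof -
      have "(\<Prod>r\<in>B. 1 + 2 * ln (real r) / (real r * (real r - 1))) \<le> (\<Prod>r\<in>B. exp (x r))"
        using x0 exp_ge_add_one_self by (intro prod_mono) (auto simp: x_def add_nonneg_nonneg)
      also have "\<dots> = exp (\<Sum>r\<in>B. x r)" using fin by (simp add: exp_sum)
      also have "\<dots> \<le> exp X" using xX by simp
      finally show ?thesis .
    qed
    also have "(\<Sum>q\<in>A. a q / real q) \<le> X"
    proof -
      have "(\<Sum>q\<in>A. a q / real q) = (\<Sum>q\<in>B. a q / real q)"
        using fin by (intro sum.mono_neutral_right) (auto simp: A_def B_def a_def)
      also have "\<dots> \<le> (\<Sum>q\<in>B. x q)"
      proof (rule sum_mono)
        fix q assume "q \<in> B"
        hence q: "q \<ge> Y" by (simp add: B_def)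
        hence "ln (real q) \<ge> 1" using ln_ge_2[of "real q"] Y by simp
        hence "2 * 1 / (real q * (real q - 1)) \<le> 2 * ln (real q) / (real q * (real q - 1))"
          using q Y by (intro divide_right_mono mult_left_mono) auto
        thus "a q / real q \<le> x q" using q by (simp add: a_def x_def mult.commute)
      qed
      finally show ?thesis using xX by linarith
    qed
    finally show ?thesis by (simp add: harm_nonneg mult_left_mono)
  qed
  hence sb: "(\<Sum>q\<in>A. b q / real q) \<le> X + 18 * harm J * (exp X - 1)" by simp
  have "(\<Sum>n=1..N. \<Prod>q\<in>prime_factors n. big_factor Y q) = (\<Sum>n=1..N. \<Prod>q\<in>A. if q dvd n then 1 + b q else 1)"
  proof (intro sum.cong refl)
    fix n assume n: "n \<in> {1..N}"
    have "prime_factors n = {q \<in> A. q dvd n}"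
      using n by (auto simp: A_def prime_factors_dvd intro: order.trans[OF dvd_imp_le])
    thus "(\<Prod>q\<in>prime_factors n. big_factor Y q) = (\<Prod>q\<in>A. if q dvd n then 1 + b q else 1)"
      unfolding b_def by (simp add: prod.inter_filter[OF fin(1)] cong: if_cong)
  qed
  also have "\<dots> \<le> real N * (\<Prod>q\<in>A. 1 + b q / real q)"
    by (rule sum_prod_prime_divisors_le[OF fin(1) _ b0]) (simp add: A_def)
  also have "(\<Prod>q\<in>A. 1 + b q / real q) \<le> (\<Prod>q\<in>A. exp (b q / real q))"
    using b0 exp_ge_add_one_self by (intro prod_mono) (auto intro!: add_nonneg_nonneg divide_nonneg_nonneg)
  also have "\<dots> = exp (\<Sum>q\<in>A. b q / real q)" using fin by (simp add: exp_sum)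
  also have "\<dots> \<le> exp (X + 18 * harm J * (exp X - 1))" using sb by simp
  finally show ?thesis by (simp add: mult_left_mono)
qed

section \<open>Mean value and normal order\<close>

definition mean_const :: real where
  "mean_const = 6 / pi\<^sup>2 * exp (2 * euler_mascheroni)"

lemma mean_const_pos: "mean_const > 0"
  by (simp add: mean_const_def)

text \<open>Moving \<open>ln Y\<close> by \<open>sqrt t\<close> away from \<open>t\<close> changes
  its square by order \<open>t * sqrt t\<close>: this is the error term of the theorem. The summand
  1 leaves room for rounding \<open>Y\<close> to an integer.\<close>

lemma prime_ratio_prod_near:
  obtains C where "C \<ge> 0" "\<And>Y t. t \<ge> 4 \<Longrightarrow> Y \<ge> 2 \<Longrightarrow> \<bar>ln (real Y) - t\<bar> \<le> sqrt t + 1 \<Longrightarrow>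
    \<bar>prime_ratio_prod Y - mean_const * t\<^sup>2\<bar> \<le> C * (t * sqrt t)"
proof -
  obtain C0 where C0: "\<And>N. N \<ge> 2 \<Longrightarrow> \<bar>prime_ratio_prod N - mean_const * (ln (real N))\<^sup>2\<bar> \<le> C0 * ln (real N)"
    using prime_ratio_prod_asymp unfolding mean_const_def by blast
  show ?thesis
  proof (rule that[of "8 * mean_const + 3 * \<bar>C0\<bar>"])
    show "8 * mean_const + 3 * \<bar>C0\<bar> \<ge> 0" using mean_const_pos by simp
    fix Y :: nat and t :: real
    assume t: "t \<ge> 4" and Y: "Y \<ge> 2" and d: "\<bar>ln (real Y) - t\<bar> \<le> sqrt t + 1"
    define l where "l = ln (real Y)"
    define s where "s = sqrt t"
    have s: "s \<ge> 2" unfolding s_def using real_sqrt_le_mono[OF t] by simp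
    have st: "s * s = t" using t by (simp add: s_def)
    have "2 * s \<le> s * s" using s by (intro mult_right_mono) auto
    hence s2: "2 * s \<le> t" by (simp add: st)
    have l0: "l \<ge> 0" using Y by (simp add: l_def)
    have d': "\<bar>l - t\<bar> \<le> 2 * s" using d s by (simp add: l_def s_def)
    have sum: "\<bar>l + t\<bar> \<le> 3 * t" using d' s2 l0 by linarith
    have lt: "l \<le> 2 * t" using d' s2 by linarith
    have "\<bar>l\<^sup>2 - t\<^sup>2\<bar> = \<bar>l - t\<bar> * \<bar>l + t\<bar>" by (simp add: power2_eq_square square_diff_square_factored abs_mult mult.commute)
    also have "\<dots> \<le> (2 * s) * (3 * t)" using d' sum s by (intro mult_mono) auto
    also have "\<dots> = 6 * (t * s)" by simp
    also have "\<dots> \<le> 8 * (t * s)" using s t by (intro mult_right_mono) auto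
    finally have sq: "\<bar>l\<^sup>2 - t\<^sup>2\<bar> \<le> 8 * (t * s)" .
    have "\<bar>prime_ratio_prod Y - mean_const * l\<^sup>2\<bar> \<le> \<bar>C0\<bar> * l"
      using C0[OF Y] mult_right_mono[OF abs_ge_self[of C0] l0] unfolding l_def[symmetric] by linarith
    also have "\<dots> \<le> \<bar>C0\<bar> * (3 * (t * s))"
    proof (rule mult_left_mono)
      have "t * 2 \<le> t * s" using s t by (intro mult_left_mono) auto
      thus "l \<le> 3 * (t * s)" using lt t by linarith
    qed simp
    finally have 1: "\<bar>prime_ratio_prod Y - mean_const * l\<^sup>2\<bar> \<le> \<bar>C0\<bar> * (3 * (t * s))" .
    have "\<bar>mean_const * l\<^sup>2 - mean_const * t\<^sup>2\<bar> = mean_const * \<bar>l\<^sup>2 - t\<^sup>2\<bar>"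
      using mean_const_pos by (simp add: abs_mult flip: right_diff_distrib)
    also have "\<dots> \<le> mean_const * (8 * (t * s))" using sq mean_const_pos by (intro mult_left_mono) auto
    finally have "\<bar>prime_ratio_prod Y - mean_const * t\<^sup>2\<bar> \<le> \<bar>C0\<bar> * (3 * (t * s)) + mean_const * (8 * (t * s))"
      using 1 by linarith
    thus "\<bar>prime_ratio_prod Y - mean_const * t\<^sup>2\<bar> \<le> (8 * mean_const + 3 * \<bar>C0\<bar>) * (t * sqrt t)"
      by (simp add: s_def algebra_simps)
  qed
qed

text \<open>\<open>K n\<close> is at most \<open>M2 * h n\<close> and at least
  \<open>M1 * (1 - missing_weight Y1 n)\<close>. The deviations on both sides are added instead of
  distinguished by sign, which is possible as all of them are nonnegative.\<close>

lemma sum_abs_diff_le: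
  assumes "N \<le> 2 ^ J" "Y2 \<ge> 8" "s > 0" "\<And>p. prime p \<Longrightarrow> p < Y1 \<Longrightarrow> inv_prime_sum p N \<ge> s / real p"
  defines "X \<equiv> 2 * (ln (real Y2 - 1) + 2) / (real Y2 - 1)"
  shows "(\<Sum>n=1..N. \<bar>K n - T\<bar>) \<le> real N * (\<bar>prime_ratio_prod Y2 - T\<bar> + \<bar>prime_ratio_prod Y1 - T\<bar> +
     prime_ratio_prod Y2 * (exp (X + 18 * harm J * (exp X - 1)) - 1) + prime_ratio_prod Y1 * (6 * real Y1 / s))"
proof -
  define M1 M2 where "M1 = prime_ratio_prod Y1" and "M2 = prime_ratio_prod Y2"
  define h where "h n = (\<Prod>q\<in>prime_factors n. big_factor Y2 q)" for n
  have h1: "h n \<ge> 1" for n unfolding h_def by (intro prod_ge_1 big_factor_ge_1)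
  have M: "M1 \<ge> 1" "M2 \<ge> 1" by (simp_all add: M1_def M2_def prime_ratio_prod_ge_1)
  have "(\<Sum>n=1..N. \<bar>K n - T\<bar>) \<le> (\<Sum>n=1..N. (\<bar>M2 - T\<bar> + \<bar>M1 - T\<bar>) + M2 * (h n - 1) + M1 * missing_weight Y1 n)"
  proof (rule sum_mono)
    fix n assume "n \<in> {1..N}"
    hence n: "n > 0" by simp
    have "K n \<le> M2 * h n" using K_le[OF n, of Y2] by (simp add: M2_def h_def)
    moreover have "K n \<ge> M1 * (1 - missing_weight Y1 n)" using K_ge[OF n, of Y1] by (simp add: M1_def)
    moreover have "M2 * (h n - 1) \<ge> 0" "M1 * missing_weight Y1 n \<ge> 0"
      using M h1 missing_weight_nonneg by (auto intro!: mult_nonneg_nonneg)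
    ultimately show "\<bar>K n - T\<bar> \<le> (\<bar>M2 - T\<bar> + \<bar>M1 - T\<bar>) + M2 * (h n - 1) + M1 * missing_weight Y1 n"
      by (simp add: algebra_simps abs_if split: if_splits)
  qed
  also have "\<dots> = real N * (\<bar>M2 - T\<bar> + \<bar>M1 - T\<bar>) + M2 * ((\<Sum>n=1..N. h n) - real N) + M1 * (\<Sum>n=1..N. missing_weight Y1 n)"
    by (simp add: sum.distrib sum_distrib_left[symmetric] sum_subtractf)
  also have "\<dots> \<le> real N * (\<bar>M2 - T\<bar> + \<bar>M1 - T\<bar>) + M2 * (real N * exp (X + 18 * harm J * (exp X - 1)) - real N) + M1 * (6 * real N * real Y1 / s)"
    using sum_prod_big_factor_le[OF assms(2,1)] sum_missing_weight_le[where Y = Y1 and N = N and s = s] assms M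
    by (intro add_mono mult_left_mono diff_mono) (auto simp: h_def X_def)
  also have "\<dots> = real N * (\<bar>M2 - T\<bar> + \<bar>M1 - T\<bar> + M2 * (exp (X + 18 * harm J * (exp X - 1)) - 1) + M1 * (6 * real Y1 / s))"
    by (simp add: algebra_simps)
  finally show ?thesis by (simp add: M1_def M2_def)
qed

lemma filterlim_log3: "filterlim log3 at_top at_top"
  unfolding log3_def by real_asymp

text \<open>The loss \<open>(4 * p + 6) * ln (2 * p)\<close> is at most
  \<open>7 * exp (t - sqrt t) * (t + 1)\<close>, hence at most \<open>lam / 2\<close>. From
  \<open>ln (ln N) \<ge> lam - 1 \<ge> 3 / 4 * lam\<close> there remains \<open>lam / 4\<close>, and
  division by \<open>2 * p\<close> produces the 8.\<close>

lemma inv_prime_sum_ge_main: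
  fixes t lam :: real
  assumes p: "prime p" "real p \<le> exp (t - sqrt t)" and lam: "lam = exp t" "lam \<ge> 4"
    and N: "ln (real N) \<ge> exp (lam - 1)" and t: "7 * exp (t - sqrt t) * (t + 1) \<le> exp t / 2" "t \<ge> 0"
  shows "inv_prime_sum p N \<ge> (lam / 8) / real p"
proof -
  have p2: "real p \<ge> 2" using prime_ge_2_nat[OF p(1)] by simp
  have "ln (2 * real p) = ln 2 + ln (real p)" using p2 by (simp add: ln_mult_pos)
  also have "ln (real p) \<le> ln (exp (t - sqrt t))" using p p2 by (intro ln_mono) auto
  finally have lp: "ln (2 * real p) \<le> t + 1" using ln2_le_25_over_36 real_sqrt_ge_zero[OF t(2)] unfolding ln_exp by linarith
  have "(4 * real p + 6) * ln (2 * real p) \<le> (7 * exp (t - sqrt t)) * (t + 1)"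
    using p p2 lp by (intro mult_mono) auto
  hence E: "(4 * real p + 6) * ln (2 * real p) \<le> lam / 2" using t lam by simp
  have "(2 * real p) ^ (4 * p + 5) + 1 < (2 * real p) ^ (4 * p + 6)"
  proof -
    define y where "y = (2 * real p) ^ (4 * p + 5)"
    have "y \<ge> 1" unfolding y_def using p2 by (intro one_le_power) auto
    hence "4 * y \<le> 2 * real p * y" using p2 by (intro mult_right_mono) auto
    moreover have "4 * p + 6 = Suc (4 * p + 5)" by simp
    hence "(2 * real p) ^ (4 * p + 6) = 2 * real p * y" unfolding y_def by (metis power_Suc)
    ultimately show ?thesis using \<open>y \<ge> 1\<close> unfolding y_def[symmetric] by linarith
  qed
  also have "(2 * real p) ^ (4 * p + 6) = exp ((4 * real p + 6) * ln (2 * real p))"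
  proof -
    have "(2 * real p) ^ (4 * p + 6) = exp (ln ((2 * real p) ^ (4 * p + 6)))" using p2 by simp
    also have "ln ((2 * real p) ^ (4 * p + 6)) = (4 * real p + 6) * ln (2 * real p)" by (subst ln_realpow) auto
    finally show ?thesis .
  qed
  also have "\<dots> \<le> exp (lam - 1)" using E lam by simp
  finally have NN: "ln (real N) > (2 * real p) ^ (4 * p + 5) + 1" using N by linarith
  have "ln (ln (real N)) \<ge> ln (exp (lam - 1))" using N by (intro ln_mono) auto
  hence "lam / 4 \<le> ln (ln (real N)) - (4 * real p + 6) * ln (2 * real p)" using E lam(2) by simp
  hence "(lam / 4) / (2 * real p) \<le> (ln (ln (real N)) - (4 * real p + 6) * ln (2 * real p)) / (2 * real p)"
    using p2 by (intro divide_right_mono) auto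
  also have "\<dots> \<le> inv_prime_sum p N" by (rule inv_prime_sum_ge[OF p(1) NN])
  finally show ?thesis by simp
qed

text \<open>All parameters are chosen as functions of \<open>t = log3 x\<close>, so that most of the
  inequalities on them are asymptotic facts about \<open>t\<close>, carried over along
  \<open>log3\<close>.\<close>

theorem mean_abs_deviation:
  "\<exists>C. \<forall>\<^sub>F x::real in at_top. (\<Sum>n=1..nat \<lfloor>x\<rfloor>. \<bar>K n - mean_const * (log3 x)\<^sup>2\<bar>) \<le> C * x * (log3 x powr (3/2))"
proof -
  obtain C where C: "C \<ge> 0" "\<And>Y t. t \<ge> 4 \<Longrightarrow> Y \<ge> 2 \<Longrightarrow> \<bar>ln (real Y) - t\<bar> \<le> sqrt t + 1 \<Longrightarrow>
    \<bar>prime_ratio_prod Y - mean_const * t\<^sup>2\<bar> \<le> C * (t * sqrt t)"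
    by (rule prime_ratio_prod_near) blast
  \<comment> \<open>An upper bound for \<open>X\<close> at
    \<open>Y2 = nat \<lceil>exp (t + sqrt t)\<rceil>\<close>:
    \<open>ln Y2 \<le> t + sqrt t + 1\<close>, and \<open>Y2 - 1\<close> is at least half of
    \<open>exp (t + sqrt t)\<close>.\<close>
  define X0 where "X0 t = 4 * (t + sqrt t + 3) / exp (t + sqrt t)" for t :: real
  define D where "D = mean_const + C"
  have e1: "\<forall>\<^sub>F t::real in at_top. t \<ge> 4" by (rule eventually_ge_at_top)
  have e2: "\<forall>\<^sub>F t::real in at_top. 7 * exp (t - sqrt t) * (t + 1) \<le> exp t / 2" by real_asymp
  \<comment> \<open>\<open>exp t * X0 t\<close> is of order \<open>t * exp (- sqrt t)\<close>, so
    the exponent tends to 0 faster than \<open>1 / sqrt t\<close>, the relative error that the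
    theorem allows.\<close>
  have e3: "\<forall>\<^sub>F t::real in at_top. exp (X0 t + 18 * (exp t + 3) * (exp (X0 t) - 1)) - 1 \<le> 1 / sqrt t"
    unfolding X0_def by real_asymp
  have e4: "\<forall>\<^sub>F t::real in at_top. 48 * exp (- sqrt t) \<le> 1 / sqrt t" by real_asymp
  have e5: "\<forall>\<^sub>F t::real in at_top. exp (t - sqrt t) \<ge> 4" by real_asymp
  have e6: "\<forall>\<^sub>F t::real in at_top. exp (t + sqrt t) \<ge> 10" by real_asymp
  have e7: "\<forall>\<^sub>F x::real in at_top. ln (ln (x - 1)) \<ge> ln (ln x) - 1" by real_asymp
  have e8: "\<forall>\<^sub>F x::real in at_top. ln x \<ge> 1" by real_asymp
  have e9: "\<forall>\<^sub>F x::real in at_top. ln (x - 1) \<ge> 1" by real_asymp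
  have "\<forall>\<^sub>F t::real in at_top. t \<ge> 4 \<and> 7 * exp (t - sqrt t) * (t + 1) \<le> exp t / 2 \<and>
     exp (X0 t + 18 * (exp t + 3) * (exp (X0 t) - 1)) - 1 \<le> 1 / sqrt t \<and> 48 * exp (- sqrt t) \<le> 1 / sqrt t \<and>
     exp (t - sqrt t) \<ge> 4 \<and> exp (t + sqrt t) \<ge> 10"
    using e1 e2 e3 e4 e5 e6 by eventually_elim auto
  from eventually_compose_filterlim[OF this filterlim_log3]
  have ev: "\<forall>\<^sub>F x::real in at_top. log3 x \<ge> 4 \<and> 7 * exp (log3 x - sqrt (log3 x)) * (log3 x + 1) \<le> exp (log3 x) / 2 \<and>
     exp (X0 (log3 x) + 18 * (exp (log3 x) + 3) * (exp (X0 (log3 x)) - 1)) - 1 \<le> 1 / sqrt (log3 x) \<and> 48 * exp (- sqrt (log3 x)) \<le> 1 / sqrt (log3 x) \<and>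
     exp (log3 x - sqrt (log3 x)) \<ge> 4 \<and> exp (log3 x + sqrt (log3 x)) \<ge> 10" .
  show ?thesis
  proof (intro exI[of _ "2 * C + 2 * D"], use ev e7 e8 e9 eventually_ge_at_top[of "3::real"] in eventually_elim)
    case (elim x)
    define t where "t = log3 x"
    define s where "s = sqrt t"
    define lam where "lam = ln (ln x)"
    define N where "N = nat \<lfloor>x\<rfloor>"
    define T where "T = mean_const * t\<^sup>2"
    have t4: "t \<ge> 4" using elim by (simp add: t_def)
    have st: "s * s = t" using t4 by (simp add: s_def)
    have s2: "s \<ge> 2" unfolding s_def using real_sqrt_le_mono[OF t4] by simp
    have lnx: "ln x \<ge> 1" and x3: "x \<ge> 3" using elim by auto
    have lam0: "lam > 0"
    proof (rule ccontr)
      assume "\<not> lam > 0"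
      hence "lam = 0" using lnx by (simp add: lam_def)
      hence "t = 0" by (simp add: t_def log3_def lam_def)
      thus False using t4 by simp
    qed
    have lam: "lam = exp t" using lam0 by (simp add: t_def log3_def lam_def)
    have lam4: "lam \<ge> 4" using exp_ge_add_one_self[of t] t4 lam by linarith
    have Nx: "real N \<le> x" "x - 1 \<le> real N" using x3 unfolding N_def by linarith+
    have lnN: "ln (real N) \<ge> exp (lam - 1)"
    proof -
      have "lam - 1 \<le> ln (ln (x - 1))" using elim by (simp add: lam_def)
      hence "exp (lam - 1) \<le> exp (ln (ln (x - 1)))" by (simp only: exp_le_cancel_iff)
      also have "\<dots> = ln (x - 1)" using elim by simp
      also have "\<dots> \<le> ln (real N)" using Nx x3 by (intro ln_mono) auto
      finally show ?thesis .
    qed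
    define Y1 where "Y1 = nat \<lfloor>exp (t - s)\<rfloor>"
    define Y2 where "Y2 = nat \<lceil>exp (t + s)\<rceil>"
    have x1: "exp (t - s) \<ge> 4" and x2: "exp (t + s) \<ge> 10" using elim by (auto simp: t_def s_def)
    have Y1: "real Y1 \<le> exp (t - s)" "real Y1 \<ge> exp (t - s) - 1" "Y1 \<ge> 2" unfolding Y1_def using x1 by linarith+
    have Y2: "real Y2 \<ge> exp (t + s)" "real Y2 \<le> exp (t + s) + 1" "Y2 \<ge> 8" unfolding Y2_def using x2 by linarith+
    have ln2: "ln (2::real) \<le> 1" using ln2_le_25_over_36 by simp
    have l1: "\<bar>ln (real Y1) - t\<bar> \<le> s + 1"
    proof -
      have "ln (real Y1) \<le> ln (exp (t - s))" using Y1 by (intro ln_mono) auto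
      moreover have "exp (t - s) / 2 \<le> real Y1" using Y1 x1 by linarith
      hence "ln (exp (t - s) / 2) \<le> ln (real Y1)" by (intro ln_mono) auto
      hence "t - s - ln 2 \<le> ln (real Y1)" by (simp add: ln_divide_pos)
      ultimately show ?thesis using s2 ln2 by simp
    qed
    have l2u: "ln (real Y2) \<le> t + s + 1"
    proof -
      have "real Y2 \<le> exp (t + s) * 2" using Y2 x2 by linarith
      hence "ln (real Y2) \<le> ln (exp (t + s) * 2)" using Y2 by (intro ln_mono) auto
      also have "\<dots> = t + s + ln 2" by (simp add: ln_mult_pos)
      finally show ?thesis using ln2 by simp
    qed
    have l2: "\<bar>ln (real Y2) - t\<bar> \<le> s + 1"
    proof -
      have "ln (exp (t + s)) \<le> ln (real Y2)" using Y2 by (intro ln_mono) auto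
      thus ?thesis using l2u s2 by simp
    qed
    have M1: "\<bar>prime_ratio_prod Y1 - T\<bar> \<le> C * (t * s)"
      unfolding T_def s_def by (rule C(2)) (use t4 Y1 l1 in \<open>auto simp: s_def\<close>)
    have M2: "\<bar>prime_ratio_prod Y2 - T\<bar> \<le> C * (t * s)"
      unfolding T_def s_def by (rule C(2)) (use t4 Y2 l2 in \<open>auto simp: s_def\<close>)
    have "t * s \<le> t\<^sup>2"
    proof -
      have "s * 1 \<le> s * s" using s2 by (intro mult_left_mono) auto
      thus ?thesis using t4 st by (simp add: power2_eq_square mult_left_mono)
    qed
    hence "C * (t * s) \<le> C * t\<^sup>2" using C by (intro mult_left_mono) auto
    hence Mb: "prime_ratio_prod Y1 \<le> D * t\<^sup>2" "prime_ratio_prod Y2 \<le> D * t\<^sup>2"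
      using M1 M2 by (auto simp: D_def T_def algebra_simps)
    \<comment> \<open>\<open>2 * ln 2 \<ge> 1\<close>, so \<open>2 ^ J \<ge> x\<close>; the surplus
      costs only a bounded amount in \<open>harm J\<close>.\<close>
    define J where "J = nat \<lceil>2 * ln x\<rceil>"
    have J: "real J \<ge> 2 * ln x" "real J \<le> 2 * ln x + 1" "J \<ge> 1" unfolding J_def using lnx by linarith+
    have NJ: "N \<le> 2 ^ J"
    proof -
      have "ln x \<le> ln 2 * (2 * ln x)" using ln2_ge_two_thirds mult_right_mono[of "1/2" "ln 2" "2 * ln x"] lnx by simp
      also have "\<dots> \<le> ln 2 * real J" using J by (intro mult_left_mono) auto
      also have "\<dots> = ln (2 ^ J)" by (simp add: ln_realpow)
      finally have "x \<le> 2 ^ J" using x3 by (subst (asm) ln_le_cancel_iff) auto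
      hence "real N \<le> 2 ^ J" using Nx(1) by linarith
      hence "real N \<le> real (2 ^ J)" by (simp only: of_nat_power of_nat_numeral)
      thus ?thesis by (simp only: of_nat_le_iff)
    qed
    have hJ: "harm J \<le> exp t + 3"
    proof -
      have "harm J \<le> 1 + ln (real J)" 
        using euler_mascheroni_sequence_decreasing[of 1 J] J by (auto simp: harm_def)
      also have "ln (real J) \<le> ln (3 * ln x)" using J lnx by (intro ln_mono) auto
      also have "\<dots> = ln 3 + lam" using lnx by (simp add: ln_mult_pos lam_def)
      also have "ln (3::real) \<le> 2" using ln_le_minus_one[of "3::real"] by simp
      finally show ?thesis using lam by simp
    qed
    define X where "X = 2 * (ln (real Y2 - 1) + 2) / (real Y2 - 1)"
    have XX0: "X \<le> X0 t"
    proof -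
      have "ln (real Y2 - 1) \<le> ln (real Y2)" using Y2 by (intro ln_mono) auto
      hence "ln (real Y2 - 1) \<le> t + s + 1" using l2u by (rule order.trans)
      hence "2 * (ln (real Y2 - 1) + 2) \<le> 2 * (t + s + 3)" by (intro mult_left_mono) simp_all
      moreover have "exp (t + s) / 2 \<le> real Y2 - 1" using Y2 x2 by linarith
      ultimately have "X \<le> 2 * (t + s + 3) / (exp (t + s) / 2)"
        unfolding X_def using t4 s2 by (intro frac_le) auto
      thus ?thesis by (simp add: X0_def s_def)
    qed
    have X0: "X \<ge> 0" unfolding X_def using Y2 by (intro divide_nonneg_nonneg mult_nonneg_nonneg add_nonneg_nonneg ln_ge_zero) auto
    have W: "exp (X + 18 * harm J * (exp X - 1)) - 1 \<le> 1 / s"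
    proof -
      have "18 * harm J * (exp X - 1) \<le> 18 * (exp t + 3) * (exp (X0 t) - 1)"
        using hJ XX0 X0 by (intro mult_mono) (auto intro: harm_nonneg)
      hence "exp (X + 18 * harm J * (exp X - 1)) \<le> exp (X0 t + 18 * (exp t + 3) * (exp (X0 t) - 1))"
        using XX0 by simp
      hence "exp (X + 18 * harm J * (exp X - 1)) - 1 \<le> exp (X0 t + 18 * (exp t + 3) * (exp (X0 t) - 1)) - 1"
        by (rule diff_right_mono)
      also have "\<dots> \<le> 1 / s" using elim unfolding t_def s_def by blast
      finally show ?thesis .
    qed
    \<comment> \<open>The mean of the missing weights is at most \<open>48 = 6 * 8\<close> times
      \<open>exp (t - s) / exp t\<close>.\<close>
    have a: "6 * real Y1 / (lam / 8) \<le> 1 / s"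
    proof -
      have "6 * real Y1 / (lam / 8) \<le> 6 * exp (t - s) / (lam / 8)"
        using Y1 lam0 by (intro divide_right_mono) auto
      also have "\<dots> = 48 * exp (- s)" by (simp add: lam exp_diff exp_minus field_simps)
      finally show ?thesis using elim by (simp add: t_def s_def)
    qed
    have ips: "inv_prime_sum p N \<ge> (lam / 8) / real p" if "prime p" "p < Y1" for p
    proof (rule inv_prime_sum_ge_main[OF that(1) _ lam lam4 lnN])
      show "real p \<le> exp (t - sqrt t)" using that Y1 by (simp add: s_def)
    qed (use elim t4 in \<open>auto simp: t_def\<close>)
    have "(\<Sum>n=1..N. \<bar>K n - T\<bar>) \<le> real N * (\<bar>prime_ratio_prod Y2 - T\<bar> + \<bar>prime_ratio_prod Y1 - T\<bar> +
     prime_ratio_prod Y2 * (exp (X + 18 * harm J * (exp X - 1)) - 1) + prime_ratio_prod Y1 * (6 * real Y1 / (lam / 8)))"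
      unfolding X_def by (rule sum_abs_diff_le[OF NJ Y2(3) _ ips]) (use lam0 in auto)
    also have "\<dots> \<le> real N * (C * (t * s) + C * (t * s) + D * t\<^sup>2 * (1 / s) + D * t\<^sup>2 * (1 / s))"
    proof (intro mult_left_mono add_mono M1 M2 mult_mono Mb W a)
      have "D \<ge> 0" using C mean_const_pos by (simp add: D_def)
      thus "0 \<le> D * t\<^sup>2" "0 \<le> D * t\<^sup>2" by auto
      show "0 \<le> exp (X + 18 * harm J * (exp X - 1)) - 1" using X0 by (simp add: harm_nonneg)
    qed (use lam0 in auto)
    also have "t\<^sup>2 * (1 / s) = t * s" using st s2 by (simp add: power2_eq_square field_simps)
    hence "real N * (C * (t * s) + C * (t * s) + D * t\<^sup>2 * (1 / s) + D * t\<^sup>2 * (1 / s)) = real N * ((2 * C + 2 * D) * (t * s))"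
      by (simp add: algebra_simps)
    also have "t * s = t powr (3/2)"
    proof -
      have "t powr (3/2) = t powr (1 + 1/2)" by simp
      also have "\<dots> = t * s" unfolding powr_add using t4 by (simp add: s_def powr_half_sqrt)
      finally show ?thesis by simp
    qed
    also have "real N * ((2 * C + 2 * D) * t powr (3/2)) \<le> x * ((2 * C + 2 * D) * t powr (3/2))"
      using Nx C mean_const_pos by (intro mult_right_mono mult_nonneg_nonneg) (auto simp: D_def)
    finally show ?case by (simp add: N_def T_def t_def mult_ac)
  qed
qed

lemma K_mean_value:
  "(\<lambda>x::real. (1 / x) * (\<Sum>n\<in>{1..nat \<lfloor>x\<rfloor>}. K n) - mean_const * (log3 x)\<^sup>2) \<in> O[at_top](\<lambda>x. (log3 x) powr (3/2))"
proof -
  obtain C where C: "\<forall>\<^sub>F x::real in at_top. (\<Sum>n=1..nat \<lfloor>x\<rfloor>. \<bar>K n - mean_const * (log3 x)\<^sup>2\<bar>) \<le> C * x * (log3 x powr (3/2))"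
    using mean_abs_deviation by blast
  \<comment> \<open>This pays for replacing the number of terms
    \<open>nat \<lfloor>x\<rfloor>\<close> by \<open>x\<close>.\<close>
  have e1: "\<forall>\<^sub>F x::real in at_top. (log3 x)\<^sup>2 / x \<le> log3 x powr (3/2)" unfolding log3_def by real_asymp
  show ?thesis
  proof (rule bigoI[of _ "C + mean_const"], use C e1 eventually_ge_at_top[of "1::real"] in eventually_elim)
    case (elim x)
    define T where "T = mean_const * (log3 x)\<^sup>2"
    define N where "N = nat \<lfloor>x\<rfloor>"
    have N: "real N \<le> x" "x - 1 \<le> real N" using elim unfolding N_def by linarith+
    have T0: "T \<ge> 0" using mean_const_pos by (simp add: T_def)
    have "\<bar>(\<Sum>n=1..N. K n) - real N * T\<bar> = \<bar>\<Sum>n=1..N. K n - T\<bar>" by (simp add: sum_subtractf)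
    also have "\<dots> \<le> (\<Sum>n=1..N. \<bar>K n - T\<bar>)" by (rule sum_abs)
    also have "\<dots> \<le> C * x * (log3 x powr (3/2))" using elim by (simp add: T_def N_def)
    finally have 1: "\<bar>(\<Sum>n=1..N. K n) - real N * T\<bar> \<le> C * x * (log3 x powr (3/2))" .
    have "\<bar>real N * T - x * T\<bar> = (x - real N) * T" using N T0 by (simp add: abs_mult flip: left_diff_distrib)
    also have "\<dots> \<le> 1 * T" using N T0 by (intro mult_right_mono) auto
    finally have "\<bar>(\<Sum>n=1..N. K n) - x * T\<bar> \<le> C * x * (log3 x powr (3/2)) + T" using 1 by linarith
    hence "\<bar>(\<Sum>n=1..N. K n) - x * T\<bar> / x \<le> (C * x * (log3 x powr (3/2)) + T) / x"
      using elim by (intro divide_right_mono) auto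
    also have "\<bar>(\<Sum>n=1..N. K n) - x * T\<bar> / x = \<bar>(1 / x) * (\<Sum>n=1..N. K n) - T\<bar>"
    proof -
      have "(1 / x) * (\<Sum>n=1..N. K n) - T = ((\<Sum>n=1..N. K n) - x * T) / x" using elim by (simp add: field_simps)
      thus ?thesis using elim by simp
    qed
    also have "(C * x * (log3 x powr (3/2)) + T) / x = C * (log3 x powr (3/2)) + mean_const * ((log3 x)\<^sup>2 / x)"
      using elim by (simp add: T_def field_simps)
    also have "\<dots> \<le> C * (log3 x powr (3/2)) + mean_const * (log3 x powr (3/2))"
      using elim mean_const_pos by (intro add_left_mono mult_left_mono) auto
    finally show ?case by (simp add: T_def N_def algebra_simps)
  qed
qed

definition typical :: "nat set" where
  "typical = {n. n \<ge> 1 \<and> \<bar>K n / (mean_const * (log3 (real n))\<^sup>2) - 1\<bar> \<le> log3 (real n) powr (-1/4)}"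

lemma K_normal_order:
  "((\<lambda>n. K n / (mean_const * (log3 (real n))\<^sup>2)) \<longlongrightarrow> 1) (inf sequentially (principal typical))"
proof -
  have "((\<lambda>n::nat. log3 (real n) powr (-1/4)) \<longlongrightarrow> 0) sequentially" unfolding log3_def by real_asymp
  hence "((\<lambda>n::nat. log3 (real n) powr (-1/4)) \<longlongrightarrow> 0) (inf sequentially (principal typical))"
    by (rule tendsto_mono[OF inf_le1])
  hence "((\<lambda>n. K n / (mean_const * (log3 (real n))\<^sup>2) - 1) \<longlongrightarrow> 0) (inf sequentially (principal typical))"
    by (rule Lim_null_comparison[rotated]) (auto simp: eventually_inf_principal typical_def)
  thus ?thesis by (simp add: LIM_zero_iff)
qed

lemma card_atypical_le:
  "\<exists>C. \<forall>\<^sub>F N::nat in sequentially. real (card ({1..N} - typical)) \<le> sqrt (real N) + C * real N * log3 (real N) powr (-1/4)"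
proof -
  obtain C where "\<forall>\<^sub>F x::real in at_top. (\<Sum>n=1..nat \<lfloor>x\<rfloor>. \<bar>K n - mean_const * (log3 x)\<^sup>2\<bar>) \<le> C * x * (log3 x powr (3/2))"
    using mean_abs_deviation by blast
  from eventually_compose_filterlim[OF this filterlim_real_sequentially]
  have C: "\<forall>\<^sub>F N::nat in sequentially. (\<Sum>n=1..N. \<bar>K n - mean_const * (log3 (real N))\<^sup>2\<bar>) \<le> C * real N * (log3 (real N) powr (3/2))"
    by simp
  have e1: "\<forall>\<^sub>F N::nat in sequentially. log3 (real N) - 1 \<le> ln (ln (ln (real N) / 2))" unfolding log3_def by real_asymp
  have e2: "\<forall>\<^sub>F N::nat in sequentially. ln (ln (real N) / 2) \<ge> 1" by real_asymp
  \<comment> \<open>Half of the deviation pays for replacing \<open>log3 n\<close> by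
    \<open>log3 N\<close> in the main term.\<close>
  have e3: "\<forall>\<^sub>F t::real in at_top. t powr (7/4) / 4 - 2 * t \<ge> t powr (7/4) / 8" by real_asymp
  have e4: "\<forall>\<^sub>F N::nat in sequentially. log3 (real N) \<ge> 2" unfolding log3_def by real_asymp
  have f3: "filterlim (\<lambda>N::nat. log3 (real N)) at_top sequentially" unfolding log3_def by real_asymp
  show ?thesis
  proof (intro exI[of _ "8 * C / mean_const"], use C e1 e2 e4 eventually_compose_filterlim[OF e3 f3] eventually_ge_at_top[of 1] in eventually_elim)
    case (elim N)
    define L where "L = log3 (real N)"
    define B where "B = {n \<in> {1..N} - typical. real n > sqrt (real N)}"
    define m where "m = mean_const * (L powr (7/4) / 8)"
    have L2: "L \<ge> 2" using elim by (simp add: L_def)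
    have m0: "m > 0" using mean_const_pos L2 by (simp add: m_def)
    have dev: "\<bar>K n - mean_const * L\<^sup>2\<bar> \<ge> m" if "n \<in> B" for n
    proof -
      have n: "n \<ge> 1" "n \<le> N" "n \<notin> typical" "real n > sqrt (real N)" using that by (auto simp: B_def)
      define l where "l = log3 (real n)"
      have "ln (sqrt (real N)) \<le> ln (real n)" using n elim by (intro ln_mono) auto
      hence lh: "ln (real N) / 2 \<le> ln (real n)" using elim by (simp add: ln_sqrt)
      have pos: "ln (real N) / 2 > 0"
      proof (rule ccontr)
        assume "\<not> ln (real N) / 2 > 0"
        hence "ln (real N) / 2 = 0" using elim by (cases "N = 0") auto
        thus False using elim by simp
      qed
      have "ln (ln (real N) / 2) \<le> ln (ln (real n))" using lh pos by (intro ln_mono) auto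
      hence "ln (ln (ln (real N) / 2)) \<le> l" unfolding l_def log3_def
        by (rule ln_mono) (use \<open>ln (ln (real N) / 2) \<le> ln (ln (real n))\<close> elim in linarith)+
      hence lL: "L - 1 \<le> l" using elim by (simp add: L_def)
      have "l \<le> L"
      proof -
        have le: "ln (real n) \<le> ln (real N)" using n by (intro ln_mono) auto
        have pos1: "ln (real n) > 0" using lh pos by linarith
        have pos2: "ln (ln (real n)) > 0" using \<open>ln (ln (real N) / 2) \<le> ln (ln (real n))\<close> elim by linarith
        show ?thesis unfolding l_def L_def log3_def by (rule ln_mono[OF ln_mono[OF le pos1] pos2])
      qed
      have l1: "l \<ge> L / 2" "l > 0" using lL L2 by linarith+
      have "\<bar>K n / (mean_const * l\<^sup>2) - 1\<bar> > l powr (-1/4)" using n by (auto simp: typical_def l_def)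
      hence "(mean_const * l\<^sup>2) * \<bar>K n / (mean_const * l\<^sup>2) - 1\<bar> \<ge> (mean_const * l\<^sup>2) * l powr (-1/4)"
        using mean_const_pos by (intro mult_left_mono) auto
      also have "(mean_const * l\<^sup>2) * \<bar>K n / (mean_const * l\<^sup>2) - 1\<bar> = \<bar>K n - mean_const * l\<^sup>2\<bar>"
      proof -
        have "K n - mean_const * l\<^sup>2 = (mean_const * l\<^sup>2) * (K n / (mean_const * l\<^sup>2) - 1)"
          using mean_const_pos l1 by (simp add: field_simps)
        thus ?thesis using mean_const_pos by (simp add: abs_mult)
      qed
      also have "(mean_const * l\<^sup>2) * l powr (-1/4) = mean_const * l powr (7/4)"
      proof -
        have "l\<^sup>2 = l powr 2" using l1 by (simp add: powr_numeral)
        thus ?thesis by (simp add: powr_add[symmetric])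
      qed
      finally have 1: "mean_const * l powr (7/4) \<le> \<bar>K n - mean_const * l\<^sup>2\<bar>" .
      \<comment> \<open>Passing from \<open>l\<close> to \<open>L\<close> by
        \<open>l \<ge> L / 2\<close> costs the factor \<open>2 powr (7 / 4)\<close>, at most
        4.\<close>
      have "(2::real) powr (7/4) \<le> 2 powr 2" by (intro powr_mono) auto
      hence "L powr (7/4) / 4 \<le> L powr (7/4) / 2 powr (7/4)" by (intro divide_left_mono) auto
      also have "\<dots> = (L / 2) powr (7/4)" using L2 by (simp add: powr_divide)
      also have "\<dots> \<le> l powr (7/4)" using l1 L2 by (intro powr_mono2) auto
      finally have 2: "mean_const * (L powr (7/4) / 4) \<le> mean_const * l powr (7/4)" using mean_const_pos by (intro mult_left_mono) auto
      have "L\<^sup>2 - l\<^sup>2 = (L - l) * (L + l)" by (simp add: power2_eq_square algebra_simps)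
      also have "\<dots> \<le> 1 * (2 * L)" using lL \<open>l \<le> L\<close> L2 l1 by (intro mult_mono) auto
      finally have "L\<^sup>2 - l\<^sup>2 \<le> 2 * L" by simp
      moreover have "L\<^sup>2 - l\<^sup>2 \<ge> 0" using \<open>l \<le> L\<close> l1 by (simp add: power_mono)
      ultimately have "\<bar>mean_const * L\<^sup>2 - mean_const * l\<^sup>2\<bar> \<le> mean_const * (2 * L)"
        using mean_const_pos by (simp add: abs_mult flip: right_diff_distrib)
      moreover have "m \<le> mean_const * (L powr (7/4) / 4 - 2 * L)"
        unfolding m_def using elim mean_const_pos by (intro mult_left_mono) (auto simp: L_def)
      ultimately show ?thesis using 1 2 by (simp add: right_diff_distrib)
    qed
    have "real (card B) * m = (\<Sum>n\<in>B. m)" by simp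
    also have "\<dots> \<le> (\<Sum>n\<in>B. \<bar>K n - mean_const * L\<^sup>2\<bar>)" by (intro sum_mono dev)
    also have "\<dots> \<le> (\<Sum>n=1..N. \<bar>K n - mean_const * L\<^sup>2\<bar>)" by (intro sum_mono2) (auto simp: B_def)
    also have "\<dots> \<le> C * real N * (L powr (3/2))" using elim by (simp add: L_def)
    finally have "real (card B) \<le> C * real N * (L powr (3/2)) / m" using m0 by (simp add: field_simps)
    also have "\<dots> = 8 * C / mean_const * real N * (L powr (3/2) / L powr (7/4))" by (simp add: m_def)
    also have "L powr (3/2) / L powr (7/4) = L powr (-1/4)" by (simp add: powr_diff[symmetric])
    finally have B: "real (card B) \<le> 8 * C / mean_const * real N * L powr (-1/4)" .
    have "card ({1..N} - typical) \<le> card ({1..nat \<lfloor>sqrt (real N)\<rfloor>} \<union> B)"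
    proof (rule card_mono)
      show "{1..N} - typical \<subseteq> {1..nat \<lfloor>sqrt (real N)\<rfloor>} \<union> B"
      proof
        fix n assume n: "n \<in> {1..N} - typical"
        show "n \<in> {1..nat \<lfloor>sqrt (real N)\<rfloor>} \<union> B"
        proof (cases "real n > sqrt (real N)")
          case False
          hence "n \<le> nat \<lfloor>sqrt (real N)\<rfloor>" by (simp add: le_nat_floor)
          thus ?thesis using n by auto
        qed (use n in \<open>auto simp: B_def\<close>)
      qed
    qed (auto simp: B_def)
    also have "\<dots> \<le> card {1..nat \<lfloor>sqrt (real N)\<rfloor>} + card B" by (rule card_Un_le)
    also have "card {1..nat \<lfloor>sqrt (real N)\<rfloor>} = nat \<lfloor>sqrt (real N)\<rfloor>" by simp
    finally have "real (card ({1..N} - typical)) \<le> real (nat \<lfloor>sqrt (real N)\<rfloor>) + real (card B)"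
      by (simp only: of_nat_add[symmetric] of_nat_le_iff)
    also have "real (nat \<lfloor>sqrt (real N)\<rfloor>) \<le> sqrt (real N)" by simp
    finally show ?case using B by (simp add: L_def)
  qed
qed

lemma typical_density: "((\<lambda>N. real (card (typical \<inter> {1..N})) / real N) \<longlongrightarrow> 1) sequentially"
proof -
  obtain C where C: "\<forall>\<^sub>F N::nat in sequentially. real (card ({1..N} - typical)) \<le> sqrt (real N) + C * real N * log3 (real N) powr (-1/4)"
    using card_atypical_le by blast
  have l1: "(\<lambda>N::nat. sqrt (real N) / real N) \<longlonglongrightarrow> 0" by real_asymp
  have l2: "(\<lambda>N::nat. log3 (real N) powr (-1/4)) \<longlonglongrightarrow> 0" unfolding log3_def by real_asymp
  have "(\<lambda>N::nat. 1 - (sqrt (real N) / real N + C * log3 (real N) powr (-1/4))) \<longlonglongrightarrow> 1 - (0 + C * 0)"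
    by (intro tendsto_intros l1 l2)
  hence lim: "(\<lambda>N::nat. 1 - (sqrt (real N) / real N + C * log3 (real N) powr (-1/4))) \<longlonglongrightarrow> 1"
    by (simp only: mult_zero_right add_0_right diff_zero)
  have eq: "real (card (typical \<inter> {1..N})) / real N = 1 - real (card ({1..N} - typical)) / real N" if "N \<ge> 1" for N
  proof -
    have "card ({1..N} - typical) = card {1..N} - card ({1..N} \<inter> typical)" by (rule card_Diff_subset_Int) auto
    moreover have "card ({1..N} \<inter> typical) \<le> card {1..N}" by (intro card_mono) auto
    ultimately have "real (card ({1..N} - typical)) = real N - real (card (typical \<inter> {1..N}))"
      by (simp add: of_nat_diff Int_commute)
    thus ?thesis using that by (simp add: field_simps)
  qed
  show ?thesis
  proof (rule tendsto_sandwich[OF _ _ lim tendsto_const])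
    show "\<forall>\<^sub>F N in sequentially. real (card (typical \<inter> {1..N})) / real N \<le> 1"
    proof (intro always_eventually allI)
      fix N :: nat
      have "card (typical \<inter> {1..N}) \<le> card {1..N}" by (intro card_mono) auto
      thus "real (card (typical \<inter> {1..N})) / real N \<le> 1" by (simp add: divide_le_eq)
    qed
    show "\<forall>\<^sub>F N in sequentially. 1 - (sqrt (real N) / real N + C * log3 (real N) powr (- 1 / 4)) \<le> real (card (typical \<inter> {1..N})) / real N"
      using C eventually_ge_at_top[of 1]
    proof eventually_elim
      case (elim N)
      have "real (card ({1..N} - typical)) / real N \<le> (sqrt (real N) + C * real N * log3 (real N) powr (-1/4)) / real N"
        using elim by (intro divide_right_mono) auto
      also have "\<dots> = sqrt (real N) / real N + C * log3 (real N) powr (-1/4)" using elim by (simp add: add_divide_distrib)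
      finally show ?case using eq[OF elim(2)] by simp
    qed
  qed
qed

theorem theorem1p3:
  shows "((\<lambda>x::real. (1 / x) * (\<Sum>n\<in>{1..nat \<lfloor>x\<rfloor>}. K n)
            - 6 / pi\<^sup>2 * exp (2 * euler_mascheroni) * (log3 x)\<^sup>2)
          \<in> O[at_top](\<lambda>x. (log3 x) powr (3/2))) \<and>
    (\<exists>S :: nat set. S \<subseteq> {1..} \<and>
           ((\<lambda>N. real (card (S \<inter> {1..N})) / real N) \<longlongrightarrow> 1) sequentially \<and>
           ((\<lambda>n. K n / (6 / pi\<^sup>2 * exp (2 * euler_mascheroni) * (log3 (real n))\<^sup>2)) \<longlongrightarrow> 1)
             (inf sequentially (principal S)))"
proof (intro conjI exI[of _ typical])
  show "typical \<subseteq> {1..}" by (auto simp: typical_def)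
qed (use K_mean_value K_normal_order typical_density in \<open>simp_all add: mean_const_def\<close>)

end
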